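(* Let $n\ge 1$ be an integer. For $t>0$ and $\tilde x\in\mathbb{R}^n$ set $$u_{\tilde x,t}(x)=\beta_n\Big(\frac{t}{t^2+|x-\tilde x|^2}\Big)^{\frac n2},\quad x\in\mathbb{R}^n,\qquad \beta_n=2^{\frac n2}e^{\frac n2\psi(\frac n2)}.$$ Then the set of all solutions of the problem $$\mathcal{L}_\Delta u=\tfrac4n\,u\ln u\ \text{ in }\mathbb{R}^n,\qquad u\ge 0,\ u\not\equiv 0\ \text{ in }\mathbb{R}^n,$$ is exactly $\{u_{\tilde x,t}: t>0,\ \tilde x\in\mathbb{R}^n\}$.
   Context: Here $\psi=\Gamma'/\Gamma$ is the digamma function and $\gamma=-\Gamma'(1)$ is the Euler–Mascheroni constant. The logarithmic Laplacian in $\mathbb{R}^n$ is $$\mathcal{L}_\Delta u(x)=c_n\int_{\mathbb{R}^n}\frac{u(x)1_{B_1(x)}(y)-u(y)}{|x-y|^n}\,dy+\rho_n u(x),\qquad c_n=\pi^{-n/2}\Gamma(n/2),\quad \rho_n=2\ln2+\psi(\tfrac n2)-\gamma,$$ where $B_1(x)$ is the unit ball centered at $x$. The function $t\mapsto t\ln t$ on $[0,\infty)$ takes the value $0$ at $t=0$. $L^1_0(\mathbb{R}^n)$ is the space of measurable $u$ with $\int_{\mathbb{R}^n}\frac{|u(x)|}{1+|x|^n}dx<\infty$. A function $u$ is Dini continuous at $x$ if $\int_0^1\frac{\varpi_{u,x}(r)}{r}dr<\infty$, where $\varpi_{u,x}(r)=\sup_{y\in\mathbb{R}^n,\,|y-x|\le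 r}|u(y)-u(x)|$. $\mathcal{D}^0(\mathbb{R}^n)$ is the set of functions that are Dini continuous at every $x\in\mathbb{R}^n$. A solution is a nonnegative function $u\in L^1_0(\mathbb{R}^n)\cap\mathcal{D}^0(\mathbb{R}^n)$, $u\not\equiv0$, satisfying the equation pointwise. *)

theory Defs
  imports "HOL-Analysis.Analysis"
begin

definition log_lap_c :: "nat \<Rightarrow> real" where
  "log_lap_c n = pi powr (- real n / 2) * Gamma (real n / 2)"

definition log_lap_rho :: "nat \<Rightarrow> real" where
  "log_lap_rho n = 2 * ln 2 + Digamma (real n / 2) - euler_mascheroni"

text \<open>For functions in \<open>L10\<close> that are Dini continuous at \<open>x\<close> the integrand below is absolutely
  integrable, so the convention that the Bochner integral of a non-integrable function is \<open>0\<close>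
  plays no role for the solutions considered here. Division by zero makes the integrand \<open>0\<close> at
  the single point \<open>y = x\<close>.\<close>

definition log_laplacian :: "('a::euclidean_space \<Rightarrow> real) \<Rightarrow> 'a \<Rightarrow> real" where
  "log_laplacian u x =
     log_lap_c DIM('a) *
       (LINT y|lebesgue. (u x * indicator (ball x 1) y - u y) / norm (x - y) ^ DIM('a))
     + log_lap_rho DIM('a) * u x"

definition L10 :: "('a::euclidean_space \<Rightarrow> real) set" where
  "L10 = {u. u \<in> borel_measurable lebesgue \<and>
             (\<integral>\<^sup>+x. ennreal (\<bar>u x\<bar> / (1 + norm x ^ DIM('a))) \<partial>lebesgue) < \<infinity>}"

text \<open>The modulus of continuity is extended-valued, as the supremum may be infinite.\<close>

definition modulus_at :: "('a::euclidean_space \<Rightarrow> real) \<Rightarrow> 'a \<Rightarrow> real \<Rightarrow> ennreal" where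
  "modulus_at u x r = (SUP y\<in>cball x r. ennreal \<bar>u y - u x\<bar>)"

definition Dini_continuous_at :: "('a::euclidean_space \<Rightarrow> real) \<Rightarrow> 'a \<Rightarrow> bool" where
  "Dini_continuous_at u x \<longleftrightarrow>
     (\<integral>\<^sup>+r\<in>{0<..<1}. (modulus_at u x r / ennreal r) \<partial>lborel) < \<infinity>"

definition Dini_space :: "('a::euclidean_space \<Rightarrow> real) set" where
  "Dini_space = {u. \<forall>x. Dini_continuous_at u x}"

text \<open>The product \<open>u x * ln (u x)\<close> is \<open>0\<close> where \<open>u x = 0\<close>, which is the convention for
  \<open>t ln t\<close> at \<open>t = 0\<close>.\<close>

definition log_lap_solution :: "('a::euclidean_space \<Rightarrow> real) \<Rightarrow> bool" where
  "log_lap_solution u \<longleftrightarrow>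
     u \<in> L10 \<inter> Dini_space \<and> (\<forall>x. u x \<ge> 0) \<and> (\<exists>x. u x \<noteq> 0) \<and>
     (\<forall>x. log_laplacian u x = 4 / real DIM('a) * (u x * ln (u x)))"

definition bubble_const :: "nat \<Rightarrow> real" where
  "bubble_const n = 2 powr (real n / 2) * exp (real n / 2 * Digamma (real n / 2))"

definition bubble :: "'a::euclidean_space \<Rightarrow> real \<Rightarrow> 'a \<Rightarrow> real" where
  "bubble z t x =
     bubble_const DIM('a) * (t / (t\<^sup>2 + (norm (x - z))\<^sup>2)) powr (real DIM('a) / 2)"

end

theory Submission
  imports Defs
begin

text \<open>Let \<open>b\<close> be the bubble with centre \<open>a\<close> and parameter \<open>l\<close>, and let \<open>U = u / b\<close>. Since \<open>b\<close> solves
  the equation, \<open>u\<close> solves it if and only if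
  \<open>c * integral of (U x - U y) * b y / norm (x - y) ^ n dy = 4 / n * b x * U x * ln (U x)\<close>.
  No regularisation is left here, and the identity is exactly invariant under the inversion in the
  sphere of radius \<open>l\<close> around \<open>a\<close>. This allows the method of moving spheres: \<open>u\<close> is compared with
  its Kelvin transform inside the ball. A negative minimum of their difference, suitably weighted,
  is impossible if \<open>l\<close> is small, because then \<open>ln U\<close> is very negative, and also if the set where the
  difference is negative has small measure, because \<open>norm (x - y) powr - n\<close> is not integrable at
  \<open>x\<close>. Either \<open>u\<close> is constant, which \<open>L10\<close> excludes, or \<open>u\<close> is symmetric with respect to a sphere
  of some radius \<open>l a\<close> around every point \<open>a\<close>; in the latter case \<open>(l a)\<^sup>2\<close> is a quadratic polynomial
  in \<open>a\<close>, which makes \<open>u\<close> a multiple of a bubble. That bubbles are solutions is a radial integral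
  at the centre; an inversion preserving the bubble carries it to every other point.\<close>

section \<open>Radial integration\<close>

text \<open>The factor \<open>4 / n\<close> is the conformally natural one: an inversion multiplies
  values by \<open>\<mu> ^ n\<close>, which adds \<open>n * ln \<mu>\<close> to their logarithm, and
  it adds exactly \<open>4 * ln \<mu>\<close> times the value to the operator. Comparison then meets
  two obstacles. The function \<open>t * ln t\<close> decreases only for
  \<open>t < exp (-1)\<close>, so the right-hand side has the favourable sign only where
  \<open>U\<close> is small; elsewhere the singularity of the kernel has to supply the sign. And
  nothing beyond \<open>L10\<close> is known about \<open>u\<close> at infinity, so the Kelvin
  transform may behave wildly near the centre of the inversion, and a minimum of the gap need not be
  attained. Only a lower bound is available there: the transform is positive and \<open>u\<close> is
  bounded, so the gap times a positive power of the distance to the centre does attain a negative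
  minimum. The price is an error term whose integral is scale invariant, hence at most a fixed
  multiple of \<open>sphere_area n\<close>. This constant is what the logarithm or the singular
  kernel must outweigh.\<close>

definition sphere_area :: "nat \<Rightarrow> real" where
  "sphere_area n = real n * unit_ball_vol (real n)"

lemma sphere_area_pos: "0 < n \<Longrightarrow> 0 < sphere_area n"
  by (simp add: sphere_area_def)

lemma log_lap_c_pos: "0 < n \<Longrightarrow> 0 < log_lap_c n"
  by (simp add: log_lap_c_def Gamma_real_pos)

text \<open>Source of the explicit constants below: an annulus with radii \<open>r\<close> and
  \<open>R\<close> has weight \<open>2 * ln (R / r)\<close> under the normalised kernel. This
  produces the \<open>4 * ln \<mu>\<close> of the conformal law and turns
  \<open>8 * sphere_area n\<close> into 16.\<close>

lemma log_lap_c_sphere_area: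
  assumes "0 < n"
  shows "log_lap_c n * sphere_area n = 2"
proof -
  have G: "Gamma (real n / 2 + 1) = real n / 2 * Gamma (real n / 2)"
    using assms by (intro Gamma_plus1) (auto simp: nonpos_Ints_def)
  have g0: "Gamma (real n / 2) \<noteq> 0" using assms by (intro less_imp_neq[symmetric] Gamma_real_pos) simp
  have "pi powr (- real n / 2) * pi powr (real n / 2) = 1"
    by (simp flip: powr_add)
  with g0 assms show ?thesis
    unfolding log_lap_c_def sphere_area_def unit_ball_vol_def G by (simp add: field_simps)
qed

text \<open>Polar coordinates for radial functions, in the form of an image measure so that they
  serve both kinds of integral. On the generating half-lines the claim is the volume of a ball,
  recovered from its derivative in the radius.\<close>

lemma distr_norm_lborel:
  fixes c :: "'a::euclidean_space"
  shows "distr lborel borel (\<lambda>y. norm (y - c)) =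
    density lborel (\<lambda>r. ennreal (sphere_area DIM('a) * r ^ (DIM('a) - 1) * indicator {0..} r))"
    (is "?M = ?N")
proof (rule measure_eqI_generator_eq)
  let ?E = "range (\<lambda>x::real. {..x})"
  show "Int_stable ?E" by (auto simp: Int_stable_def)
  show "sets ?M = sigma_sets UNIV ?E" "sets ?N = sigma_sets UNIV ?E"
    by (simp_all add: borel_eq_atMost)
  show "range (\<lambda>i::nat. {..real i}) \<subseteq> ?E" by auto
  show "(\<Union>i::nat. {..real i}) = UNIV" by (auto intro: real_arch_simple)
  have M: "emeasure ?M {..x} = (if x < 0 then 0 else ennreal (unit_ball_vol (real DIM('a)) * x ^ DIM('a)))" for x
  proof -
    have "(\<lambda>y. norm (y - c)) -` {..x} = (if x < 0 then {} else cball c x)"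
      by (auto simp: dist_norm norm_minus_commute) (meson le_less_trans norm_ge_zero not_less)
    then show ?thesis by (simp add: emeasure_distr emeasure_cball)
  qed
  show "emeasure ?M {..real i} \<noteq> \<infinity>" for i :: nat by (simp add: M)
  fix X assume "X \<in> ?E"
  then obtain x where X: "X = {..x}" by auto
  have "emeasure ?N {..x} = (\<integral>\<^sup>+r. ennreal (sphere_area DIM('a) * r ^ (DIM('a) - 1)) * indicator {0..x} r \<partial>lborel)"
    by (subst emeasure_density) (auto intro!: nn_integral_cong simp: indicator_def)
  also have "\<dots> = (if x < 0 then 0 else ennreal (unit_ball_vol (real DIM('a)) * x ^ DIM('a)))"
  proof (cases "x < 0")
    case False
    have "(\<integral>\<^sup>+r. ennreal (sphere_area DIM('a) * r ^ (DIM('a) - 1)) * indicator {0..x} r \<partial>lborel)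
       = ennreal (unit_ball_vol (real DIM('a)) * x ^ DIM('a) - unit_ball_vol (real DIM('a)) * 0 ^ DIM('a))"
      using False
      by (intro nn_integral_FTC_Icc)
         (auto intro!: derivative_eq_intros simp: sphere_area_def)
    then show ?thesis using False by simp
  qed auto
  finally show "emeasure ?M X = emeasure ?N X" by (simp add: M X)
qed auto

lemma nn_integral_radial:
  fixes c :: "'a::euclidean_space" and g :: "real \<Rightarrow> ennreal"
  assumes [measurable]: "g \<in> borel_measurable borel"
  shows "(\<integral>\<^sup>+y. g (norm (y - c)) \<partial>lborel) =
    (\<integral>\<^sup>+r. ennreal (sphere_area DIM('a) * r ^ (DIM('a) - 1) * indicator {0..} r) * g r \<partial>lborel)"
proof -
  have "(\<integral>\<^sup>+y. g (norm (y - c)) \<partial>lborel) = (\<integral>\<^sup>+r. g r \<partial>distr lborel borel (\<lambda>y. norm (y - c)))"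
    by (subst nn_integral_distr) auto
  also have "\<dots> = (\<integral>\<^sup>+r. ennreal (sphere_area DIM('a) * r ^ (DIM('a) - 1) * indicator {0..} r) * g r \<partial>lborel)"
    unfolding distr_norm_lborel by (subst nn_integral_density) auto
  finally show ?thesis .
qed

text \<open>The critical power cancels the Jacobian \<open>r ^ (n - 1)\<close> up to
  \<open>1 / r\<close>. What remains is the measure of the Dini condition, the same in every
  dimension.\<close>

lemma nn_integral_radial_div:
  fixes c :: "'a::euclidean_space" and g :: "real \<Rightarrow> ennreal"
  assumes [measurable]: "g \<in> borel_measurable borel"
  shows "(\<integral>\<^sup>+y. g (norm (y - c)) * ennreal (1 / norm (y - c) ^ DIM('a)) \<partial>lborel) =
    ennreal (sphere_area DIM('a)) * (\<integral>\<^sup>+r\<in>{0<..}. g r * ennreal (1 / r) \<partial>lborel)"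
proof -
  have n: "DIM('a) > 0" by simp
  have "(\<integral>\<^sup>+y. g (norm (y - c)) * ennreal (1 / norm (y - c) ^ DIM('a)) \<partial>lborel)
     = (\<integral>\<^sup>+r. ennreal (sphere_area DIM('a) * r ^ (DIM('a) - 1) * indicator {0..} r) * (g r * ennreal (1 / r ^ DIM('a))) \<partial>lborel)"
    by (rule nn_integral_radial) measurable
  also have "\<dots> = (\<integral>\<^sup>+r. ennreal (sphere_area DIM('a)) * (g r * ennreal (1 / r) * indicator {0<..} r) \<partial>lborel)"
  proof (rule nn_integral_cong)
    fix r :: real
    show "ennreal (sphere_area DIM('a) * r ^ (DIM('a) - 1) * indicator {0..} r) * (g r * ennreal (1 / r ^ DIM('a)))
      = ennreal (sphere_area DIM('a)) * (g r * ennreal (1 / r) * indicator {0<..} r)"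
    proof (cases "r > 0")
      case True
      have "r ^ DIM('a) = r ^ (DIM('a) - 1) * r"
        using n by (metis Suc_diff_1 power_Suc2)
      then have "r ^ (DIM('a) - 1) * (1 / r ^ DIM('a)) = 1 / r"
        using True by (simp add: field_simps)
      then have "ennreal (r ^ (DIM('a) - 1)) * ennreal (1 / r ^ DIM('a)) = ennreal (1 / r)"
        using True by (simp flip: ennreal_mult)
      moreover have "ennreal (sphere_area DIM('a) * r ^ (DIM('a) - 1)) = ennreal (sphere_area DIM('a)) * ennreal (r ^ (DIM('a) - 1))"
        using True sphere_area_pos[OF n] by (simp flip: ennreal_mult)
      ultimately show ?thesis using True by (simp add: mult_ac)
    next
      case False
      then show ?thesis by (cases "r = 0") auto
    qed
  qed
  also have "\<dots> = ennreal (sphere_area DIM('a)) * (\<integral>\<^sup>+r\<in>{0<..}. g r * ennreal (1 / r) \<partial>lborel)"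
    by (rule nn_integral_cmult) measurable
  finally show ?thesis .
qed

lemma nn_integral_annulus:
  fixes c :: "'a::euclidean_space"
  assumes "0 < r" "r \<le> R"
  shows "(\<integral>\<^sup>+y\<in>{y. r \<le> norm (y - c) \<and> norm (y - c) \<le> R}. ennreal (1 / norm (y - c) ^ DIM('a)) \<partial>lborel)
    = ennreal (sphere_area DIM('a) * ln (R / r))"
proof -
  have "(\<integral>\<^sup>+y\<in>{y. r \<le> norm (y - c) \<and> norm (y - c) \<le> R}. ennreal (1 / norm (y - c) ^ DIM('a)) \<partial>lborel)
     = (\<integral>\<^sup>+y. indicator {r..R} (norm (y - c)) * ennreal (1 / norm (y - c) ^ DIM('a)) \<partial>lborel)"
    by (intro nn_integral_cong) (auto simp: indicator_def)
  also have "\<dots> = ennreal (sphere_area DIM('a)) * (\<integral>\<^sup>+s\<in>{0<..}. indicator {r..R} s * ennreal (1 / s) \<partial>lborel)"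
    by (rule nn_integral_radial_div) auto
  also have "(\<integral>\<^sup>+s\<in>{0<..}. indicator {r..R} s * ennreal (1 / s) \<partial>lborel)
     = (\<integral>\<^sup>+s. ennreal (1 / s) * indicator {r..R} s \<partial>lborel)"
    using assms by (intro nn_integral_cong) (auto simp: indicator_def)
  also have "\<dots> = ennreal (ln R - ln r)"
    using assms by (intro nn_integral_FTC_Icc) (auto intro!: derivative_eq_intros)
  also have "ennreal (sphere_area DIM('a)) * \<dots> = ennreal (sphere_area DIM('a) * ln (R / r))"
    using assms sphere_area_pos[of "DIM('a)"] by (simp add: ln_div flip: ennreal_mult)
  finally show ?thesis .
qed

section \<open>The logarithmic Laplacian of Dini continuous functions\<close>

text \<open>Superlevel sets of a monotone function are upward closed, hence half-lines. This is all
  that is known of the extended-valued modulus of continuity.\<close>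

lemma borel_measurable_mono_ennreal:
  fixes f :: "real \<Rightarrow> ennreal"
  assumes "mono f"
  shows "f \<in> borel_measurable borel"
proof (rule borel_measurableI_greater)
  fix a
  define S where "S = {x. a < f x}"
  have up: "y \<in> S" if "x \<in> S" "x \<le> y" for x y
    using that monoD[OF assms, of x y] by (auto simp: S_def)
  have "S = {} \<or> S = UNIV \<or> (\<exists>c. S = {c..} \<or> S = {c<..})"
  proof (cases "S = {} \<or> S = UNIV")
    case False
    then obtain z where z: "z \<notin> S" by auto
    have bdd: "bdd_below S"
      using up z by (intro bdd_belowI[of _ z]) (metis linear)
    define c where "c = Inf S"
    have gt: "x \<in> S" if "c < x" for x
      using that False bdd unfolding c_def by (metis (lifting) cInf_less_iff less_imp_le up)
    have ge: "c \<le> x" if "x \<in> S" for x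
      using that bdd unfolding c_def by (rule cInf_lower)
    have "S = {c..} \<or> S = {c<..}"
      using gt ge by (cases "c \<in> S") (auto simp: set_eq_iff le_less)
    then show ?thesis by blast
  qed auto
  then have "S \<in> sets borel" by (elim disjE exE) simp_all
  then show "{x \<in> space borel. a < f x} \<in> sets borel" by (simp add: S_def)
qed

lemma mono_modulus_at: "mono (modulus_at u x)"
  unfolding modulus_at_def by (intro monoI SUP_subset_mono) auto

lemma borel_measurable_modulus_at [measurable]: "modulus_at u x \<in> borel_measurable borel"
  by (rule borel_measurable_mono_ennreal[OF mono_modulus_at])

lemma modulus_at_ge: "ennreal \<bar>u y - u x\<bar> \<le> modulus_at u x (norm (y - x))"
  unfolding modulus_at_def
  by (rule SUP_upper) (simp add: dist_norm norm_minus_commute)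

lemma nn_integral_inverse_unit_interval:
  "(\<integral>\<^sup>+r\<in>{0<..<1}. ennreal (1 / r) \<partial>lborel) = \<infinity>"
proof (rule ccontr)
  assume "(\<integral>\<^sup>+r\<in>{0<..<1}. ennreal (1 / r) \<partial>lborel) \<noteq> \<infinity>"
  then obtain C where C: "(\<integral>\<^sup>+r\<in>{0<..<1}. ennreal (1 / r) \<partial>lborel) = ennreal C" "C \<ge> 0"
    by (cases "(\<integral>\<^sup>+r\<in>{0<..<1}. ennreal (1 / r) \<partial>lborel)") auto
  define d :: real where "d = exp (- (C + 2))"
  have d: "0 < d" "d < exp (-1)" using C by (auto simp: d_def)
  have e1: "exp (-1) < (1::real)" by simp
  have "ennreal (ln (exp (-1)) - ln d) = (\<integral>\<^sup>+r. ennreal (1 / r) * indicator {d..exp (-1)} r \<partial>lborel)"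
    using d by (intro nn_integral_FTC_Icc[symmetric]) (auto intro!: derivative_eq_intros)
  also have "\<dots> \<le> ennreal C"
    unfolding C(1)[symmetric] using d e1
    by (intro nn_integral_mono) (auto simp: indicator_def intro: le_less_trans)
  finally have "C + 1 \<le> C" using C(2) by (simp add: d_def)
  then show False by simp
qed

text \<open>A jump of size \<open>e\<close> keeps the modulus above \<open>e\<close> at every
  radius, and \<open>1 / r\<close> is not integrable at 0.\<close>

lemma Dini_continuous_at_imp_isCont:
  fixes u :: "'a::euclidean_space \<Rightarrow> real"
  assumes "Dini_continuous_at u x"
  shows "isCont u x"
proof (rule ccontr)
  assume "\<not> isCont u x"
  then obtain e where e: "e > 0" and ne: "\<And>d. d > 0 \<Longrightarrow> \<exists>y. norm (y - x) < d \<and> e \<le> \<bar>u y - u x\<bar>"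
    unfolding continuous_at_eps_delta dist_norm real_norm_def not_all not_ex de_Morgan_conj not_imp not_less
    by (meson not_le)
  have ge: "ennreal e \<le> modulus_at u x r" if r: "0 < r" for r
  proof -
    obtain y where y: "norm (y - x) < r" "e \<le> \<bar>u y - u x\<bar>" using ne[OF r] by auto
    have "ennreal e \<le> ennreal \<bar>u y - u x\<bar>" using y by (intro ennreal_leI) auto
    also have "\<dots> \<le> modulus_at u x (norm (y - x))" by (rule modulus_at_ge)
    also have "\<dots> \<le> modulus_at u x r" using y by (intro monoD[OF mono_modulus_at]) auto
    finally show ?thesis .
  qed
  have "ennreal e * \<infinity> = ennreal e * (\<integral>\<^sup>+r\<in>{0<..<1}. ennreal (1 / r) \<partial>lborel)"
    by (simp add: nn_integral_inverse_unit_interval)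
  also have "\<dots> = (\<integral>\<^sup>+r. ennreal e * (ennreal (1 / r) * indicator {0<..<1} r) \<partial>lborel)"
    by (rule nn_integral_cmult[symmetric]) measurable
  also have "\<dots> \<le> (\<integral>\<^sup>+r\<in>{0<..<1}. (modulus_at u x r / ennreal r) \<partial>lborel)"
  proof (rule nn_integral_mono)
    fix r :: real
    show "ennreal e * (ennreal (1 / r) * indicator {0<..<1} r) \<le> modulus_at u x r / ennreal r * indicator {0<..<1} r"
      using ge[of r] e by (auto simp: indicator_def divide_ennreal_def inverse_ennreal inverse_eq_divide intro!: mult_right_mono)
  qed
  finally show False using assms e unfolding Dini_continuous_at_def
    by (simp add: ennreal_mult_eq_top_iff top_unique)
qed

lemma Dini_space_continuous_on: "u \<in> Dini_space \<Longrightarrow> continuous_on A u"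
  unfolding Dini_space_def using Dini_continuous_at_imp_isCont continuous_at_imp_continuous_on by blast

lemma Dini_space_borel_measurable: "u \<in> Dini_space \<Longrightarrow> u \<in> borel_measurable borel"
  by (rule borel_measurable_continuous_onI[OF Dini_space_continuous_on])

section \<open>Convergence of the defining integral and the ground state substitution\<close>

lemma one_plus_norm_power_pos: "1 + norm y ^ n > 0"
  by (metis add_pos_nonneg norm_ge_zero zero_le_power zero_less_one)

lemma L10_borel_iff:
  fixes u :: "'a::euclidean_space \<Rightarrow> real"
  assumes "u \<in> borel_measurable borel"
  shows "u \<in> L10 \<longleftrightarrow> integrable lborel (\<lambda>y. u y / (1 + norm y ^ DIM('a)))"
proof -
  have [measurable]: "u \<in> borel_measurable borel" by fact
  have nn: "1 + norm y ^ DIM('a) > 0" for y :: 'a by (rule one_plus_norm_power_pos)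
  have "(\<integral>\<^sup>+x. ennreal (\<bar>u x\<bar> / (1 + norm x ^ DIM('a))) \<partial>lebesgue)
     = (\<integral>\<^sup>+x. ennreal (norm (u x / (1 + norm x ^ DIM('a)))) \<partial>lborel)"
    by (subst nn_integral_completion) (auto intro!: nn_integral_cong simp: abs_of_pos[OF nn])
  then show ?thesis
    using assms unfolding L10_def integrable_iff_bounded by (auto intro: measurable_completion)
qed

text \<open>Makes the kernel at \<open>x\<close> comparable to the weight of \<open>L10\<close> away
  from \<open>x\<close>; the two summands of the constant take care of \<open>1\<close> and of
  \<open>norm y ^ n\<close>.\<close>

lemma norm_power_le_shift:
  fixes x y :: "'a::euclidean_space"
  assumes "0 < r" "r \<le> norm (y - x)"
  shows "1 + norm y ^ n \<le> ((1 / r) ^ n + (norm x / r + 1) ^ n) * norm (x - y) ^ n"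
proof -
  have "norm y \<le> norm x + norm (x - y)"
    by (metis add.commute norm_minus_commute norm_triangle_sub)
  also have "norm x \<le> norm x / r * norm (x - y)"
    using assms mult_left_mono[of r "norm (x - y)" "norm x"] by (simp add: field_simps norm_minus_commute)
  finally have "norm y \<le> (norm x / r + 1) * norm (x - y)" by (simp add: algebra_simps)
  then have "norm y ^ n \<le> (norm x / r + 1) ^ n * norm (x - y) ^ n"
    by (metis norm_ge_zero power_mono power_mult_distrib)
  moreover have "1 \<le> (1 / r) ^ n * norm (x - y) ^ n"
    using assms unfolding power_mult_distrib[symmetric]
    by (intro one_le_power) (simp add: field_simps norm_minus_commute)
  ultimately show ?thesis by (simp add: algebra_simps)
qed

lemma integrable_L10_tail:
  fixes f :: "'a::euclidean_space \<Rightarrow> real"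
  assumes f: "f \<in> L10" and [measurable]: "f \<in> borel_measurable borel" "A \<in> sets borel"
    and r: "0 < r" and A: "\<And>y. y \<in> A \<Longrightarrow> r \<le> norm (y - x)"
  shows "integrable lborel (\<lambda>y. indicator A y * (f y / norm (x - y) ^ DIM('a)))"
proof (rule Bochner_Integration.integrable_bound)
  let ?C = "(1 / r) ^ DIM('a) + (norm x / r + 1) ^ DIM('a)"
  show "integrable lborel (\<lambda>y. ?C * (f y / (1 + norm y ^ DIM('a))))"
    using f by (intro integrable_mult_right) (simp add: L10_borel_iff)
  show "AE y in lborel. norm (indicator A y * (f y / norm (x - y) ^ DIM('a))) \<le> norm (?C * (f y / (1 + norm y ^ DIM('a))))"
  proof (intro AE_I2)
    fix y
    show "norm (indicator A y * (f y / norm (x - y) ^ DIM('a))) \<le> norm (?C * (f y / (1 + norm y ^ DIM('a))))"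
    proof (cases "y \<in> A")
      case True
      have C: "0 \<le> ?C" using r by simp
      have pos: "0 < norm (x - y) ^ DIM('a)"
        using A[OF True] r by (auto simp: norm_minus_commute intro!: zero_less_power)
      have nn: "1 + norm y ^ DIM('a) > 0" by (rule one_plus_norm_power_pos)
      have "1 / norm (x - y) ^ DIM('a) \<le> ?C / (1 + norm y ^ DIM('a))"
        using norm_power_le_shift[OF r A[OF True], of "DIM('a)"] pos nn by (simp add: field_simps)
      then have "\<bar>f y\<bar> * (1 / norm (x - y) ^ DIM('a)) \<le> \<bar>f y\<bar> * (?C / (1 + norm y ^ DIM('a)))"
        by (rule mult_left_mono) simp
      then show ?thesis
        using True C nn by (simp add: abs_mult mult_ac)
    qed simp
  qed
qed measurable

text \<open>Inside the unit ball the Dini condition controls the difference; outside, the term with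
  \<open>u x\<close> is absent and \<open>L10\<close> controls \<open>u y\<close>.\<close>

lemma integrable_log_integrand:
  fixes u :: "'a::euclidean_space \<Rightarrow> real"
  assumes u: "u \<in> L10 \<inter> Dini_space"
  shows "integrable lborel (\<lambda>y. (u x * indicator (ball x 1) y - u y) / norm (x - y) ^ DIM('a))"
proof -
  have [measurable]: "u \<in> borel_measurable borel" "ball x 1 \<in> sets borel"
    using u Dini_space_borel_measurable by auto
  let ?I = "\<lambda>A y. indicator A y * ((u x - u y) / norm (x - y) ^ DIM('a))"
  have "(\<integral>\<^sup>+y. ennreal (norm (?I (ball x 1) y)) \<partial>lborel)
     \<le> (\<integral>\<^sup>+y. (modulus_at u x (norm (y - x)) * indicator {..<1} (norm (y - x))) * ennreal (1 / norm (y - x) ^ DIM('a)) \<partial>lborel)"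
  proof (rule nn_integral_mono)
    fix y
    show "ennreal (norm (?I (ball x 1) y)) \<le> (modulus_at u x (norm (y - x)) * indicator {..<1} (norm (y - x))) * ennreal (1 / norm (y - x) ^ DIM('a))"
    proof (cases "y \<in> ball x 1")
      case True
      have "ennreal (norm (?I (ball x 1) y)) = ennreal \<bar>u y - u x\<bar> * ennreal (1 / norm (y - x) ^ DIM('a))"
        using True by (simp add: norm_minus_commute abs_minus_commute flip: ennreal_mult)
      also have "\<dots> \<le> modulus_at u x (norm (y - x)) * ennreal (1 / norm (y - x) ^ DIM('a))"
        by (intro mult_right_mono modulus_at_ge) simp
      finally show ?thesis using True by (simp add: dist_norm norm_minus_commute)
    qed simp
  qed
  also have "\<dots> = ennreal (sphere_area DIM('a)) * (\<integral>\<^sup>+r\<in>{0<..}. (modulus_at u x r * indicator {..<1} r) * ennreal (1 / r) \<partial>lborel)"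
    by (rule nn_integral_radial_div) measurable
  also have "(\<integral>\<^sup>+r\<in>{0<..}. (modulus_at u x r * indicator {..<1} r) * ennreal (1 / r) \<partial>lborel)
     = (\<integral>\<^sup>+r\<in>{0<..<1}. (modulus_at u x r / ennreal r) \<partial>lborel)"
    by (intro nn_integral_cong) (auto simp: indicator_def divide_ennreal_def inverse_ennreal inverse_eq_divide)
  also have "ennreal (sphere_area DIM('a)) * \<dots> < \<infinity>"
    using u unfolding Dini_space_def Dini_continuous_at_def
    by (auto simp: ennreal_mult_less_top)
  finally have 1: "integrable lborel (?I (ball x 1))"
    by (intro integrableI_bounded) measurable
  have 2: "integrable lborel (\<lambda>y. indicator (- ball x 1) y * (u y / norm (x - y) ^ DIM('a)))"
    by (rule integrable_L10_tail[where r=1]) (use u in \<open>auto simp: dist_norm norm_minus_commute\<close>)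
  show ?thesis
    by (rule Bochner_Integration.integrable_cong[THEN iffD1, OF refl _ Bochner_Integration.integrable_diff[OF 1 2]])
       (auto simp: indicator_def)
qed

lemma log_laplacian_lborel:
  fixes u :: "'a::euclidean_space \<Rightarrow> real"
  assumes "u \<in> borel_measurable borel"
  shows "log_laplacian u x = log_lap_c DIM('a) *
      (LINT y|lborel. (u x * indicator (ball x 1) y - u y) / norm (x - y) ^ DIM('a))
     + log_lap_rho DIM('a) * u x"
proof -
  have [measurable]: "u \<in> borel_measurable borel" "ball x 1 \<in> sets borel" using assms by auto
  show ?thesis unfolding log_laplacian_def by (subst integral_completion) auto
qed

text \<open>Ground state substitution. Subtracting \<open>u x / b x\<close> times the operator of
  \<open>b\<close> matches the two functions at \<open>x\<close>, so the terms with the unit ball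
  and those with \<open>log_lap_rho\<close> cancel, and an integral without cut-off remains.\<close>

lemma log_laplacian_ground_state:
  fixes u b :: "'a::euclidean_space \<Rightarrow> real"
  assumes u: "u \<in> L10 \<inter> Dini_space" and b: "b \<in> L10 \<inter> Dini_space" and pos: "\<And>x. b x > 0"
  shows "integrable lborel (\<lambda>y. (u x / b x - u y / b y) * b y / norm (x - y) ^ DIM('a))" (is ?I)
    and "log_laplacian u x = u x / b x * log_laplacian b x +
      log_lap_c DIM('a) * (LINT y|lborel. (u x / b x - u y / b y) * b y / norm (x - y) ^ DIM('a))" (is ?L)
proof -
  have [measurable]: "u \<in> borel_measurable borel" "b \<in> borel_measurable borel"
    using u b Dini_space_borel_measurable by auto
  let ?F = "\<lambda>u y. (u x * indicator (ball x 1) y - u y) / norm (x - y) ^ DIM('a)"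
  have bne: "b y \<noteq> 0" for y using pos[of y] by simp
  \<comment> \<open>On the diagonal both sides are 0, because the denominator vanishes and division
    by zero yields 0.\<close>
  have eq: "(u x / b x - u y / b y) * b y / norm (x - y) ^ DIM('a) = ?F u y - u x / b x * ?F b y" for y
    using bne[of x] bne[of y]
    by (cases "y = x") (simp_all add: field_simps)
  note i = integrable_log_integrand[OF u, of x] integrable_log_integrand[OF b, of x]
  show ?I unfolding eq using i by (intro Bochner_Integration.integrable_diff integrable_mult_right)
  have "(LINT y|lborel. ?F u y - u x / b x * ?F b y) = (LINT y|lborel. ?F u y) - u x / b x * (LINT y|lborel. ?F b y)"
    using i by (simp only: Bochner_Integration.integral_diff integrable_mult_right integral_mult_right_zero)
  moreover have "u x / b x * b x = u x" using bne[of x] by simp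
  ultimately show ?L unfolding eq
    by (simp only: log_laplacian_lborel \<open>u \<in> borel_measurable borel\<close> \<open>b \<in> borel_measurable borel\<close>) algebra
qed

lemma open_AE_imp_empty:
  fixes S :: "'a::euclidean_space set"
  assumes "open S" "AE y in lborel. y \<notin> S"
  shows "S = {}"
proof (rule ccontr)
  assume "S \<noteq> {}"
  then obtain z e where e: "e > 0" "ball z e \<subseteq> S" using assms(1) by (meson all_not_in_conv openE)
  have "AE y in lborel. y \<notin> ball z e" using assms(2) by eventually_elim (use e(2) in auto)
  then have "emeasure lborel (ball z e) = 0"
    using AE_iff_measurable[of "ball z e" lborel "\<lambda>y. y \<notin> ball z e"] by (auto simp: ball_def)
  then show False
    using e(1) unit_ball_vol_pos[of "real DIM('a)"]
    by (auto simp add: emeasure_ball simp del: unit_ball_vol_pos)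
qed

text \<open>At a zero of \<open>u\<close> every term of the equation vanishes except the integral of
  the nonnegative function \<open>u y / norm (x - y) ^ n\<close>. So \<open>u\<close> vanishes
  almost everywhere, and by continuity everywhere.\<close>

lemma log_lap_solution_pos:
  fixes u :: "'a::euclidean_space \<Rightarrow> real"
  assumes "log_lap_solution u"
  shows "u x > 0"
proof (rule ccontr)
  assume "\<not> u x > 0"
  from assms have u: "u \<in> L10 \<inter> Dini_space" and nn: "\<And>x. u x \<ge> 0" and ne: "\<exists>x. u x \<noteq> 0"
    and eq: "\<And>x. log_laplacian u x = 4 / real DIM('a) * (u x * ln (u x))"
    unfolding log_lap_solution_def by auto
  have [measurable]: "u \<in> borel_measurable borel" using u Dini_space_borel_measurable by auto
  have 0: "u x = 0" using \<open>\<not> u x > 0\<close> nn[of x] by simp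
  have i: "integrable lborel (\<lambda>y. u y / norm (x - y) ^ DIM('a))"
    using integrable_log_integrand[OF u, of x] by (simp add: 0)
  have "(LINT y|lborel. u y / norm (x - y) ^ DIM('a)) = 0"
    using eq[of x] log_lap_c_pos[of "DIM('a)"] by (simp add: log_laplacian_lborel 0)
  then have "AE y in lborel. u y / norm (x - y) ^ DIM('a) = 0"
    using i nn by (subst (asm) integral_nonneg_eq_0_iff_AE) auto
  moreover have "AE y in lborel. y \<noteq> x" by (rule AE_lborel_singleton)
  ultimately have ae: "AE y in lborel. u y = 0" by eventually_elim simp
  obtain z where z: "u z \<noteq> 0" using ne by auto
  have "open {y. u y \<noteq> 0}"
    using open_Collect_neq[of u "\<lambda>_. 0"] u Dini_space_continuous_on by auto
  moreover have "AE y in lborel. y \<notin> {y. u y \<noteq> 0}" using ae by eventually_elim simp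
  ultimately show False using open_AE_imp_empty z by blast
qed

section \<open>Inversions in spheres\<close>

text \<open>The change of variables formula of the library needs an index type of class
  \<^class>\<open>wellorder\<close>, so a general Euclidean space is first identified with
  \<open>real ^ 'a dim_index\<close>.\<close>

typedef (overloaded) 'a dim_index = "{..<DIM('a::euclidean_space)}"
  by (rule exI[of _ 0]) simp

instantiation dim_index :: (euclidean_space) "{finite, wellorder}"
begin

definition "i \<le> j \<longleftrightarrow> Rep_dim_index i \<le> Rep_dim_index j"
definition "i < j \<longleftrightarrow> Rep_dim_index i < Rep_dim_index j"

instance
proof
  show "finite (UNIV :: 'a dim_index set)"
    by (metis finite_imageI finite_lessThan type_definition.Abs_image type_definition_dim_index)
  fix P and a :: "'a dim_index"
  assume *: "\<And>x::'a dim_index. (\<And>y. y < x \<Longrightarrow> P y) \<Longrightarrow> P x"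
  show "P a"
    by (induction "Rep_dim_index a" arbitrary: a rule: less_induct)
       (use * in \<open>auto simp: less_dim_index_def\<close>)
qed (auto simp: less_eq_dim_index_def less_dim_index_def Rep_dim_index_inject)

end

lemma bij_betw_Rep_dim_index: "bij_betw Rep_dim_index (UNIV :: 'a::euclidean_space dim_index set) {..<DIM('a)}"
  unfolding bij_betw_def using type_definition.Rep_range[OF type_definition_dim_index]
  by (auto simp: inj_on_def Rep_dim_index_inject)

lemma CARD_dim_index: "CARD('a::euclidean_space dim_index) = DIM('a)"
  using bij_betw_same_card[OF bij_betw_Rep_dim_index] by simp

text \<open>Enumerating the basis gives an isometry under which boxes pull back to boxes with the
  same side lengths, which is enough to identify the image of Lebesgue measure.\<close>

lemma vec_isometry_exists:
  obtains S :: "real ^ ('a::euclidean_space dim_index) \<Rightarrow> 'a" and T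
  where "linear S" "\<And>v. norm (S v) = norm v" "\<And>v. T (S v) = v" "\<And>x. S (T x) = x"
    "S \<in> borel_measurable borel" "distr lborel borel S = lborel"
proof -
  have "finite (Basis :: 'a set)" by simp
  then obtain h where h: "bij_betw h {..<DIM('a)} (Basis :: 'a set)"
    by (metis atLeast0LessThan ex_bij_betw_nat_finite)
  define e where "e = (\<lambda>i::'a dim_index. h (Rep_dim_index i))"
  have e: "bij_betw e UNIV (Basis :: 'a set)"
    unfolding e_def using bij_betw_trans[OF bij_betw_Rep_dim_index h] by (simp add: o_def)
  define S where "S = (\<lambda>v::real^'a dim_index. \<Sum>i\<in>UNIV. (v $ i) *\<^sub>R e i)"
  define T where "T = (\<lambda>x::'a. \<chi> i. x \<bullet> e i)"
  have eB: "e i \<in> Basis" for i using e by (auto simp: bij_betw_def)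
  have inner_e: "e i \<bullet> e j = (if i = j then 1 else 0)" for i j
    using eB[of i] eB[of j] bij_betw_imp_inj_on[OF e] by (auto simp: inner_Basis inj_on_def)
  have lin: "linear S"
    unfolding S_def by (intro linearI) (simp_all add: scaleR_left_distrib sum.distrib scaleR_sum_right)
  have Sinner: "S v \<bullet> e j = v $ j" for v j
    unfolding S_def by (simp add: inner_sum_left inner_e if_distrib cong: if_cong)
  have TS: "T (S v) = v" for v
    unfolding T_def by (simp add: Sinner vec_eq_iff)
  have ST: "S (T x) = x" for x
  proof -
    have "S (T x) = (\<Sum>i\<in>UNIV. (x \<bullet> e i) *\<^sub>R e i)" by (simp add: S_def T_def)
    also have "\<dots> = (\<Sum>b\<in>Basis. (x \<bullet> b) *\<^sub>R b)"
      by (rule sum.reindex_bij_betw[OF e])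
    finally show ?thesis by (simp add: euclidean_representation)
  qed
  have inner: "S v \<bullet> S w = v \<bullet> w" for v w
  proof -
    have "S v \<bullet> S w = (\<Sum>i\<in>UNIV. w $ i * (S v \<bullet> e i))"
      by (subst (2) S_def) (simp add: inner_sum_right)
    also have "\<dots> = v \<bullet> w" by (simp add: Sinner inner_vec_def mult.commute)
    finally show ?thesis .
  qed
  have meas: "S \<in> borel_measurable borel"
    using lin by (intro borel_measurable_continuous_onI linear_continuous_on)
       (simp add: linear_conv_bounded_linear)
  have "lborel = distr lborel borel S"
  proof (rule lborel_eqI)
    fix l u :: 'a
    assume lu: "\<And>b. b \<in> Basis \<Longrightarrow> l \<bullet> b \<le> u \<bullet> b"
    have "S -` box l u = box (T l) (T u)"
    proof (intro equalityI subsetI)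
      fix v assume "v \<in> S -` box l u"
      then have S: "\<And>b. b \<in> Basis \<Longrightarrow> l \<bullet> b < S v \<bullet> b \<and> S v \<bullet> b < u \<bullet> b"
        by (auto simp: mem_box)
      have "l \<bullet> e i < v $ i \<and> v $ i < u \<bullet> e i" for i
        using S[OF eB[of i]] unfolding Sinner .
      then show "v \<in> box (T l) (T u)" by (simp add: mem_box_cart T_def)
    next
      fix v assume v: "v \<in> box (T l) (T u)"
      have "l \<bullet> b < S v \<bullet> b \<and> S v \<bullet> b < u \<bullet> b" if b: "b \<in> Basis" for b
      proof -
        obtain i where "b = e i" using bij_betw_imp_surj_on[OF e] b by blast
        then show ?thesis using v by (auto simp: mem_box_cart T_def Sinner)
      qed
      then show "v \<in> S -` box l u" by (auto simp: mem_box)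
    qed
    then have "emeasure (distr lborel borel S) (box l u) = emeasure lborel (box (T l) (T u))"
      using meas by (simp add: emeasure_distr)
    also have "\<dots> = ennreal (\<Prod>b\<in>Basis. (T u - T l) \<bullet> b)"
      using lu eB by (intro emeasure_lborel_box) (auto simp: Basis_vec_def inner_axis T_def)
    also have "(\<Prod>b\<in>Basis. (T u - T l) \<bullet> b) = (\<Prod>i\<in>UNIV. (T u - T l) $ i)"
    proof -
      have "(Basis :: (real^'a dim_index) set) = range (\<lambda>i. axis i 1)" by (auto simp: Basis_vec_def)
      moreover have "inj (\<lambda>i::'a dim_index. axis i (1::real))" by (auto simp: inj_on_def axis_eq_axis)
      ultimately have "bij_betw (\<lambda>i::'a dim_index. axis i (1::real)) UNIV Basis"
        by (simp add: bij_betw_def)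
      from prod.reindex_bij_betw[OF this, of "\<lambda>b. (T u - T l) \<bullet> b", symmetric]
      show ?thesis by (simp add: inner_axis)
    qed
    also have "\<dots> = (\<Prod>i\<in>UNIV. (u - l) \<bullet> e i)" by (simp add: T_def inner_diff_left)
    also have "\<dots> = (\<Prod>b\<in>Basis. (u - l) \<bullet> b)" by (rule prod.reindex_bij_betw[OF e])
    finally show "emeasure (distr lborel borel S) (box l u) = (\<Prod>b\<in>Basis. (u - l) \<bullet> b)" .
  qed simp
  then show ?thesis
    using that[of S T] lin inner TS ST meas by (simp add: norm_eq_sqrt_inner)
qed

text \<open>Division by zero fixes the centre. The map is thereby a total involution, and the centre
  is a null set for every integral.\<close>

definition sphere_inv :: "'a::euclidean_space \<Rightarrow> real \<Rightarrow> 'a \<Rightarrow> 'a" where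
  "sphere_inv a l x = a + (l\<^sup>2 / (norm (x - a))\<^sup>2) *\<^sub>R (x - a)"

lemma sphere_inv_center [simp]: "sphere_inv a l a = a"
  by (simp add: sphere_inv_def)

lemma norm_sphere_inv_center: "norm (sphere_inv a l x - a) = l\<^sup>2 / norm (x - a)"
  by (cases "x = a") (simp_all add: sphere_inv_def power2_eq_square)

lemma sphere_inv_involution [simp]: "l \<noteq> 0 \<Longrightarrow> sphere_inv a l (sphere_inv a l x) = x"
proof (cases "x = a")
  case False
  assume l: "l \<noteq> 0"
  have "sphere_inv a l (sphere_inv a l x) = a + (l\<^sup>2 / (l\<^sup>2 / norm (x - a))\<^sup>2) *\<^sub>R (sphere_inv a l x - a)"
    by (subst sphere_inv_def) (simp add: norm_sphere_inv_center)
  also have "sphere_inv a l x - a = (l\<^sup>2 / (norm (x - a))\<^sup>2) *\<^sub>R (x - a)" by (simp add: sphere_inv_def)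
  also have "(l\<^sup>2 / (l\<^sup>2 / norm (x - a))\<^sup>2) * (l\<^sup>2 / (norm (x - a))\<^sup>2) = 1"
    using False l by (simp add: field_simps power2_eq_square)
  ultimately show ?thesis by simp
qed simp

lemma sphere_inv_eq_center_iff: "l \<noteq> 0 \<Longrightarrow> sphere_inv a l x = a \<longleftrightarrow> x = a"
  by (auto simp: sphere_inv_def)

text \<open>Expanding both squared norms reduces this to the law of cosines. All conformal
  invariance below rests on it.\<close>

lemma norm_sphere_inv_diff:
  assumes "x \<noteq> a" "y \<noteq> a"
  shows "norm (sphere_inv a l x - sphere_inv a l y) = l\<^sup>2 * norm (x - y) / (norm (x - a) * norm (y - a))"
proof -
  define p q where "p = x - a" and "q = y - a"
  have pq: "p \<noteq> 0" "q \<noteq> 0" using assms by (auto simp: p_def q_def)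
  have "(norm (sphere_inv a l x - sphere_inv a l y))\<^sup>2 = (norm ((l\<^sup>2 / (norm p)\<^sup>2) *\<^sub>R p - (l\<^sup>2 / (norm q)\<^sup>2) *\<^sub>R q))\<^sup>2"
    by (simp add: sphere_inv_def p_def q_def)
  also have "\<dots> = (l\<^sup>2 / (norm p)\<^sup>2)\<^sup>2 * (norm p)\<^sup>2 + (l\<^sup>2 / (norm q)\<^sup>2)\<^sup>2 * (norm q)\<^sup>2
      - 2 * (l\<^sup>2 / (norm p)\<^sup>2) * (l\<^sup>2 / (norm q)\<^sup>2) * (p \<bullet> q)"
    unfolding power2_norm_eq_inner by (simp add: inner_diff inner_commute power2_eq_square algebra_simps)
  also have "\<dots> = (l\<^sup>2 / (norm p * norm q))\<^sup>2 * ((norm p)\<^sup>2 + (norm q)\<^sup>2 - 2 * (p \<bullet> q))"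
    using pq by (simp add: field_simps power2_eq_square)
  also have "(norm p)\<^sup>2 + (norm q)\<^sup>2 - 2 * (p \<bullet> q) = (norm (p - q))\<^sup>2"
    unfolding power2_norm_eq_inner by (simp add: inner_diff inner_commute)
  also have "p - q = x - y" by (simp add: p_def q_def)
  also have "(l\<^sup>2 / (norm p * norm q))\<^sup>2 * (norm (x - y))\<^sup>2 = (l\<^sup>2 * norm (x - y) / (norm p * norm q))\<^sup>2"
    by (simp add: power_mult_distrib power_divide)
  finally show ?thesis
    unfolding p_def q_def by (rule power2_eq_imp_eq) auto
qed

text \<open>The power \<open>2 * n\<close> is the Jacobian of the inversion and the inner power
  \<open>n\<close> the factor that a bubble picks up. Together with the distorted distance they
  leave the kernel itself and a factor that depends on \<open>x\<close> only, which can leave the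
  integral.\<close>

lemma sphere_inv_kernel:
  fixes a :: "'a::euclidean_space"
  assumes l: "l > 0" and x: "x \<noteq> a" and y: "y \<noteq> a"
  shows "(l / norm (y - a)) ^ (2 * n) * ((norm (y - a) / l) ^ n / norm (sphere_inv a l x - sphere_inv a l y) ^ n)
    = (norm (x - a) / l) ^ n / norm (x - y) ^ n"
proof -
  define p d w where "p = norm (y - a)" and "d = norm (x - a)" and "w = norm (x - y)"
  have p: "p > 0" "d > 0" using x y by (auto simp: p_def d_def)
  have "(l / p) ^ (2 * n) * ((p / l) ^ n / (l\<^sup>2 * w / (d * p)) ^ n)
    = (((l / p)\<^sup>2) * ((p / l) / (l\<^sup>2 * w / (d * p)))) ^ n"
    by (simp only: power_mult power_mult_distrib power_divide)
  also have "((l / p)\<^sup>2) * ((p / l) / (l\<^sup>2 * w / (d * p))) = (d / l) / w"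
    using p l by (cases "w = 0") (simp_all add: field_simps power2_eq_square)
  finally show ?thesis
    unfolding norm_sphere_inv_diff[OF x y] p_def d_def w_def by (simp only: power_divide)
qed

section \<open>Inversions as changes of variables\<close>

lemma borel_measurable_sphere_inv [measurable]: "sphere_inv a l \<in> borel_measurable borel"
  unfolding sphere_inv_def by measurable

lemma continuous_on_sphere_inv: "a \<notin> A \<Longrightarrow> continuous_on A (sphere_inv a l)"
  unfolding sphere_inv_def by (intro continuous_intros) auto

lemma has_derivative_sphere_inv:
  fixes a :: "'a::euclidean_space"
  assumes "x \<noteq> a"
  shows "(sphere_inv a l has_derivative
    (\<lambda>h. (l\<^sup>2 / (norm (x - a))\<^sup>2) *\<^sub>R (h - (2 * ((x - a) \<bullet> h) / (norm (x - a))\<^sup>2) *\<^sub>R (x - a)))) (at x within A)"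
proof -
  have ne: "(x - a) \<bullet> (x - a) \<noteq> 0" using assms by simp
  have d: "((\<lambda>x. l\<^sup>2 / ((x - a) \<bullet> (x - a))) has_derivative
      (\<lambda>h. - (l\<^sup>2 * (2 * ((x - a) \<bullet> h)) / ((x - a) \<bullet> (x - a))\<^sup>2))) (at x within A)"
    using ne by (auto intro!: derivative_eq_intros ext simp: inner_commute power2_eq_square field_simps)
  have "((\<lambda>x. (l\<^sup>2 / ((x - a) \<bullet> (x - a))) *\<^sub>R (x - a)) has_derivative
    (\<lambda>h. (l\<^sup>2 / ((x - a) \<bullet> (x - a))) *\<^sub>R h + (- (l\<^sup>2 * (2 * ((x - a) \<bullet> h)) / ((x - a) \<bullet> (x - a))\<^sup>2)) *\<^sub>R (x - a))) (at x within A)"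
    by (rule has_derivative_scaleR[OF d]) (auto intro!: derivative_eq_intros)
  then have "((\<lambda>x. a + (l\<^sup>2 / ((x - a) \<bullet> (x - a))) *\<^sub>R (x - a)) has_derivative
    (\<lambda>h. 0 + ((l\<^sup>2 / ((x - a) \<bullet> (x - a))) *\<^sub>R h + (- (l\<^sup>2 * (2 * ((x - a) \<bullet> h)) / ((x - a) \<bullet> (x - a))\<^sup>2)) *\<^sub>R (x - a)))) (at x within A)"
    by (intro has_derivative_add has_derivative_const)
  moreover have "0 + ((l\<^sup>2 / ((x - a) \<bullet> (x - a))) *\<^sub>R h + (- (l\<^sup>2 * (2 * ((x - a) \<bullet> h)) / ((x - a) \<bullet> (x - a))\<^sup>2)) *\<^sub>R (x - a))
    = (l\<^sup>2 / ((x - a) \<bullet> (x - a))) *\<^sub>R (h - (2 * ((x - a) \<bullet> h) / ((x - a) \<bullet> (x - a))) *\<^sub>R (x - a))" for h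
    by (simp add: scaleR_diff_right power2_eq_square)
  ultimately show ?thesis unfolding sphere_inv_def power2_norm_eq_inner by simp
qed

text \<open>The bracket is the reflection in the hyperplane orthogonal to \<open>p\<close>, an
  orthogonal map, so only the dilation by \<open>c\<close> contributes.\<close>

lemma det_derivative_sphere_inv:
  fixes p :: "real ^ 'm::{finite,wellorder}"
  assumes "p \<noteq> 0"
  shows "\<bar>det (matrix (\<lambda>h. c *\<^sub>R (h - (2 * (p \<bullet> h) / (norm p)\<^sup>2) *\<^sub>R p)))\<bar> = \<bar>c\<bar> ^ CARD('m)"
proof -
  let ?R = "\<lambda>h. h - (2 * (p \<bullet> h) / (norm p)\<^sup>2) *\<^sub>R p"
  have lin: "linear ?R"
    by (intro linearI) (simp_all add: inner_add_right distrib_left add_divide_distrib scaleR_left_distrib scaleR_diff_right)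
  have ip: "?R v \<bullet> ?R v = v \<bullet> v" for v
  proof -
    have "?R v \<bullet> ?R v = v \<bullet> v - 2 * (2 * (p \<bullet> v) / (norm p)\<^sup>2) * (p \<bullet> v) + (2 * (p \<bullet> v) / (norm p)\<^sup>2)\<^sup>2 * (p \<bullet> p)"
      by (simp add: inner_diff inner_commute power2_eq_square algebra_simps)
    also have "\<dots> = v \<bullet> v"
      using assms unfolding power2_norm_eq_inner by (simp add: power2_eq_square)
    finally show ?thesis .
  qed
  have "orthogonal_transformation ?R"
    unfolding orthogonal_transformation using lin ip by (simp add: norm_eq_sqrt_inner[of "_ - _"] norm_eq_sqrt_inner[of v for v :: "real ^ 'm::_"])
  then have R: "\<bar>det (matrix ?R)\<bar> = 1" by (rule orthogonal_transformation_det)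
  have "matrix ((\<lambda>h. c *\<^sub>R h) \<circ> ?R) = matrix (\<lambda>h::real^'m::_. c *\<^sub>R h) ** matrix ?R"
    by (rule matrix_compose[OF lin linear_scaleR])
  then show ?thesis using R
    by (simp add: o_def det_mul abs_mult power_abs del: scaleR_diff_right)
qed

text \<open>\<open>X\<close> is treated as the image of its own preimage. Boundedness gives it
  finite measure, as the real-valued image formula demands, and \<open>a \<notin> X\<close> keeps
  the preimage inside the domain of differentiability.\<close>

lemma emeasure_sphere_inv_cart:
  fixes a :: "real ^ 'm::{finite,wellorder}"
  assumes l: "l > 0" and X: "X \<in> sets borel" and bd: "bounded X" and aX: "a \<notin> X"
  shows "emeasure lborel X =
    (\<integral>\<^sup>+x. ennreal ((l / norm (x - a)) ^ (2 * CARD('m))) * indicator X (sphere_inv a l x) \<partial>lborel)"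
proof -
  define S where "S = sphere_inv a l -` X"
  have S: "S \<in> sets borel" unfolding S_def using X measurable_sets[OF borel_measurable_sphere_inv X, of a l] by simp
  have aS: "a \<notin> S" using aX by (simp add: S_def)
  have img: "sphere_inv a l ` S = X"
  proof (intro equalityI subsetI)
    fix x assume "x \<in> X"
    then have "sphere_inv a l x \<in> S" using l by (simp add: S_def)
    then show "x \<in> sphere_inv a l ` S" using l by (metis image_eqI less_irrefl sphere_inv_involution)
  qed (auto simp: S_def)
  have inj: "inj_on (sphere_inv a l) S"
    using l by (intro inj_on_inverseI[of _ "sphere_inv a l"]) simp
  let ?D = "\<lambda>x h. (l\<^sup>2 / (norm (x - a))\<^sup>2) *\<^sub>R (h - (2 * ((x - a) \<bullet> h) / (norm (x - a))\<^sup>2) *\<^sub>R (x - a))"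
  have XL: "X \<in> lmeasurable"
    using bd X by (intro bounded_set_imp_lmeasurable) auto
  have "((\<lambda>x. \<bar>det (matrix (?D x))\<bar>) has_integral measure lebesgue X) S"
  proof (subst has_measure_differentiable_image[symmetric, where f = "sphere_inv a l"])
    show "sphere_inv a l ` S \<in> lmeasurable \<and> measure lebesgue (sphere_inv a l ` S) = measure lebesgue X"
      using XL by (simp add: img)
  qed (use S aS inj in \<open>auto intro: has_derivative_sphere_inv\<close>)
  then have "(\<integral>\<^sup>+x. ennreal \<bar>det (matrix (?D x))\<bar> * indicator S x \<partial>lborel) = ennreal (measure lebesgue X)"
    by (intro nn_integral_has_integral_lebesgue') auto
  also have "ennreal (measure lebesgue X) = emeasure lborel X"
    using emeasure_eq_measure2[OF XL] X by simp
  finally have "emeasure lborel X = (\<integral>\<^sup>+x. ennreal \<bar>det (matrix (?D x))\<bar> * indicator S x \<partial>lborel)" ..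
  also have "\<dots> = (\<integral>\<^sup>+x. ennreal ((l / norm (x - a)) ^ (2 * CARD('m))) * indicator X (sphere_inv a l x) \<partial>lborel)"
  proof (rule nn_integral_cong)
    fix x
    show "ennreal \<bar>det (matrix (?D x))\<bar> * indicator S x
      = ennreal ((l / norm (x - a)) ^ (2 * CARD('m))) * indicator X (sphere_inv a l x)"
    proof (cases "x \<in> S")
      case True
      then have "x - a \<noteq> 0" using aS by auto
      then have "\<bar>det (matrix (?D x))\<bar> = (l / norm (x - a)) ^ (2 * CARD('m))"
        by (subst det_derivative_sphere_inv) (simp_all add: power_mult power_divide)
      then show ?thesis using True by (simp add: S_def)
    qed (simp add: S_def)
  qed
  finally show ?thesis .
qed

lemma lborel_sphere_inv_cart:
  fixes a :: "real ^ 'm::{finite,wellorder}"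
  assumes l: "l > 0"
  shows "lborel = distr (density lborel (\<lambda>x. ennreal ((l / norm (x - a)) ^ (2 * CARD('m))))) borel (sphere_inv a l)"
    (is "_ = ?N")
proof (rule measure_eqI)
  fix X :: "(real^'m::_) set" assume "X \<in> sets lborel"
  then have X[measurable]: "X \<in> sets borel" by simp
  have N: "emeasure ?N Y = (\<integral>\<^sup>+x. ennreal ((l / norm (x - a)) ^ (2 * CARD('m))) * indicator Y (sphere_inv a l x) \<partial>lborel)"
    if [measurable]: "Y \<in> sets borel" for Y
    by (subst emeasure_distr, measurable, subst emeasure_density, measurable)
       (auto intro!: nn_integral_cong simp: indicator_def)
  define Y where "Y = (\<lambda>k::nat. (X - {a}) \<inter> ball a (real k))"
  have Ym: "Y k \<in> sets borel" for k unfolding Y_def by (intro sets.Int sets.Diff X borel_open borel_closed) auto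
  have eq: "emeasure lborel (Y k) = emeasure ?N (Y k)" for k
    using Ym by (subst N, simp, subst emeasure_sphere_inv_cart[OF l, of _ a])
      (auto simp: Y_def intro: bounded_subset[OF bounded_ball])
  have inc: "incseq Y" unfolding Y_def incseq_def by force
  have U: "(\<Union>k. Y k) = X - {a}"
    unfolding Y_def using reals_Archimedean2 by (auto simp: mem_ball)
  have "emeasure lborel (X - {a}) = emeasure ?N (X - {a})"
  proof -
    have "emeasure lborel (X - {a}) = (SUP k. emeasure lborel (Y k))"
      unfolding U[symmetric] using inc Ym by (intro SUP_emeasure_incseq[symmetric]) auto
    also have "\<dots> = (SUP k. emeasure ?N (Y k))" by (simp add: eq)
    also have "\<dots> = emeasure ?N (X - {a})"
      unfolding U[symmetric] using inc Ym by (intro SUP_emeasure_incseq) auto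
    finally show ?thesis .
  qed
  \<comment> \<open>Only the centre is mapped to the centre, and there the density is a positive
    power of \<open>l / 0 = 0\<close>.\<close>
  moreover have "emeasure ?N {a} = 0"
  proof -
    have "emeasure ?N {a} = (\<integral>\<^sup>+x. 0 \<partial>(lborel :: (real^'m::_) measure))"
      unfolding N[OF borel_singleton[OF sets.empty_sets], of a] using l
      by (intro nn_integral_cong) (auto simp: indicator_def sphere_inv_eq_center_iff power_0_left)
    then show ?thesis by simp
  qed
  ultimately show "emeasure lborel X = emeasure ?N X"
    using emeasure_Diff_null_set[of "{a}" ?N X] emeasure_Diff_null_set[of "{a}" lborel X]
    by (auto simp: null_sets_def)
qed simp

lemma nn_integral_sphere_inv:
  fixes a :: "'a::euclidean_space" and f :: "'a \<Rightarrow> ennreal"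
  assumes l: "l > 0" and [measurable]: "f \<in> borel_measurable borel"
  shows "(\<integral>\<^sup>+x. f x \<partial>lborel) =
    (\<integral>\<^sup>+x. ennreal ((l / norm (x - a)) ^ (2 * DIM('a))) * f (sphere_inv a l x) \<partial>lborel)"
proof -
  obtain S :: "real ^ 'a dim_index \<Rightarrow> 'a" and T where
    S: "linear S" "\<And>v. norm (S v) = norm v" and TS: "\<And>v. T (S v) = v" and ST: "\<And>x. S (T x) = x"
    and [measurable]: "S \<in> borel_measurable borel" and SL: "distr lborel borel S = lborel"
    by (rule vec_isometry_exists) blast
  have inv: "S (sphere_inv (T a) l v) = sphere_inv a l (S v)" for v
  proof -
    have "norm (v - T a) = norm (S v - a)" using S ST by (metis linear_diff)
    then show ?thesis unfolding sphere_inv_def using S ST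
      by (simp add: linear_add linear_scale linear_diff)
  qed
  have nrm: "norm (v - T a) = norm (S v - a)" for v using S ST by (metis linear_diff)
  have tr: "(\<integral>\<^sup>+x. g x \<partial>lborel) = (\<integral>\<^sup>+v. g (S v) \<partial>lborel)" if [measurable]: "g \<in> borel_measurable borel" for g :: "'a \<Rightarrow> ennreal"
    by (subst SL[symmetric], subst nn_integral_distr) auto
  have "(\<integral>\<^sup>+x. f x \<partial>lborel) = (\<integral>\<^sup>+v. f (S v) \<partial>lborel)" by (rule tr) simp
  also have "\<dots> = (\<integral>\<^sup>+v. ennreal ((l / norm (v - T a)) ^ (2 * DIM('a))) * f (S (sphere_inv (T a) l v)) \<partial>lborel)"
    by (subst lborel_sphere_inv_cart[OF l, of "T a"], subst nn_integral_distr, measurable,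
        subst nn_integral_density, measurable) (simp_all add: CARD_dim_index)
  also have "\<dots> = (\<integral>\<^sup>+v. ennreal ((l / norm (S v - a)) ^ (2 * DIM('a))) * f (sphere_inv a l (S v)) \<partial>lborel)"
    by (simp add: inv nrm)
  also have "\<dots> = (\<integral>\<^sup>+x. ennreal ((l / norm (x - a)) ^ (2 * DIM('a))) * f (sphere_inv a l x) \<partial>lborel)"
    by (rule tr[symmetric]) measurable
  finally show ?thesis .
qed

lemma lborel_sphere_inv:
  fixes a :: "'a::euclidean_space"
  assumes l: "l > 0"
  shows "lborel = distr (density lborel (\<lambda>x. ennreal ((l / norm (x - a)) ^ (2 * DIM('a))))) borel (sphere_inv a l)"
    (is "_ = ?N")
proof (rule measure_eqI)
  fix X :: "'a set" assume "X \<in> sets lborel"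
  then have [measurable]: "X \<in> sets borel" by simp
  have "emeasure lborel X = (\<integral>\<^sup>+x. indicator X x \<partial>lborel)" by simp
  also have "\<dots> = (\<integral>\<^sup>+x. ennreal ((l / norm (x - a)) ^ (2 * DIM('a))) * indicator X (sphere_inv a l x) \<partial>lborel)"
    by (rule nn_integral_sphere_inv[OF l]) simp
  also have "\<dots> = emeasure ?N X"
    by (subst emeasure_distr, measurable, subst emeasure_density, measurable)
       (auto intro!: nn_integral_cong simp: indicator_def)
  finally show "emeasure lborel X = emeasure ?N X" .
qed simp

lemma
  fixes a :: "'a::euclidean_space" and f :: "'a \<Rightarrow> real"
  assumes l: "l > 0" and [measurable]: "f \<in> borel_measurable borel"
  shows integrable_sphere_inv: "integrable lborel f \<longleftrightarrow>
      integrable lborel (\<lambda>x. (l / norm (x - a)) ^ (2 * DIM('a)) * f (sphere_inv a l x))" (is ?I)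
    and integral_sphere_inv: "(LINT x|lborel. f x) =
      (LINT x|lborel. (l / norm (x - a)) ^ (2 * DIM('a)) * f (sphere_inv a l x))" (is ?L)
proof -
  let ?w = "\<lambda>x. (l / norm (x - a)) ^ (2 * DIM('a))"
  have w: "AE x in lborel. 0 \<le> ?w x" using l by simp
  show ?I
    by (subst lborel_sphere_inv[OF l, of a], subst integrable_distr_eq, measurable,
        subst integrable_density) (use w in auto)
  show ?L
    by (subst lborel_sphere_inv[OF l, of a], subst integral_distr, measurable,
        subst integral_density) (use w in auto)
qed

section \<open>Bubbles\<close>

lemma Dini_continuous_at_if_Lipschitz:
  fixes u :: "'a::euclidean_space \<Rightarrow> real"
  assumes C0: "0 \<le> C" and lip: "\<And>y. norm (y - x) \<le> 1 \<Longrightarrow> \<bar>u y - u x\<bar> \<le> C * norm (y - x)"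
  shows "Dini_continuous_at u x"
proof -
  have "(\<integral>\<^sup>+r\<in>{0<..<1}. (modulus_at u x r / ennreal r) \<partial>lborel) \<le> (\<integral>\<^sup>+r. ennreal C * indicator {0<..<1::real} r \<partial>lborel)"
  proof (rule nn_integral_mono)
    fix r :: real
    show "modulus_at u x r / ennreal r * indicator {0<..<1} r \<le> ennreal C * indicator {0<..<1} r"
    proof (cases "0 < r \<and> r < 1")
      case True
      have "modulus_at u x r \<le> ennreal (C * r)"
        unfolding modulus_at_def
      proof (rule SUP_least)
        fix y assume "y \<in> cball x r"
        then have y: "norm (y - x) \<le> r" by (simp add: dist_norm norm_minus_commute)
        have "\<bar>u y - u x\<bar> \<le> C * norm (y - x)" using lip y True by simp
        also have "\<dots> \<le> C * r" using y C0 by (rule mult_left_mono)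
        finally show "ennreal \<bar>u y - u x\<bar> \<le> ennreal (C * r)" by (rule ennreal_leI)
      qed
      then have "modulus_at u x r / ennreal r \<le> ennreal (C * r) / ennreal r" by (rule divide_right_mono_ennreal)
      also have "\<dots> = ennreal C" using True C0 by (simp add: divide_ennreal)
      finally show ?thesis using True by simp
    qed auto
  qed
  also have "\<dots> < \<infinity>" by (simp add: nn_integral_cmult_indicator ennreal_mult_less_top)
  finally show ?thesis unfolding Dini_continuous_at_def .
qed

lemma L10_if_decay:
  fixes u :: "'a::euclidean_space \<Rightarrow> real"
  assumes u: "u \<in> borel_measurable borel" and decay: "\<And>y. \<bar>u y\<bar> \<le> C / (1 + norm y ^ DIM('a))"
  shows "u \<in> L10"
proof -
  let ?n = "DIM('a)"
  have [measurable]: "u \<in> borel_measurable borel" by (rule u)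
  have n: "?n > 0" by simp
  have s: "sphere_area ?n > 0" by (rule sphere_area_pos[OF n])
  have C: "0 \<le> C" using decay[of 0] n by (simp add: power_0_left)
  have rp: "1 + r ^ ?n > 0" if "0 \<le> r" for r :: real using that by (simp add: add_pos_nonneg)
  have "(\<integral>\<^sup>+y. ennreal (norm (u y / (1 + norm y ^ ?n))) \<partial>lborel)
    \<le> (\<integral>\<^sup>+y. ennreal (C / (1 + norm (y - 0) ^ ?n)\<^sup>2) \<partial>(lborel :: 'a measure))"
  proof (intro nn_integral_mono ennreal_leI)
    fix y :: 'a
    have "\<bar>u y\<bar> / (1 + norm y ^ ?n) \<le> C / (1 + norm y ^ ?n) / (1 + norm y ^ ?n)"
      using decay[of y] one_plus_norm_power_pos[of y ?n] by (intro divide_right_mono) auto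
    then show "norm (u y / (1 + norm y ^ ?n)) \<le> C / (1 + norm (y - 0) ^ ?n)\<^sup>2"
      using one_plus_norm_power_pos[of y ?n] by (simp add: power2_eq_square)
  qed
  also have "\<dots> = (\<integral>\<^sup>+r. ennreal (sphere_area ?n * r ^ (?n - 1) * indicator {0..} r) * ennreal (C / (1 + r ^ ?n)\<^sup>2) \<partial>lborel)"
    by (rule nn_integral_radial) measurable
  also have "\<dots> = (\<integral>\<^sup>+r. ennreal (sphere_area ?n * r ^ (?n - 1) * (C / (1 + r ^ ?n)\<^sup>2)) * indicator {0..} r \<partial>lborel)"
    using s C by (intro nn_integral_cong) (auto simp: indicator_def simp flip: ennreal_mult)
  also have "\<dots> = ennreal (0 - - (sphere_area ?n * C / real ?n) / (1 + 0 ^ ?n))"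
  proof (rule nn_integral_FTC_atLeast)
    show "((\<lambda>r::real. - (sphere_area ?n * C / real ?n) / (1 + r ^ ?n)) \<longlongrightarrow> 0) at_top"
      using n by (intro real_tendsto_divide_at_top[OF tendsto_const]
          filterlim_tendsto_add_at_top[OF tendsto_const] filterlim_pow_at_top filterlim_ident)
    fix r :: real assume r: "0 \<le> r"
    then show "((\<lambda>r. - (sphere_area ?n * C / real ?n) / (1 + r ^ ?n)) has_real_derivative
        sphere_area ?n * r ^ (?n - 1) * (C / (1 + r ^ ?n)\<^sup>2)) (at r)"
      using rp[OF r] n by (auto intro!: derivative_eq_intros simp: power2_eq_square)
    show "0 \<le> sphere_area ?n * r ^ (?n - 1) * (C / (1 + r ^ ?n)\<^sup>2)" using r s C by simp
  qed measurable
  also have "\<dots> < \<infinity>" by simp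
  finally have "integrable lborel (\<lambda>y. u y / (1 + norm y ^ ?n))"
    by (intro integrableI_bounded) measurable
  then show ?thesis using L10_borel_iff[OF u] by simp
qed

lemma bubble_const_pos: "bubble_const n > 0"
  by (simp add: bubble_const_def)

lemma bubble_base_pos:
  fixes t :: real
  assumes "t > 0"
  shows "t / (t\<^sup>2 + r\<^sup>2) > 0"
  using assms by (simp add: add_pos_nonneg)

lemma bubble_pos: "t > 0 \<Longrightarrow> bubble z t x > 0"
  using bubble_base_pos[of t "norm (x - z)"] by (simp add: bubble_def bubble_const_pos)

lemma bubble_Lipschitz:
  fixes x y z :: "'a::euclidean_space"
  assumes t: "t > 0"
  shows "\<bar>bubble z t y - bubble z t x\<bar> \<le> bubble_const DIM('a) * (real DIM('a) / 2) * (1 / t) powr (real DIM('a) / 2) * (1 / t) * norm (y - x)"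
proof -
  let ?n = "real DIM('a)"
  let ?h = "\<lambda>r. bubble_const DIM('a) * (t / (t\<^sup>2 + r\<^sup>2)) powr (?n / 2)"
  let ?h' = "\<lambda>r. bubble_const DIM('a) * ((?n / 2) * (t / (t\<^sup>2 + r\<^sup>2)) powr (?n / 2) * (- (2 * r) / (t\<^sup>2 + r\<^sup>2)))"
  let ?B = "bubble_const DIM('a) * ((?n / 2) * (1 / t) powr (?n / 2) * (1 / t))"
  have q: "t\<^sup>2 + r\<^sup>2 > 0" for r using t by (simp add: add_pos_nonneg)
  have "norm (?h (norm (y - z)) - ?h (norm (x - z))) \<le> ?B * norm (norm (y - z) - norm (x - z))"
  proof (rule field_differentiable_bound[OF convex_UNIV])
    fix r :: real
    have "((\<lambda>r. t / (t\<^sup>2 + r\<^sup>2)) has_real_derivative - (t * (2 * r)) / (t\<^sup>2 + r\<^sup>2)\<^sup>2) (at r)"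
      using q[of r] by (auto intro!: derivative_eq_intros simp: power2_eq_square)
    from DERIV_fun_powr[OF this bubble_base_pos[OF t], of "?n / 2"]
    have "((\<lambda>r. (t / (t\<^sup>2 + r\<^sup>2)) powr (?n / 2)) has_real_derivative
        (?n / 2) * (t / (t\<^sup>2 + r\<^sup>2)) powr (?n / 2 - of_nat 1) * (- (t * (2 * r)) / (t\<^sup>2 + r\<^sup>2)\<^sup>2)) (at r)" .
    moreover have "(t / (t\<^sup>2 + r\<^sup>2)) powr (?n / 2 - of_nat 1) * (- (t * (2 * r)) / (t\<^sup>2 + r\<^sup>2)\<^sup>2)
        = (t / (t\<^sup>2 + r\<^sup>2)) powr (?n / 2) * (- (2 * r) / (t\<^sup>2 + r\<^sup>2))"
      using q[of r] t bubble_base_pos[OF t, of r] by (simp add: powr_diff power2_eq_square)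
    ultimately have "((\<lambda>r. (t / (t\<^sup>2 + r\<^sup>2)) powr (?n / 2)) has_real_derivative
        (?n / 2) * ((t / (t\<^sup>2 + r\<^sup>2)) powr (?n / 2) * (- (2 * r) / (t\<^sup>2 + r\<^sup>2)))) (at r)"
      by (simp only: mult.assoc)
    from DERIV_cmult[OF this, of "bubble_const DIM('a)"]
    show "(?h has_real_derivative ?h' r) (at r within UNIV)" by (simp add: mult.assoc)
    have a: "(t / (t\<^sup>2 + r\<^sup>2)) powr (?n / 2) \<le> (1 / t) powr (?n / 2)"
    proof (rule powr_mono2)
      show "t / (t\<^sup>2 + r\<^sup>2) \<le> 1 / t" using q[of r] t by (simp add: field_simps power2_eq_square)
    qed (use bubble_base_pos[OF t, of r] in simp_all)
    have b: "\<bar>- (2 * r) / (t\<^sup>2 + r\<^sup>2)\<bar> \<le> 1 / t"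
    proof -
      have "0 \<le> (\<bar>r\<bar> - t)\<^sup>2" by simp
      then have "2 * \<bar>r\<bar> * t \<le> t\<^sup>2 + r\<^sup>2" by (simp add: power2_diff)
      then show ?thesis using q[of r] t by (simp add: abs_mult field_simps)
    qed
    have "norm (?h' r) = bubble_const DIM('a) * ((?n / 2) * (t / (t\<^sup>2 + r\<^sup>2)) powr (?n / 2) * \<bar>- (2 * r) / (t\<^sup>2 + r\<^sup>2)\<bar>)"
      using bubble_const_pos[of "DIM('a)"] by (simp add: abs_mult)
    also have "\<dots> \<le> ?B"
      using a b bubble_const_pos[of "DIM('a)"]
      by (intro mult_left_mono mult_mono) auto
    finally show "norm (?h' r) \<le> ?B" .
  qed auto
  also have "\<dots> \<le> ?B * norm (y - x)"
  proof (rule mult_left_mono)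
    show "norm (norm (y - z) - norm (x - z)) \<le> norm (y - x)"
      using norm_triangle_ineq3[of "y - z" "x - z"] by simp
    show "0 \<le> ?B" using bubble_const_pos[of "DIM('a)"] t by simp
  qed
  finally show ?thesis by (simp add: bubble_def mult.assoc)
qed

lemma bubble_Dini: "t > 0 \<Longrightarrow> bubble z t \<in> Dini_space"
  unfolding Dini_space_def
  by (intro CollectI allI Dini_continuous_at_if_Lipschitz[OF _ bubble_Lipschitz])
     (auto simp: bubble_const_pos less_imp_le)

lemma bubble_L10:
  fixes z :: "'a::euclidean_space"
  assumes t: "t > 0"
  shows "bubble z t \<in> L10"
proof (rule L10_if_decay)
  show "bubble z t \<in> borel_measurable borel" by (rule Dini_space_borel_measurable[OF bubble_Dini[OF t]])
  let ?k = "real DIM('a) / 2"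
  \<comment> \<open>\<open>A * t\<^sup>2\<close> is made to absorb the constant terms of
    \<open>1 + 2 * (norm (y - z))\<^sup>2 + 2 * (norm z)\<^sup>2\<close>, an upper bound of
    \<open>1 + (norm y)\<^sup>2\<close>; the 2 in \<open>K\<close> absorbs the remaining
    one.\<close>
  define A where "A = (1 + 2 * (norm z)\<^sup>2) / t\<^sup>2"
  define K where "K = 2 + A"
  have A: "A * t\<^sup>2 = 1 + 2 * (norm z)\<^sup>2" "A \<ge> 0" using t by (simp_all add: A_def)
  fix y
  define Q where "Q = t\<^sup>2 + (norm (y - z))\<^sup>2"
  have Q: "Q > 0" using t by (simp add: Q_def add_pos_nonneg)
  have K: "K > 0" using A by (simp add: K_def)
  have "0 \<le> (norm (y - z) - norm z)\<^sup>2" by simp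
  then have "(norm (y - z) + norm z)\<^sup>2 \<le> 2 * (norm (y - z))\<^sup>2 + 2 * (norm z)\<^sup>2"
    by (simp add: power2_eq_square algebra_simps)
  moreover have "(norm y)\<^sup>2 \<le> (norm (y - z) + norm z)\<^sup>2"
    using norm_triangle_ineq[of "y - z" z] by (intro power_mono) auto
  moreover have "K * Q = A * t\<^sup>2 + 2 * (norm (y - z))\<^sup>2 + (2 * t\<^sup>2 + A * (norm (y - z))\<^sup>2)"
    by (simp add: K_def Q_def algebra_simps)
  moreover have "0 \<le> 2 * t\<^sup>2 + A * (norm (y - z))\<^sup>2" using A by simp
  ultimately have yQ: "1 + (norm y)\<^sup>2 \<le> K * Q" using A(1) by linarith
  have "norm y ^ DIM('a) = ((norm y)\<^sup>2) powr ?k"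
    by (cases "y = 0") (simp_all add: powr_powr power_0_left flip: powr_numeral powr_realpow)
  then have "1 + norm y ^ DIM('a) \<le> (1 + (norm y)\<^sup>2) powr ?k + (1 + (norm y)\<^sup>2) powr ?k"
    by (intro add_mono ge_one_powr_ge_zero) (auto intro: powr_mono2)
  also have "\<dots> \<le> 2 * (K * Q) powr ?k" using powr_mono2[OF _ _ yQ, of ?k] by simp
  finally have le: "1 + norm y ^ DIM('a) \<le> 2 * K powr ?k * Q powr ?k" using K Q by (simp add: powr_mult)
  have "bubble z t y = bubble_const DIM('a) * t powr ?k / Q powr ?k"
    unfolding bubble_def Q_def[symmetric] using t Q by (simp add: powr_divide)
  also have "\<dots> \<le> bubble_const DIM('a) * t powr ?k * (2 * K powr ?k) / (1 + norm y ^ DIM('a))"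
    using mult_left_mono[OF le, of "bubble_const DIM('a) * t powr ?k"] bubble_const_pos[of "DIM('a)"] Q
      one_plus_norm_power_pos[of y "DIM('a)"]
    by (simp add: divide_simps mult_ac)
  finally show "\<bar>bubble z t y\<bar> \<le> bubble_const DIM('a) * t powr ?k * (2 * K powr ?k) / (1 + norm y ^ DIM('a))"
    using bubble_pos[OF t, of z y] by simp
qed

lemma bubble_good: "t > 0 \<Longrightarrow> bubble z t \<in> L10 \<inter> Dini_space"
  using bubble_L10 bubble_Dini by auto

section \<open>The equation at the centre of a bubble\<close>

lemma integral_radial_div:
  fixes c :: "'a::euclidean_space" and g :: "real \<Rightarrow> real"
  assumes [measurable]: "g \<in> borel_measurable borel"
  shows "(LINT y|lborel. g (norm (c - y)) / norm (c - y) ^ DIM('a)) =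
    sphere_area DIM('a) * (LINT r|lborel. indicator {0<..} r * (g r / r))"
proof -
  let ?w = "\<lambda>r. sphere_area DIM('a) * r ^ (DIM('a) - 1) * indicator {0..} r :: real"
  have n: "DIM('a) > 0" by simp
  have "(LINT y|lborel. g (norm (c - y)) / norm (c - y) ^ DIM('a)) = (LINT y|lborel. g (norm (y - c)) / norm (y - c) ^ DIM('a))"
    by (simp add: norm_minus_commute)
  also have "\<dots> = (LINT r|distr lborel borel (\<lambda>y. norm (y - c)). g r / r ^ DIM('a))"
    by (subst integral_distr) auto
  also have "\<dots> = (LINT r|lborel. ?w r *\<^sub>R (g r / r ^ DIM('a)))"
    unfolding distr_norm_lborel using sphere_area_pos[OF n]
    by (subst integral_density) (auto simp: indicator_def)
  also have "\<dots> = (LINT r|lborel. sphere_area DIM('a) * (indicator {0<..} r * (g r / r)))"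
  proof (rule Bochner_Integration.integral_cong)
    fix r :: real
    have "r ^ DIM('a) = r ^ (DIM('a) - 1) * r" using n by (metis Suc_diff_1 power_Suc2)
    then show "?w r *\<^sub>R (g r / r ^ DIM('a)) = sphere_area DIM('a) * (indicator {0<..} r * (g r / r))"
      by (cases "r = 0") (auto simp: indicator_def)
  qed simp
  also have "\<dots> = sphere_area DIM('a) * (LINT r|lborel. indicator {0<..} r * (g r / r))"
    by (rule integral_mult_right_zero)
  finally show ?thesis .
qed

text \<open>The half-integer digamma values arise because the antiderivatives for \<open>n\<close> and \<open>n + 2\<close>
  differ by an elementary function that tends to \<open>1 / n\<close>, matching
  \<open>Digamma (x + 1) = Digamma x + 1 / x\<close> for \<open>x = n / 2\<close>.\<close>

lemma log_profile_primitive: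
  fixes t :: real
  assumes t: "t > 0" and n: "n \<ge> 1"
  shows "\<exists>G. G 0 = 0 \<and>
    (\<forall>r\<ge>0. (G has_real_derivative (1 - (1 + (r / t)\<^sup>2) powr (- real n / 2)) / r) (at r)) \<and>
    ((\<lambda>r. G r - ln r) \<longlongrightarrow> (Digamma (real n / 2) + euler_mascheroni) / 2 - ln t) at_top"
  using n
proof (induction n rule: less_induct)
  case (less n)
  have Q: "1 + (r / t)\<^sup>2 > 0" for r by (simp add: add_pos_nonneg)
  have dQ: "((\<lambda>r. 1 + (r / t)\<^sup>2) has_real_derivative 2 * r / t\<^sup>2) (at r)" for r
    using t by (auto intro!: derivative_eq_intros simp: power2_eq_square)
  have inv0: "((\<lambda>r::real. 1 / r) \<longlongrightarrow> 0) at_top"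
    using tendsto_inverse_0_at_top[OF filterlim_ident, of] by (simp add: inverse_eq_divide)
  have lim: "((\<lambda>r. (1 / r)\<^sup>2 + (1 / t)\<^sup>2) \<longlongrightarrow> (1 / t)\<^sup>2) at_top"
    using tendsto_add[OF tendsto_power[OF inv0, of 2] tendsto_const[of "(1/t)\<^sup>2"]] by simp
  consider "n = 1" | "n = 2" | m where "n = m + 2" "m \<ge> 1"
    using less.prems by (metis One_nat_def Suc_1 add_2_eq_Suc' le_SucE le_add_diff_inverse2 not_less_eq_eq numeral_2_eq_2 plus_1_eq_Suc le0 nat_less_le not0_implies_Suc not_one_le_zero)
  then show ?case
  proof cases
    case 1
    define G where "G = (\<lambda>r. ln (1 + sqrt (1 + (r / t)\<^sup>2)) - ln 2)"
    have "(G has_real_derivative (1 - (1 + (r / t)\<^sup>2) powr (- real n / 2)) / r) (at r)" if "r \<ge> 0" for r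
    proof -
      define s where "s = sqrt (1 + (r / t)\<^sup>2)"
      have s: "s > 0" "s\<^sup>2 = 1 + (r / t)\<^sup>2" using Q[of r] by (auto simp: s_def)
      have "(1 + (r / t)\<^sup>2) powr (- real n / 2) = 1 / s"
        using Q[of r] by (simp add: 1 s_def powr_minus powr_half_sqrt inverse_eq_divide)
      moreover have "(2 * r / t\<^sup>2) / (2 * s) / (1 + s) = (1 - 1 / s) / r"
      \<comment> \<open>At \<open>r = 0\<close> the right-hand side is 0 by division by zero, which
        is the true derivative there since the primitive is an even function.\<close>
      proof (cases "r = 0")
        case False
        have "r\<^sup>2 / t\<^sup>2 = (s - 1) * (s + 1)" using s(2) by (simp add: power_divide algebra_simps power2_eq_square)
        then have "r * (r / t\<^sup>2) = (s - 1) * (s + 1)" by (simp add: power2_eq_square)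
        then have e: "r / t\<^sup>2 = (s - 1) * (s + 1) / r" using False by (simp add: field_simps)
        have "(2 * r / t\<^sup>2) / (2 * s) / (1 + s) = (r / t\<^sup>2) / (s * (1 + s))" by simp
        also have "\<dots> = (1 - 1 / s) / r"
          unfolding e using False s(1) by (simp add: divide_simps)
        finally show ?thesis .
      qed simp
      moreover have "(G has_real_derivative (2 * r / t\<^sup>2) / (2 * s) / (1 + s)) (at r)"
      proof -
        have "((\<lambda>r. sqrt (1 + (r / t)\<^sup>2)) has_real_derivative inverse s / 2 * (2 * r / t\<^sup>2)) (at r)"
          unfolding s_def by (rule DERIV_chain2[OF DERIV_real_sqrt[OF Q] dQ])
        then have "((\<lambda>r. 1 + sqrt (1 + (r / t)\<^sup>2)) has_real_derivative 0 + inverse s / 2 * (2 * r / t\<^sup>2)) (at r)"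
          by (intro DERIV_add DERIV_const)
        then have "((\<lambda>r. ln (1 + sqrt (1 + (r / t)\<^sup>2))) has_real_derivative 1 / (1 + s) * (0 + inverse s / 2 * (2 * r / t\<^sup>2))) (at r)"
          using s(1) unfolding s_def by (intro DERIV_chain2[OF DERIV_ln_divide]) (auto intro: add_pos_pos)
        then have "(G has_real_derivative 1 / (1 + s) * (0 + inverse s / 2 * (2 * r / t\<^sup>2)) - 0) (at r)"
          unfolding G_def by (intro DERIV_diff DERIV_const)
        then show ?thesis by (simp add: field_simps)
      qed
      ultimately show ?thesis by simp
    qed
    moreover have "((\<lambda>r. G r - ln r) \<longlongrightarrow> (Digamma (real n / 2) + euler_mascheroni) / 2 - ln t) at_top"
    proof -
      have "((\<lambda>r. ln (1 / r + sqrt ((1 / r)\<^sup>2 + (1 / t)\<^sup>2)) - ln 2) \<longlongrightarrow> ln (0 + sqrt ((1 / t)\<^sup>2)) - ln 2) at_top"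
        using t by (intro tendsto_intros inv0 lim) auto
      moreover have "\<forall>\<^sub>F r in at_top. ln (1 / r + sqrt ((1 / r)\<^sup>2 + (1 / t)\<^sup>2)) - ln 2 = G r - ln r"
        using eventually_gt_at_top[of 0]
      proof eventually_elim
        case (elim r)
        have "(1 / r)\<^sup>2 + (1 / t)\<^sup>2 = (1 + (r / t)\<^sup>2) / r\<^sup>2" using elim t by (simp add: field_simps power_divide)
        then have "sqrt ((1 / r)\<^sup>2 + (1 / t)\<^sup>2) = sqrt (1 + (r / t)\<^sup>2) / r"
          using elim by (simp only: real_sqrt_divide real_sqrt_abs abs_of_pos)
        then have "1 / r + sqrt ((1 / r)\<^sup>2 + (1 / t)\<^sup>2) = (1 + sqrt (1 + (r / t)\<^sup>2)) / r"
          by (simp add: add_divide_distrib)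
        moreover have "1 + sqrt (1 + (r / t)\<^sup>2) > 0" by (intro add_pos_nonneg) auto
        ultimately show ?case using ln_div[of "1 + sqrt (1 + (r / t)\<^sup>2)" r] elim by (simp add: G_def)
      qed
      ultimately have "((\<lambda>r. G r - ln r) \<longlongrightarrow> ln (0 + sqrt ((1 / t)\<^sup>2)) - ln 2) at_top"
        by (rule Lim_transform_eventually)
      moreover have "ln (0 + sqrt ((1 / t)\<^sup>2)) - ln 2 = (Digamma (real n / 2) + euler_mascheroni) / 2 - ln t"
        using t by (simp add: 1 Digamma_one_half ln_div)
      ultimately show ?thesis by (simp only:)
    qed
    ultimately show ?thesis by (intro exI[of _ G]) (auto simp: G_def)
  next
    case 2
    define G where "G = (\<lambda>r. ln (1 + (r / t)\<^sup>2) / 2)"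
    have "(G has_real_derivative (1 - (1 + (r / t)\<^sup>2) powr (- real n / 2)) / r) (at r)" if "r \<ge> 0" for r
    proof -
      have "(1 + (r / t)\<^sup>2) powr (- real n / 2) = 1 / (1 + (r / t)\<^sup>2)"
        using Q[of r] by (simp add: 2 powr_minus inverse_eq_divide)
      moreover have "(2 * r / t\<^sup>2) / (1 + (r / t)\<^sup>2) / 2 = (1 - 1 / (1 + (r / t)\<^sup>2)) / r"
      proof -
        define q where "q = 1 + (r / t)\<^sup>2"
        have "1 - 1 / q = (r / t)\<^sup>2 / q" using Q[of r] by (simp add: q_def diff_divide_eq_iff)
        then have "(1 - 1 / q) / r = (2 * r / t\<^sup>2) / q / 2" by (simp add: power2_eq_square)
        then show ?thesis by (simp add: q_def)
      qed
      moreover have "(G has_real_derivative (2 * r / t\<^sup>2) / (1 + (r / t)\<^sup>2) / 2) (at r)"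
        using DERIV_cdivide[OF DERIV_chain2[OF DERIV_ln_divide[OF Q] dQ], of 2 r] by (simp add: G_def mult.commute)
      ultimately show ?thesis by simp
    qed
    moreover have "((\<lambda>r. G r - ln r) \<longlongrightarrow> (Digamma (real n / 2) + euler_mascheroni) / 2 - ln t) at_top"
    proof -
      have "((\<lambda>r. ln ((1 / r)\<^sup>2 + (1 / t)\<^sup>2) / 2) \<longlongrightarrow> ln ((1 / t)\<^sup>2) / 2) at_top"
        using t by (intro tendsto_intros lim) auto
      moreover have "\<forall>\<^sub>F r in at_top. ln ((1 / r)\<^sup>2 + (1 / t)\<^sup>2) / 2 = G r - ln r"
        using eventually_gt_at_top[of 0]
      proof eventually_elim
        case (elim r)
        have "(1 / r)\<^sup>2 + (1 / t)\<^sup>2 = (1 + (r / t)\<^sup>2) / r\<^sup>2" using elim t by (simp add: field_simps power_divide)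
        then show ?case using elim Q[of r] by (simp add: G_def ln_div ln_realpow diff_divide_distrib)
      qed
      ultimately have "((\<lambda>r. G r - ln r) \<longlongrightarrow> ln ((1 / t)\<^sup>2) / 2) at_top"
        by (rule Lim_transform_eventually)
      moreover have "ln ((1 / t)\<^sup>2) / 2 = (Digamma (real n / 2) + euler_mascheroni) / 2 - ln t"
        using t by (simp add: 2 ln_realpow ln_div)
      ultimately show ?thesis by (simp only:)
    qed
    ultimately show ?thesis by (intro exI[of _ G]) (auto simp: G_def)
  next
    case (3 m)
    obtain G where G: "G 0 = 0"
      and dG: "\<And>r. r \<ge> 0 \<Longrightarrow> (G has_real_derivative (1 - (1 + (r / t)\<^sup>2) powr (- real m / 2)) / r) (at r)"
      and lG: "((\<lambda>r. G r - ln r) \<longlongrightarrow> (Digamma (real m / 2) + euler_mascheroni) / 2 - ln t) at_top"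
      using less.IH[of m] 3 by auto
    \<comment> \<open>From \<open>m\<close> to \<open>m + 2\<close> the integrand grows by
      \<open>(r / t\<^sup>2) * (1 + (r / t)\<^sup>2) powr (- m / 2 - 1)\<close>, the derivative of
      \<open>- (1 + (r / t)\<^sup>2) powr (- m / 2) / m\<close>. The \<open>- 1\<close> keeps the
      value at 0 equal to 0.\<close>
    define H where "H = (\<lambda>r. G r - ((1 + (r / t)\<^sup>2) powr (- real m / 2) - 1) / real m)"
    have "(H has_real_derivative (1 - (1 + (r / t)\<^sup>2) powr (- real n / 2)) / r) (at r)" if r: "r \<ge> 0" for r
    proof -
      have "((\<lambda>r. (1 + (r / t)\<^sup>2) powr (- real m / 2)) has_real_derivative
          (- real m / 2) * (1 + (r / t)\<^sup>2) powr (- real m / 2 - of_nat 1) * (2 * r / t\<^sup>2)) (at r)"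
        by (rule DERIV_fun_powr[OF dQ Q])
      then have "(H has_real_derivative (1 - (1 + (r / t)\<^sup>2) powr (- real m / 2)) / r -
          ((- real m / 2) * (1 + (r / t)\<^sup>2) powr (- real m / 2 - of_nat 1) * (2 * r / t\<^sup>2) - 0) / real m) (at r)"
        unfolding H_def by (intro DERIV_diff DERIV_cdivide DERIV_const dG r)
      moreover have "(1 - (1 + (r / t)\<^sup>2) powr (- real m / 2)) / r -
          ((- real m / 2) * (1 + (r / t)\<^sup>2) powr (- real m / 2 - of_nat 1) * (2 * r / t\<^sup>2) - 0) / real m
          = (1 - (1 + (r / t)\<^sup>2) powr (- real n / 2)) / r"
      proof -
        define P where "P = (1 + (r / t)\<^sup>2) powr (- real m / 2 - 1)"
        have e: "(1 + (r / t)\<^sup>2) powr (- real n / 2) = P"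
        proof -
          have "- real n / 2 = - real m / 2 - 1" using 3 by simp
          then show ?thesis unfolding P_def by (simp only:)
        qed
        have f: "(1 + (r / t)\<^sup>2) powr (- real m / 2) = P * (1 + (r / t)\<^sup>2)"
          using Q[of r] powr_add[of "1 + (r / t)\<^sup>2" "- real m / 2 - 1" 1] unfolding P_def by simp
        have "((- real m / 2) * P * (2 * r / t\<^sup>2) - 0) / real m = - (P * (r / t\<^sup>2))"
          using 3 by (simp add: field_simps)
        moreover have "(1 - P * (1 + (r / t)\<^sup>2)) / r + P * (r / t\<^sup>2) = (1 - P) / r"
          using t by (cases "r = 0") (auto simp: field_simps power2_eq_square)
        ultimately show ?thesis unfolding e f of_nat_1 P_def[symmetric] by simp
      qed
      ultimately show ?thesis by simp
    qed
    moreover have "((\<lambda>r. H r - ln r) \<longlongrightarrow> (Digamma (real n / 2) + euler_mascheroni) / 2 - ln t) at_top"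
    proof -
      have f: "filterlim (\<lambda>r. 1 + (r / t)\<^sup>2) at_top at_top"
      proof -
        have "filterlim (\<lambda>r. (1 / t) * r) at_top at_top"
          using t by (intro filterlim_tendsto_pos_mult_at_top[OF tendsto_const _ filterlim_ident]) auto
        then have "filterlim (\<lambda>r. r / t) at_top at_top" by simp
        then show ?thesis by (intro filterlim_tendsto_add_at_top[OF tendsto_const] filterlim_pow_at_top) auto
      qed
      have "((\<lambda>r. (1 + (r / t)\<^sup>2) powr (- real m / 2)) \<longlongrightarrow> 0) at_top"
        using 3 by (intro tendsto_neg_powr f) auto
      then have "((\<lambda>r. (G r - ln r) - ((1 + (r / t)\<^sup>2) powr (- real m / 2) - 1) / real m) \<longlongrightarrow>
          ((Digamma (real m / 2) + euler_mascheroni) / 2 - ln t) - (0 - 1) / real m) at_top"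
        using 3 by (intro tendsto_intros lG) auto
      moreover have "((Digamma (real m / 2) + euler_mascheroni) / 2 - ln t) - (0 - 1) / real m
          = (Digamma (real n / 2) + euler_mascheroni) / 2 - ln t"
        using Digamma_plus1[of "real m / 2"] 3 by (simp add: add_divide_distrib add.commute)
      moreover have "(\<lambda>r. (G r - ln r) - ((1 + (r / t)\<^sup>2) powr (- real m / 2) - 1) / real m) = (\<lambda>r. H r - ln r)"
        by (simp add: H_def algebra_simps)
      ultimately show ?thesis by (simp only:)
    qed
    ultimately show ?thesis using G by (intro exI[of _ H]) (auto simp: H_def)
  qed
qed

text \<open>Cut at radius 1, the integrand has constant sign on each piece, with primitives
  \<open>G\<close> and, up to sign, \<open>ln r - G r\<close>. The latter has a limit at infinity,
  so both pieces are finite; \<open>G 1\<close> cancels and only that limit survives.\<close>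

lemma integral_log_profile:
  fixes t :: real
  assumes t: "t > 0" and n: "n \<ge> 1"
  shows "(LINT r|lborel. indicator {0<..} r * ((indicator {..<1} r - (1 + (r / t)\<^sup>2) powr (- real n / 2)) / r))
    = (Digamma (real n / 2) + euler_mascheroni) / 2 - ln t"
proof -
  obtain G where G: "G 0 = 0"
    and dG: "\<And>r. r \<ge> 0 \<Longrightarrow> (G has_real_derivative (1 - (1 + (r / t)\<^sup>2) powr (- real n / 2)) / r) (at r)"
    and lG: "((\<lambda>r. G r - ln r) \<longlongrightarrow> (Digamma (real n / 2) + euler_mascheroni) / 2 - ln t) at_top"
    using log_profile_primitive[OF t n] by auto
  let ?P = "\<lambda>r. (1 + (r / t)\<^sup>2) powr (- real n / 2)"
  let ?J = "(Digamma (real n / 2) + euler_mascheroni) / 2 - ln t"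
  have P1: "?P r \<le> 1" for r
    using powr_mono2'[of "- real n / 2" 1 "1 + (r / t)\<^sup>2"] by simp
  let ?f = "\<lambda>r. (1 - ?P r) / r * indicator {0..1} r"
  let ?g = "\<lambda>r. ?P r / r * indicator {1..} r"
  have nf: "0 \<le> ?f r" for r using P1[of r] by (auto simp: indicator_def)
  have ng: "0 \<le> ?g r" for r by (auto simp: indicator_def)
  have f1: "(\<integral>\<^sup>+r. ennreal (?f r) \<partial>lborel) = ennreal (G 1 - G 0)"
  proof -
    have "(\<integral>\<^sup>+r. ennreal (?f r) \<partial>lborel) = (\<integral>\<^sup>+r. ennreal ((1 - ?P r) / r) * indicator {0..1} r \<partial>lborel)"
      by (intro nn_integral_cong) (auto simp: indicator_def)
    also have "\<dots> = ennreal (G 1 - G 0)"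
      using P1 by (intro nn_integral_FTC_Icc dG) auto
    finally show ?thesis .
  qed
  have g1: "(\<integral>\<^sup>+r. ennreal (?g r) \<partial>lborel) = ennreal (- ?J - (ln 1 - G 1))"
  proof -
    have "(\<integral>\<^sup>+r. ennreal (?g r) \<partial>lborel) = (\<integral>\<^sup>+r. ennreal (?P r / r) * indicator {1..} r \<partial>lborel)"
      by (intro nn_integral_cong) (auto simp: indicator_def)
    also have "\<dots> = ennreal (- ?J - (ln 1 - G 1))"
    proof (rule nn_integral_FTC_atLeast)
      show "((\<lambda>r. ln r - G r) \<longlongrightarrow> - ?J) at_top" using tendsto_minus[OF lG] by simp
      fix r :: real assume "1 \<le> r"
      then show "((\<lambda>r. ln r - G r) has_real_derivative ?P r / r) (at r)"
        by (auto intro!: derivative_eq_intros dG simp: diff_divide_distrib)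
    qed auto
    finally show ?thesis .
  qed
  have G1: "0 \<le> G 1 - G 0"
    using DERIV_nonneg_imp_nondecreasing[of 0 1 G] dG P1 by (metis diff_ge_0_iff_ge divide_nonneg_nonneg zero_le_one)
  have g0: "0 \<le> - ?J - (ln 1 - G 1)"
  proof -
    have "((\<lambda>r. ln r - G r) \<longlongrightarrow> - ?J) at_top" using tendsto_minus[OF lG] by simp
    moreover have "\<forall>\<^sub>F r in at_top. ln 1 - G 1 \<le> ln r - G r"
      using eventually_ge_at_top[of 1]
    proof eventually_elim
      case (elim r)
      show ?case
      proof (rule DERIV_nonneg_imp_nondecreasing[OF elim])
        fix s :: real assume "1 \<le> s" "s \<le> r"
        then have "((\<lambda>r. ln r - G r) has_real_derivative ?P s / s) (at s)"
          by (auto intro!: derivative_eq_intros dG simp: diff_divide_distrib)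
        then show "\<exists>y. ((\<lambda>r. ln r - G r) has_real_derivative y) (at s) \<and> 0 \<le> y"
          using \<open>1 \<le> s\<close> by (intro exI[of _ "?P s / s"]) auto
      qed
    qed
    ultimately have "ln 1 - G 1 \<le> - ?J" by (rule tendsto_lowerbound) simp
    then show ?thesis by simp
  qed
  have hf: "has_bochner_integral lborel ?f (G 1 - G 0)"
    by (rule has_bochner_integral_nn_integral[OF _ _ G1 f1]) (use nf in auto)
  have hg: "has_bochner_integral lborel ?g (- ?J - (ln 1 - G 1))"
    by (rule has_bochner_integral_nn_integral[OF _ _ g0 g1]) (use ng in auto)
  have "(LINT r|lborel. indicator {0<..} r * ((indicator {..<1} r - ?P r) / r)) = (LINT r|lborel. ?f r - ?g r)"
  proof (rule integral_cong_AE)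
    have "AE r in lborel. r \<noteq> (1::real)" by (rule AE_lborel_singleton)
    then show "AE r in lborel. indicator {0<..} r * ((indicator {..<1} r - ?P r) / r) = ?f r - ?g r"
    proof eventually_elim
      case (elim r)
      then show ?case by (cases "r = 0") (auto simp: indicator_def diff_divide_distrib)
    qed
  qed measurable
  also have "\<dots> = (G 1 - G 0) - (- ?J - (ln 1 - G 1))"
    using has_bochner_integral_diff[OF hf hg] by (rule has_bochner_integral_integral_eq)
  finally show ?thesis using G by simp
qed

lemma bubble_center: "t > 0 \<Longrightarrow> bubble z t z = bubble_const DIM('a) * (1 / t) powr (real DIM('a) / 2)"
  for z :: "'a::euclidean_space"
  by (simp add: bubble_def power2_eq_square)

text \<open>Origin of \<open>bubble_const\<close>: the operator returns the value at the centre
  times \<open>2 * ln 2 + 2 * Digamma (n / 2) - 2 * ln t\<close>, and \<open>bubble_const\<close> is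
  the number for which this equals \<open>4 / n\<close> times the logarithm of that value. The Euler
  constant from the radial integral cancels the one in \<open>log_lap_rho\<close>.\<close>

lemma log_laplacian_bubble_center:
  fixes z :: "'a::euclidean_space"
  assumes t: "t > 0"
  shows "log_laplacian (bubble z t) z = 4 / real DIM('a) * (bubble z t z * ln (bubble z t z))"
proof -
  let ?n = "DIM('a)"
  let ?b = "bubble z t"
  have n: "?n > 0" by simp
  have m: "?b \<in> borel_measurable borel" by (rule Dini_space_borel_measurable[OF bubble_Dini[OF t]])
  let ?g = "\<lambda>r. ?b z * (indicator {..<1} r - (1 + (r / t)\<^sup>2) powr (- real ?n / 2))"
  have "?b z * indicator (ball z 1) y - ?b y = ?g (norm (z - y))" for y
  proof -
    have "t / (t\<^sup>2 + (norm (y - z))\<^sup>2) = (1 / t) / (1 + (norm (z - y) / t)\<^sup>2)"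
      using t by (simp add: field_simps power2_eq_square norm_minus_commute)
    then have "?b y = ?b z * (1 + (norm (z - y) / t)\<^sup>2) powr (- real ?n / 2)"
      using t unfolding bubble_center[OF t] bubble_def
      by (simp only:) (simp add: powr_divide[of "1 / t"] powr_minus_divide power2_eq_square del: divide_divide_eq_left divide_divide_eq_right)
    then show ?thesis by (simp add: right_diff_distrib indicator_def dist_norm)
  qed
  then have "log_laplacian ?b z = log_lap_c ?n * (LINT y|lborel. ?g (norm (z - y)) / norm (z - y) ^ ?n) + log_lap_rho ?n * ?b z"
    by (simp add: log_laplacian_lborel[OF m])
  also have "(LINT y|lborel. ?g (norm (z - y)) / norm (z - y) ^ ?n)
    = sphere_area ?n * (LINT r|lborel. indicator {0<..} r * (?g r / r))"
    by (rule integral_radial_div) measurable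
  also have "(LINT r|lborel. indicator {0<..} r * (?g r / r)) = (LINT r|lborel. ?b z * (indicator {0<..} r * ((indicator {..<1} r - (1 + (r / t)\<^sup>2) powr (- real ?n / 2)) / r)))"
    by (intro Bochner_Integration.integral_cong) auto
  also have "\<dots> = ?b z * ((Digamma (real ?n / 2) + euler_mascheroni) / 2 - ln t)"
    using n by (simp only: integral_mult_right_zero integral_log_profile[OF t] Suc_le_eq One_nat_def)
  finally have "log_laplacian ?b z = (log_lap_c ?n * sphere_area ?n) * ?b z * ((Digamma (real ?n / 2) + euler_mascheroni) / 2 - ln t) + log_lap_rho ?n * ?b z"
    by simp
  also have "\<dots> = ?b z * (2 * ln 2 + 2 * Digamma (real ?n / 2) - 2 * ln t)"
    unfolding log_lap_c_sphere_area[OF n] log_lap_rho_def by (simp add: algebra_simps)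
  finally have L: "log_laplacian ?b z = ?b z * (2 * ln 2 + 2 * Digamma (real ?n / 2) - 2 * ln t)" .
  have "ln (?b z) = real ?n / 2 * (ln 2 + Digamma (real ?n / 2) - ln t)"
    using t unfolding bubble_center[OF t] bubble_const_def
    by (simp add: ln_mult ln_powr ln_div algebra_simps)
  then have "4 / real ?n * ln (?b z) = 2 * ln 2 + 2 * Digamma (real ?n / 2) - 2 * ln t"
    using n by (simp add: field_simps)
  then show ?thesis unfolding L by (metis mult.left_commute)
qed

section \<open>Conformal covariance of the logarithmic Laplacian\<close>

lemma integrable_annulus:
  fixes x :: "'a::euclidean_space"
  assumes s: "0 < s" and [measurable]: "A \<in> sets borel"
    and A: "\<And>y. y \<in> A \<Longrightarrow> s \<le> norm (y - x) \<and> norm (y - x) \<le> R"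
  shows "integrable lborel (\<lambda>y. indicator A y / norm (x - y) ^ DIM('a))"
proof (cases "s \<le> R")
  case True
  let ?B = "{y. s \<le> norm (y - x) \<and> norm (y - x) \<le> R}"
  have [measurable]: "?B \<in> sets borel" by measurable
  show ?thesis
  proof (rule integrableI_bounded)
    have "(\<integral>\<^sup>+y. ennreal (norm (indicator A y / norm (x - y) ^ DIM('a))) \<partial>lborel)
       \<le> (\<integral>\<^sup>+y\<in>?B. ennreal (1 / norm (y - x) ^ DIM('a)) \<partial>lborel)"
      using A by (intro nn_integral_mono) (auto simp: indicator_def norm_minus_commute)
    also have "\<dots> < \<infinity>" by (subst nn_integral_annulus[OF s True]) simp
    finally show "(\<integral>\<^sup>+y. ennreal (norm (indicator A y / norm (x - y) ^ DIM('a))) \<partial>lborel) < \<infinity>" .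
  qed measurable
next
  case False
  then have "A = {}" using A by force
  then show ?thesis by simp
qed

lemma integral_annulus:
  fixes x :: "'a::euclidean_space"
  assumes "0 < s" "s \<le> R"
  shows "(LINT y|lborel. indicator {y. s \<le> norm (y - x) \<and> norm (y - x) \<le> R} y / norm (x - y) ^ DIM('a))
    = sphere_area DIM('a) * ln (R / s)"
proof -
  let ?B = "{y. s \<le> norm (y - x) \<and> norm (y - x) \<le> R}"
  have [measurable]: "?B \<in> sets borel" by measurable
  have "(\<integral>\<^sup>+y. ennreal (indicator ?B y / norm (x - y) ^ DIM('a)) \<partial>lborel)
    = (\<integral>\<^sup>+y\<in>?B. ennreal (1 / norm (y - x) ^ DIM('a)) \<partial>lborel)"
    by (intro nn_integral_cong) (auto simp: indicator_def norm_minus_commute)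
  also have "\<dots> = ennreal (sphere_area DIM('a) * ln (R / s))" by (rule nn_integral_annulus[OF assms])
  finally have "has_bochner_integral lborel (\<lambda>y. indicator ?B y / norm (x - y) ^ DIM('a)) (sphere_area DIM('a) * ln (R / s))"
    using assms sphere_area_pos[of "DIM('a)"]
    by (intro has_bochner_integral_nn_integral) (auto intro!: mult_nonneg_nonneg ln_ge_zero simp: field_simps less_imp_le)
  then show ?thesis by (rule has_bochner_integral_integral_eq)
qed

text \<open>The regularising ball around \<open>x\<close> may be replaced by any sets \<open>E k\<close> whose complements
  shrink to \<open>x\<close>; this is what makes the operator accessible to the inversion, under which balls
  around \<open>x\<close> are not mapped to balls around the image of \<open>x\<close>.\<close>

lemma log_integrand_limit:
  fixes u :: "'a::euclidean_space \<Rightarrow> real" and E :: "nat \<Rightarrow> 'a set"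
  assumes u: "u \<in> L10 \<inter> Dini_space"
    and E[measurable]: "\<And>k. E k \<in> sets borel"
    and s: "\<And>k. s k > 0" and Es: "\<And>k y. y \<in> E k \<Longrightarrow> s k \<le> norm (y - x)"
    and exh: "\<And>y. y \<noteq> x \<Longrightarrow> \<forall>\<^sub>F k in sequentially. y \<in> E k"
  shows "(\<lambda>k. u x * (LINT y|lborel. indicator (E k \<inter> ball x 1) y / norm (x - y) ^ DIM('a))
      - (LINT y|lborel. indicator (E k) y * (u y / norm (x - y) ^ DIM('a))))
    \<longlonglongrightarrow> (LINT y|lborel. (u x * indicator (ball x 1) y - u y) / norm (x - y) ^ DIM('a))"
proof -
  let ?F = "\<lambda>y. (u x * indicator (ball x 1) y - u y) / norm (x - y) ^ DIM('a)"
  have [measurable]: "u \<in> borel_measurable borel" "ball x 1 \<in> sets borel"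
    using u Dini_space_borel_measurable by auto
  note iF = integrable_log_integrand[OF u, of x]
  have "(\<lambda>k. LINT y|lborel. indicator (E k) y * ?F y) \<longlonglongrightarrow> (LINT y|lborel. ?F y)"
  proof (rule integral_dominated_convergence[where w = "\<lambda>y. norm (?F y)"])
    show "integrable lborel (\<lambda>y. norm (?F y))" using iF by (rule integrable_norm)
    show "AE y in lborel. (\<lambda>k. indicator (E k) y * ?F y) \<longlonglongrightarrow> ?F y"
    proof (rule AE_mp[OF AE_lborel_singleton[of x]], rule AE_I2, rule impI)
      fix y assume "y \<noteq> x"
      from exh[OF this] have "\<forall>\<^sub>F k in sequentially. indicator (E k) y * ?F y = ?F y"
        by eventually_elim simp
      then show "(\<lambda>k. indicator (E k) y * ?F y) \<longlonglongrightarrow> ?F y" by (rule tendsto_eventually)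
    qed
    show "AE y in lborel. norm (indicator (E k) y * ?F y) \<le> norm (?F y)" for k
      by (intro AE_I2) (simp add: indicator_def)
  qed measurable
  moreover have "(LINT y|lborel. indicator (E k) y * ?F y)
     = u x * (LINT y|lborel. indicator (E k \<inter> ball x 1) y / norm (x - y) ^ DIM('a))
      - (LINT y|lborel. indicator (E k) y * (u y / norm (x - y) ^ DIM('a)))" for k
  proof -
    have 1: "integrable lborel (\<lambda>y. indicator (E k \<inter> ball x 1) y / norm (x - y) ^ DIM('a))"
      using Es by (intro integrable_annulus[OF s[of k], where R = 1]) (auto simp: dist_norm norm_minus_commute)
    have 2: "integrable lborel (\<lambda>y. indicator (E k) y * (u y / norm (x - y) ^ DIM('a)))"
      using u Es by (intro integrable_L10_tail[OF _ _ _ s[of k]]) auto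
    have "(LINT y|lborel. indicator (E k) y * ?F y) = (LINT y|lborel. u x * (indicator (E k \<inter> ball x 1) y / norm (x - y) ^ DIM('a))
      - indicator (E k) y * (u y / norm (x - y) ^ DIM('a)))"
      by (intro Bochner_Integration.integral_cong) (auto simp: indicator_def diff_divide_distrib)
    also have "\<dots> = (LINT y|lborel. u x * (indicator (E k \<inter> ball x 1) y / norm (x - y) ^ DIM('a)))
      - (LINT y|lborel. indicator (E k) y * (u y / norm (x - y) ^ DIM('a)))"
      using 1 2 by (intro Bochner_Integration.integral_diff integrable_mult_right)
    finally show ?thesis by (simp only: integral_mult_right_zero)
  qed
  ultimately show ?thesis by simp
qed

lemma AE_not_in_sphere: "AE y in lborel. norm (y - x) \<noteq> r" for x :: "'a::euclidean_space"
proof -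
  have "sphere x r \<in> null_sets lborel"
    using negligible_sphere[of x r] closed_sphere[of x r]
    by (auto simp: negligible_iff_null_sets null_sets_completion_iff)
  then have "AE y in lborel. y \<notin> sphere x r" by (rule AE_not_in)
  then show ?thesis by eventually_elim (simp add: dist_norm norm_minus_commute)
qed

text \<open>Comparison of the weight of \<open>E\<close> inside the unit ball with that of an
  annulus. With two radii whose ratio tends to 1 it determines a divergent weight up to an error
  that tends to 0. The bound by \<open>s\<close> serves integrability and may be much smaller than
  \<open>r\<close>.\<close>

lemma
  fixes x :: "'a::euclidean_space"
  assumes E: "E \<in> sets borel" and r: "0 < r" "r \<le> 1"
    and s: "0 < s" "\<And>y. y \<in> E \<Longrightarrow> s \<le> norm (y - x)"
  shows integral_ball_minus_le: "(\<And>y. y \<in> E \<Longrightarrow> r \<le> norm (y - x)) \<Longrightarrow>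
      (LINT y|lborel. indicator (E \<inter> ball x 1) y / norm (x - y) ^ DIM('a)) \<le> sphere_area DIM('a) * ln (1 / r)"
    and integral_ball_minus_ge: "(\<And>y. r \<le> norm (y - x) \<Longrightarrow> y \<in> E) \<Longrightarrow>
      sphere_area DIM('a) * ln (1 / r) \<le> (LINT y|lborel. indicator (E \<inter> ball x 1) y / norm (x - y) ^ DIM('a))"
proof -
  let ?B = "{y. r \<le> norm (y - x) \<and> norm (y - x) \<le> 1}"
  have [measurable]: "E \<in> sets borel" "?B \<in> sets borel" by (fact E) measurable
  have iE: "integrable lborel (\<lambda>y. indicator (E \<inter> ball x 1) y / norm (x - y) ^ DIM('a))"
    using s(2) E by (intro integrable_annulus[OF s(1), where R = 1]) (auto simp: dist_norm norm_minus_commute)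
  have iB: "integrable lborel (\<lambda>y. indicator ?B y / norm (x - y) ^ DIM('a))"
    by (intro integrable_annulus[OF r(1), where R = 1]) auto
  note eq = integral_annulus[OF r, of x, symmetric]
  show "(LINT y|lborel. indicator (E \<inter> ball x 1) y / norm (x - y) ^ DIM('a)) \<le> sphere_area DIM('a) * ln (1 / r)"
    if "\<And>y. y \<in> E \<Longrightarrow> r \<le> norm (y - x)"
    unfolding eq using that
    by (intro integral_mono[OF iE iB]) (auto simp: indicator_def dist_norm norm_minus_commute)
  show "sphere_area DIM('a) * ln (1 / r) \<le> (LINT y|lborel. indicator (E \<inter> ball x 1) y / norm (x - y) ^ DIM('a))"
    if "\<And>y. r \<le> norm (y - x) \<Longrightarrow> y \<in> E"
    unfolding eq
  proof (rule integral_mono_AE[OF iB iE])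
    show "AE y in lborel. indicator ?B y / norm (x - y) ^ DIM('a) \<le> indicator (E \<inter> ball x 1) y / norm (x - y) ^ DIM('a)"
      using AE_not_in_sphere[of x 1]
      by eventually_elim (use that in \<open>auto simp: indicator_def dist_norm norm_minus_commute\<close>)
  qed
qed

text \<open>Removing the ball of radius \<open>s k\<close> around \<open>x\<close> amounts, after
  the inversion, to removing nearly a ball of radius \<open>s k * \<mu>\<^sup>2\<close> around
  \<open>z\<close>. The two divergent weights differ by \<open>sphere_area * 2 * ln \<mu>\<close> in
  the limit, which \<open>log_lap_c\<close> turns into \<open>4 * ln \<mu>\<close>.\<close>

lemma log_laplacian_sphere_inv_invariant:
  fixes b :: "'a::euclidean_space \<Rightarrow> real"
  assumes b: "b \<in> L10 \<inter> Dini_space" and l: "l > 0" and za: "z \<noteq> a"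
    and inv: "\<And>y. y \<noteq> a \<Longrightarrow> b (sphere_inv a l y) = (norm (y - a) / l) ^ DIM('a) * b y"
  defines "\<mu> \<equiv> norm (z - a) / l"
  shows "log_laplacian b (sphere_inv a l z) = \<mu> ^ DIM('a) * (log_laplacian b z + 4 * ln \<mu> * b z)"
proof -
  let ?n = "DIM('a)"
  define x where "x = sphere_inv a l z"
  have [measurable]: "b \<in> borel_measurable borel" using b Dini_space_borel_measurable by auto
  have [measurable]: "ball x 1 \<in> sets borel" "ball z 1 \<in> sets borel" by simp_all
  have d: "norm (z - a) > 0" using za by simp
  have \<mu>: "\<mu> > 0" using d l by (simp add: \<mu>_def)
  have bx: "b x = \<mu> ^ ?n * b z" unfolding x_def \<mu>_def using za by (rule inv)
  have n: "?n > 0" by simp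
  let ?I = "\<lambda>x. LINT y|lborel. (b x * indicator (ball x 1) y - b y) / norm (x - y) ^ ?n"
  \<comment> \<open>This bound on the removed radii keeps \<open>a\<close> in every
    \<open>E k\<close> and both \<open>\<kappa> k\<close> and \<open>\<tau> k\<close> below
    \<open>1/2\<close>, so the radii \<open>\<tau> k / (1 - \<kappa> k)\<close> stay inside the unit
    ball.\<close>
  define q where "q = min (1/2) (min (l\<^sup>2 / norm (z - a) / 2) (1 / (2 * \<mu>\<^sup>2)))"
  have q: "0 < q" "q \<le> 1/2" "q * norm (z - a) / l\<^sup>2 \<le> 1/2" "q * \<mu>\<^sup>2 \<le> 1/2"
  proof -
    show "0 < q" "q \<le> 1/2" using d l \<mu> by (auto simp: q_def)
    have "q \<le> l\<^sup>2 / norm (z - a) / 2" "q \<le> 1 / (2 * \<mu>\<^sup>2)" by (auto simp: q_def)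
    then show "q * norm (z - a) / l\<^sup>2 \<le> 1/2" "q * \<mu>\<^sup>2 \<le> 1/2" using d l \<mu> by (auto simp: field_simps)
  qed
  define s where "s = (\<lambda>k::nat. q / real (Suc k))"
  have s0: "s k > 0" and sq: "s k \<le> q" for k
    using q(1) by (auto simp: s_def field_simps)
  have s_lim: "s \<longlonglongrightarrow> 0"
    unfolding s_def using LIMSEQ_Suc[OF lim_const_over_n[of q]] by simp
  \<comment> \<open>Off the centre, the complement of \<open>E k\<close> is the Apollonian ball
    where \<open>norm (y - z) < \<kappa> k * norm (y - a)\<close>. It lies between the balls around
    \<open>z\<close> of radii \<open>\<tau> k / (1 + \<kappa> k)\<close> and
    \<open>\<tau> k / (1 - \<kappa> k)\<close>, whose ratio tends to 1.\<close>
  define \<kappa> where "\<kappa> = (\<lambda>k. s k * norm (z - a) / l\<^sup>2)"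
  have \<kappa>0: "\<kappa> k > 0" for k using s0 d l by (simp add: \<kappa>_def)
  have \<kappa>1: "\<kappa> k \<le> 1/2" for k
  proof -
    have "\<kappa> k \<le> q * norm (z - a) / l\<^sup>2" unfolding \<kappa>_def using sq[of k] by (intro divide_right_mono mult_right_mono) auto
    then show ?thesis using q(3) by (rule order_trans)
  qed
  have \<kappa>_lim: "\<kappa> \<longlonglongrightarrow> 0"
    unfolding \<kappa>_def using tendsto_divide[OF tendsto_mult[OF s_lim tendsto_const] tendsto_const, of "l\<^sup>2" "norm (z - a)"] l by simp
  define \<tau> where "\<tau> = (\<lambda>k. s k * \<mu>\<^sup>2)"
  have \<tau>\<kappa>: "\<tau> k = \<kappa> k * norm (z - a)" for k by (simp add: \<tau>_def \<kappa>_def \<mu>_def power_divide power2_eq_square)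
  have \<tau>0: "\<tau> k > 0" for k using s0 \<mu> by (simp add: \<tau>_def)
  define A where "A = (\<lambda>k. {y. s k \<le> norm (y - x)})"
  define E where "E = (\<lambda>k. {y. s k \<le> norm (sphere_inv a l y - x)})"
  have [measurable]: "A k \<in> sets borel" "E k \<in> sets borel" for k unfolding A_def E_def by measurable
  have dist: "norm (sphere_inv a l y - x) = l\<^sup>2 * norm (y - z) / (norm (y - a) * norm (z - a))" if "y \<noteq> a" for y
    unfolding x_def using that za by (rule norm_sphere_inv_diff)
  have E_iff: "y \<in> E k \<longleftrightarrow> \<kappa> k * norm (y - a) \<le> norm (y - z)" if "y \<noteq> a" for y k
    using that d l unfolding E_def by (simp add: dist \<kappa>_def field_simps)
  have aE: "a \<in> E k" for k
  proof -
    have "s k \<le> l\<^sup>2 / norm (z - a) / 2" using sq[of k] by (simp add: q_def)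
    also have "\<dots> \<le> l\<^sup>2 / norm (z - a)" using half_gt_zero[of "l\<^sup>2 / norm (z - a)"] d l by (simp add: field_simps)
    also have "\<dots> = norm (a - x)" unfolding x_def by (metis norm_sphere_inv_center norm_minus_commute)
    finally show ?thesis by (simp add: E_def)
  qed
  have lower: "norm (y - z) \<ge> \<tau> k / (1 + \<kappa> k)" if "y \<in> E k" for y k
  proof -
    have tri: "norm (z - a) \<le> norm (y - a) + norm (y - z)"
      using norm_triangle_ineq4[of "y - a" "y - z"] by simp
    have "\<kappa> k * norm (z - a) \<le> norm (y - z) + \<kappa> k * norm (y - z)"
    proof (cases "y = a")
      case False
      have "\<kappa> k * norm (z - a) \<le> \<kappa> k * norm (y - a) + \<kappa> k * norm (y - z)"
        using tri \<kappa>0[of k] by (simp flip: distrib_left)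
      also have "\<dots> \<le> norm (y - z) + \<kappa> k * norm (y - z)" using that E_iff[OF False] by simp
      finally show ?thesis .
    qed (simp add: norm_minus_commute)
    then show ?thesis using \<kappa>0[of k] by (simp add: \<tau>\<kappa> field_simps add_pos_pos)
  qed
  have upper: "y \<in> E k" if "norm (y - z) \<ge> \<tau> k / (1 - \<kappa> k)" for y k
  proof (cases "y = a")
    case False
    have "norm (y - a) \<le> norm (y - z) + norm (z - a)" using norm_triangle_ineq[of "y - z" "z - a"] by simp
    then have "\<kappa> k * norm (y - a) \<le> \<kappa> k * norm (y - z) + \<kappa> k * norm (z - a)"
      using \<kappa>0[of k] by (simp flip: distrib_left)
    also have "\<dots> \<le> norm (y - z)" using that \<kappa>1[of k] by (simp add: \<tau>\<kappa> field_simps)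
    finally show ?thesis using E_iff[OF False] by simp
  qed (simp add: aE)
  have exA: "\<forall>\<^sub>F k in sequentially. y \<in> A k" if "y \<noteq> x" for y
  proof -
    have "\<forall>\<^sub>F k in sequentially. s k < norm (y - x)" using that s_lim by (intro order_tendstoD(2)) auto
    then show ?thesis by eventually_elim (simp add: A_def)
  qed
  have limA: "(\<lambda>k. b x * (sphere_area ?n * ln (1 / s k)) - (LINT y|lborel. indicator (A k) y * (b y / norm (x - y) ^ ?n))) \<longlonglongrightarrow> ?I x"
  proof -
    have eq: "(LINT y|lborel. indicator (A k \<inter> ball x 1) y / norm (x - y) ^ ?n) = sphere_area ?n * ln (1 / s k)" for k
      using s0[of k] sq[of k] q(2)
      by (intro antisym integral_ball_minus_le[where s = "s k"] integral_ball_minus_ge[where s = "s k"]) (auto simp: A_def)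
    have "(\<lambda>k. b x * (LINT y|lborel. indicator (A k \<inter> ball x 1) y / norm (x - y) ^ ?n)
        - (LINT y|lborel. indicator (A k) y * (b y / norm (x - y) ^ ?n))) \<longlonglongrightarrow> ?I x"
      by (rule log_integrand_limit[OF b _ s0 _ exA]) (simp_all add: A_def)
    then show ?thesis by (simp only: eq)
  qed
  define m where "m = (\<lambda>k. LINT y|lborel. indicator (E k \<inter> ball z 1) y / norm (z - y) ^ ?n)"
  have exE: "\<forall>\<^sub>F k in sequentially. y \<in> E k" if yz: "y \<noteq> z" for y
  proof (cases "y = a")
    case False
    have "(\<lambda>k. \<kappa> k * norm (y - a)) \<longlonglongrightarrow> 0" using tendsto_mult[OF \<kappa>_lim tendsto_const] by simp
    then have "\<forall>\<^sub>F k in sequentially. \<kappa> k * norm (y - a) < norm (y - z)" using yz by (intro order_tendstoD(2)) auto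
    then show ?thesis by eventually_elim (simp add: E_iff[OF False])
  qed (simp add: aE)
  have limE: "(\<lambda>k. b z * m k - (LINT y|lborel. indicator (E k) y * (b y / norm (z - y) ^ ?n))) \<longlonglongrightarrow> ?I z"
    unfolding m_def
  proof (rule log_integrand_limit[OF b, where s = "\<lambda>k. \<tau> k / (1 + \<kappa> k)"])
    show "0 < \<tau> k / (1 + \<kappa> k)" for k using \<tau>0[of k] \<kappa>0[of k] by simp
  qed (use lower exE in auto)
  have \<tau>1: "\<tau> k \<le> 1/2" for k
  proof -
    have "\<tau> k \<le> q * \<mu>\<^sup>2" unfolding \<tau>_def using sq[of k] by (intro mult_right_mono) auto
    then show ?thesis using q(4) by simp
  qed
  have E_away: "0 < \<tau> k / (1 + \<kappa> k)" for k using \<tau>0[of k] \<kappa>0[of k] by simp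
  have m_upper: "m k \<le> sphere_area ?n * ln (1 / (\<tau> k / (1 + \<kappa> k)))" for k
    unfolding m_def using \<tau>1[of k] \<kappa>0[of k]
    by (intro integral_ball_minus_le[OF _ E_away _ E_away lower] lower) (auto simp: field_simps)
  have m_lower: "m k \<ge> sphere_area ?n * ln (1 / (\<tau> k / (1 - \<kappa> k)))" for k
    unfolding m_def
  proof (rule integral_ball_minus_ge[where s = "\<tau> k / (1 + \<kappa> k)"])
    show "\<tau> k / (1 - \<kappa> k) \<le> norm (y - z) \<Longrightarrow> y \<in> E k" for y by (rule upper)
  qed (use \<tau>0[of k] \<tau>1[of k] \<kappa>1[of k] E_away[of k] lower in \<open>auto simp: pos_divide_le_eq\<close>)
  have m_lim: "(\<lambda>k. m k - sphere_area ?n * ln (1 / \<tau> k)) \<longlonglongrightarrow> 0"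
  proof (rule tendsto_sandwich)
    show "\<forall>\<^sub>F k in sequentially. sphere_area ?n * ln (1 - \<kappa> k) \<le> m k - sphere_area ?n * ln (1 / \<tau> k)"
    proof (intro always_eventually allI)
      fix k
      have "ln (1 / (\<tau> k / (1 - \<kappa> k))) = ln (1 - \<kappa> k) + ln (1 / \<tau> k)"
        using \<tau>0[of k] \<kappa>1[of k] by (simp add: ln_div)
      then show "sphere_area ?n * ln (1 - \<kappa> k) \<le> m k - sphere_area ?n * ln (1 / \<tau> k)"
        using m_lower[of k] by (simp add: distrib_left)
    qed
    show "\<forall>\<^sub>F k in sequentially. m k - sphere_area ?n * ln (1 / \<tau> k) \<le> sphere_area ?n * ln (1 + \<kappa> k)"
    proof (intro always_eventually allI)
      fix k
      have "ln (1 / (\<tau> k / (1 + \<kappa> k))) = ln (1 + \<kappa> k) + ln (1 / \<tau> k)"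
        using \<tau>0[of k] \<kappa>0[of k] by (simp add: ln_div)
      then show "m k - sphere_area ?n * ln (1 / \<tau> k) \<le> sphere_area ?n * ln (1 + \<kappa> k)"
        using m_upper[of k] by (simp add: distrib_left)
    qed
    have "(\<lambda>k. sphere_area ?n * ln (1 - \<kappa> k)) \<longlonglongrightarrow> sphere_area ?n * ln (1 - 0)"
      by (intro tendsto_intros \<kappa>_lim) simp
    then show "(\<lambda>k. sphere_area ?n * ln (1 - \<kappa> k)) \<longlonglongrightarrow> 0" by simp
    have "(\<lambda>k. sphere_area ?n * ln (1 + \<kappa> k)) \<longlonglongrightarrow> sphere_area ?n * ln (1 + 0)"
      by (intro tendsto_intros \<kappa>_lim) simp
    then show "(\<lambda>k. sphere_area ?n * ln (1 + \<kappa> k)) \<longlonglongrightarrow> 0" by simp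
  qed
  have transfer: "(LINT y|lborel. indicator (A k) y * (b y / norm (x - y) ^ ?n))
    = \<mu> ^ ?n * (LINT y|lborel. indicator (E k) y * (b y / norm (z - y) ^ ?n))" for k
  proof -
    have "(LINT y|lborel. indicator (A k) y * (b y / norm (x - y) ^ ?n))
      = (LINT y|lborel. (l / norm (y - a)) ^ (2 * ?n) * (indicator (A k) (sphere_inv a l y) * (b (sphere_inv a l y) / norm (x - sphere_inv a l y) ^ ?n)))"
      by (rule integral_sphere_inv[OF l]) measurable
    also have "\<dots> = (LINT y|lborel. \<mu> ^ ?n * (indicator (E k) y * (b y / norm (z - y) ^ ?n)))"
    proof (rule integral_cong_AE)
      show "AE y in lborel. (l / norm (y - a)) ^ (2 * ?n) * (indicator (A k) (sphere_inv a l y) * (b (sphere_inv a l y) / norm (x - sphere_inv a l y) ^ ?n))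
         = \<mu> ^ ?n * (indicator (E k) y * (b y / norm (z - y) ^ ?n))"
      proof (rule AE_mp[OF AE_lborel_singleton[of a]], rule AE_I2, rule impI)
        fix y assume ya: "y \<noteq> a"
        have i: "indicator (A k) (sphere_inv a l y) = (indicator (E k) y :: real)"
          by (simp add: A_def E_def indicator_def)
        have "(l / norm (y - a)) ^ (2 * ?n) * (indicator (A k) (sphere_inv a l y) * (b (sphere_inv a l y) / norm (x - sphere_inv a l y) ^ ?n))
          = indicator (E k) y * b y * ((l / norm (y - a)) ^ (2 * ?n) * ((norm (y - a) / l) ^ ?n / norm (sphere_inv a l z - sphere_inv a l y) ^ ?n))"
          unfolding i inv[OF ya] x_def by simp
        also have "\<dots> = \<mu> ^ ?n * (indicator (E k) y * (b y / norm (z - y) ^ ?n))"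
          unfolding sphere_inv_kernel[OF l za ya] \<mu>_def by simp
        finally show "(l / norm (y - a)) ^ (2 * ?n) * (indicator (A k) (sphere_inv a l y) * (b (sphere_inv a l y) / norm (x - sphere_inv a l y) ^ ?n))
         = \<mu> ^ ?n * (indicator (E k) y * (b y / norm (z - y) ^ ?n))" .
      qed
    qed measurable
    finally show ?thesis by (simp only: integral_mult_right_zero)
  qed
  have "(\<lambda>k. \<mu> ^ ?n * (b z * m k - (LINT y|lborel. indicator (E k) y * (b y / norm (z - y) ^ ?n)))
     - \<mu> ^ ?n * b z * (m k - sphere_area ?n * ln (1 / \<tau> k)) + \<mu> ^ ?n * b z * (sphere_area ?n * (2 * ln \<mu>)))
     \<longlonglongrightarrow> \<mu> ^ ?n * ?I z - \<mu> ^ ?n * b z * 0 + \<mu> ^ ?n * b z * (sphere_area ?n * (2 * ln \<mu>))"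
    by (intro tendsto_intros limE m_lim)
  moreover have "\<mu> ^ ?n * (b z * m k - (LINT y|lborel. indicator (E k) y * (b y / norm (z - y) ^ ?n)))
     - \<mu> ^ ?n * b z * (m k - sphere_area ?n * ln (1 / \<tau> k)) + \<mu> ^ ?n * b z * (sphere_area ?n * (2 * ln \<mu>))
     = b x * (sphere_area ?n * ln (1 / s k)) - (LINT y|lborel. indicator (A k) y * (b y / norm (x - y) ^ ?n))" for k
  proof -
    have "ln (1 / s k) = ln (1 / \<tau> k) + 2 * ln \<mu>"
      using s0[of k] \<mu> by (simp add: \<tau>_def ln_div ln_mult ln_realpow)
    then show ?thesis unfolding transfer bx by (simp add: algebra_simps)
  qed
  ultimately have "(\<lambda>k. b x * (sphere_area ?n * ln (1 / s k)) - (LINT y|lborel. indicator (A k) y * (b y / norm (x - y) ^ ?n)))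
     \<longlonglongrightarrow> \<mu> ^ ?n * ?I z - \<mu> ^ ?n * b z * 0 + \<mu> ^ ?n * b z * (sphere_area ?n * (2 * ln \<mu>))"
    by (simp only:)
  then have "?I x = \<mu> ^ ?n * ?I z - \<mu> ^ ?n * b z * 0 + \<mu> ^ ?n * b z * (sphere_area ?n * (2 * ln \<mu>))"
    by (rule LIMSEQ_unique[OF limA])
  then have Ix: "?I x = \<mu> ^ ?n * (?I z + b z * (sphere_area ?n * (2 * ln \<mu>)))"
    by (simp only: mult_zero_right diff_zero distrib_left mult.assoc)
  have m: "b \<in> borel_measurable borel" by measurable
  have "log_laplacian b x = \<mu> ^ ?n * (log_lap_c ?n * ?I z + log_lap_rho ?n * b z + (log_lap_c ?n * sphere_area ?n) * (2 * ln \<mu>) * b z)"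
    unfolding log_laplacian_lborel[OF m] Ix unfolding bx by (simp only: algebra_simps)
  then show ?thesis
    unfolding log_lap_c_sphere_area[OF n] log_laplacian_lborel[OF m] x_def by simp
qed

text \<open>The condition on \<open>l\<close> says that the point \<open>(z, t)\<close> of the upper
  half-space lies on the hemisphere with centre \<open>a\<close> and radius \<open>l\<close>. The
  inversion, extended to the half-space, fixes this point, and therefore the bubble that it
  determines.\<close>

lemma bubble_sphere_inv:
  fixes a z :: "'a::euclidean_space"
  assumes t: "t > 0" and l: "l > 0" and lt: "l\<^sup>2 = t\<^sup>2 + (norm (a - z))\<^sup>2" and y: "y \<noteq> a"
  shows "bubble z t (sphere_inv a l y) = (norm (y - a) / l) ^ DIM('a) * bubble z t y"
proof -
  define p d where "p = y - a" and "d = z - a"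
  have p: "p \<noteq> 0" using y by (simp add: p_def)
  have P: "norm p > 0" using p by simp
  have lt': "t\<^sup>2 = l\<^sup>2 - d \<bullet> d" using lt unfolding norm_minus_commute[of a] by (simp add: d_def power2_norm_eq_inner)
  have q: "t\<^sup>2 + (norm (y - z))\<^sup>2 > 0" using t by (simp add: add_pos_nonneg)
  have "t\<^sup>2 + (norm (sphere_inv a l y - z))\<^sup>2 = t\<^sup>2 + (norm ((l\<^sup>2 / (norm p)\<^sup>2) *\<^sub>R p - d))\<^sup>2"
    by (simp add: sphere_inv_def p_def d_def algebra_simps)
  also have "\<dots> = t\<^sup>2 + (l\<^sup>2 / (norm p)\<^sup>2)\<^sup>2 * (p \<bullet> p) - 2 * (l\<^sup>2 / (norm p)\<^sup>2) * (p \<bullet> d) + d \<bullet> d"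
    unfolding power2_norm_eq_inner by (simp add: inner_diff inner_commute power2_eq_square algebra_simps)
  also have "\<dots> = (l / norm p)\<^sup>2 * (l\<^sup>2 + p \<bullet> p - 2 * (p \<bullet> d))"
    unfolding lt' using p unfolding power_divide power2_norm_eq_inner by (simp add: field_simps power2_eq_square)
  also have "l\<^sup>2 + p \<bullet> p - 2 * (p \<bullet> d) = t\<^sup>2 + (norm (p - d))\<^sup>2"
    unfolding lt' power2_norm_eq_inner by (simp add: inner_diff inner_commute)
  also have "p - d = y - z" by (simp add: p_def d_def)
  finally have e: "t\<^sup>2 + (norm (sphere_inv a l y - z))\<^sup>2 = (l / norm p)\<^sup>2 * (t\<^sup>2 + (norm (y - z))\<^sup>2)" .
  have "t / (t\<^sup>2 + (norm (sphere_inv a l y - z))\<^sup>2) = (norm p / l)\<^sup>2 * (t / (t\<^sup>2 + (norm (y - z))\<^sup>2))"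
    unfolding e using P l q by (simp add: field_simps power_divide)
  then have "bubble z t (sphere_inv a l y) = bubble_const DIM('a) * (((norm p / l)\<^sup>2) powr (real DIM('a) / 2) * (t / (t\<^sup>2 + (norm (y - z))\<^sup>2)) powr (real DIM('a) / 2))"
    unfolding bubble_def using t by (simp only: powr_mult)
  also have "((norm p / l)\<^sup>2) powr (real DIM('a) / 2) = (norm p / l) ^ DIM('a)"
    using P l by (simp add: powr_powr flip: powr_numeral powr_realpow)
  finally show ?thesis unfolding bubble_def p_def by simp
qed

text \<open>A point \<open>x\<close> other than the centre is exchanged with the centre by an inversion that leaves
  the bubble invariant.\<close>

lemma log_laplacian_bubble:
  fixes z x :: "'a::euclidean_space"
  assumes t: "t > 0"
  shows "log_laplacian (bubble z t) x = 4 / real DIM('a) * (bubble z t x * ln (bubble z t x))"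
proof (cases "x = z")
  case True
  then show ?thesis using log_laplacian_bubble_center[OF t] by simp
next
  case False
  let ?n = "DIM('a)"
  \<comment> \<open>For \<open>a\<close> on the line through \<open>x\<close> and \<open>z\<close>,
    beyond \<open>z\<close>, exchanging them requires
    \<open>norm (z - a) * norm (x - a) = l\<^sup>2\<close>. With
    \<open>l\<^sup>2 = t\<^sup>2 + (norm (a - z))\<^sup>2\<close> this reduces to
    \<open>norm (z - a) * norm (x - z) = t\<^sup>2\<close>.\<close>
  define a where "a = z - (t\<^sup>2 / (norm (x - z))\<^sup>2) *\<^sub>R (x - z)"
  define l where "l = sqrt (t\<^sup>2 + (norm (a - z))\<^sup>2)"
  have N: "norm (x - z) > 0" using False by simp
  have l0: "l > 0" unfolding l_def using t by (simp add: add_pos_nonneg)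
  have l2: "l\<^sup>2 = t\<^sup>2 + (norm (a - z))\<^sup>2" unfolding l_def by simp
  have za: "z - a = (t\<^sup>2 / (norm (x - z))\<^sup>2) *\<^sub>R (x - z)" by (simp add: a_def)
  have nza: "norm (z - a) = t\<^sup>2 / norm (x - z)"
    unfolding za using N by (simp add: power2_eq_square)
  have zna: "z \<noteq> a" using nza N t by auto
  have x: "sphere_inv a l z = x"
  proof -
    have "l\<^sup>2 / (norm (z - a))\<^sup>2 * (t\<^sup>2 / (norm (x - z))\<^sup>2) = t\<^sup>2 / (norm (x - z))\<^sup>2 + 1"
      unfolding l2 norm_minus_commute[of a z] nza using N t by (simp add: field_simps power2_eq_square)
    then have "sphere_inv a l z = a + (t\<^sup>2 / (norm (x - z))\<^sup>2 + 1) *\<^sub>R (x - z)"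
      unfolding sphere_inv_def by (subst (2) za) simp
    then show ?thesis by (simp add: a_def scaleR_left_distrib)
  qed
  define \<mu> where "\<mu> = norm (z - a) / l"
  have \<mu>: "\<mu> > 0" using zna l0 by (simp add: \<mu>_def)
  have bz: "bubble z t z > 0" by (rule bubble_pos[OF t])
  have bx: "bubble z t x = \<mu> ^ ?n * bubble z t z"
    using bubble_sphere_inv[OF t l0 l2 zna] by (simp add: x \<mu>_def)
  have "log_laplacian (bubble z t) x = \<mu> ^ ?n * (log_laplacian (bubble z t) z + 4 * ln \<mu> * bubble z t z)"
    using log_laplacian_sphere_inv_invariant[OF bubble_good[OF t] l0 zna bubble_sphere_inv[OF t l0 l2]]
    by (simp add: x \<mu>_def)
  also have "\<dots> = 4 / real ?n * (\<mu> ^ ?n * bubble z t z * (ln (bubble z t z) + real ?n * ln \<mu>))"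
    unfolding log_laplacian_bubble_center[OF t] by (simp add: field_simps)
  also have "ln (bubble z t z) + real ?n * ln \<mu> = ln (\<mu> ^ ?n * bubble z t z)"
    using \<mu> bz by (simp add: ln_mult ln_realpow)
  finally show ?thesis by (simp add: bx)
qed

lemma bubble_solution:
  fixes z :: "'a::euclidean_space"
  assumes "t > 0"
  shows "log_lap_solution (bubble z t)"
proof -
  have "bubble z t z \<noteq> 0" using bubble_pos[OF assms, of z z] by simp
  then show ?thesis unfolding log_lap_solution_def
    using bubble_good[OF assms, of z] bubble_pos[OF assms, of z] log_laplacian_bubble[OF assms, of z]
    by (auto simp: less_imp_le)
qed

section \<open>Moving spheres\<close>

definition kelvin :: "'a::euclidean_space \<Rightarrow> real \<Rightarrow> ('a \<Rightarrow> real) \<Rightarrow> 'a \<Rightarrow> real" where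
  "kelvin a l u x = (l / norm (x - a)) ^ DIM('a) * u (sphere_inv a l x)"

definition bubble_ratio :: "'a::euclidean_space \<Rightarrow> real \<Rightarrow> ('a \<Rightarrow> real) \<Rightarrow> 'a \<Rightarrow> real" where
  "bubble_ratio a l u x = u x / bubble a l x"

text \<open>For ratios to the bubble, the Kelvin transform is plain composition with the inversion.
  The gap is therefore odd under it, with value 0 at the centre and on the sphere.\<close>

definition kelvin_gap :: "'a::euclidean_space \<Rightarrow> real \<Rightarrow> ('a \<Rightarrow> real) \<Rightarrow> 'a \<Rightarrow> real" where
  "kelvin_gap a l u x = bubble_ratio a l u (sphere_inv a l x) - bubble_ratio a l u x"

lemma bubble_sphere_inv_self:
  fixes a :: "'a::euclidean_space"
  assumes "l > 0" "y \<noteq> a"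
  shows "bubble a l (sphere_inv a l y) = (norm (y - a) / l) ^ DIM('a) * bubble a l y"
  using assms by (intro bubble_sphere_inv) auto

lemma kelvin_gap_eq:
  fixes a :: "'a::euclidean_space"
  assumes l: "l > 0" and x: "x \<noteq> a"
  shows "kelvin_gap a l u x = (kelvin a l u x - u x) / bubble a l x"
proof -
  have "(norm (x - a) / l) ^ DIM('a) * (l / norm (x - a)) ^ DIM('a) = 1"
    using l x by (simp flip: power_mult_distrib)
  then have "u (sphere_inv a l x) / ((norm (x - a) / l) ^ DIM('a) * bubble a l x) = kelvin a l u x / bubble a l x"
    using l x bubble_pos[OF l, of a x] unfolding kelvin_def by (simp add: field_simps)
  then show ?thesis
    unfolding kelvin_gap_def bubble_ratio_def bubble_sphere_inv_self[OF l x] by (simp add: diff_divide_distrib)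
qed

lemma kelvin_gap_sphere_inv: "l \<noteq> 0 \<Longrightarrow> kelvin_gap a l u (sphere_inv a l x) = - kelvin_gap a l u x"
  by (simp add: kelvin_gap_def)

lemma sphere_inv_on_sphere: "norm (x - a) = l \<Longrightarrow> sphere_inv a l x = x"
  by (cases "l = 0") (simp_all add: sphere_inv_def)

text \<open>The logarithm of \<open>u = b * U\<close> splits, and its part \<open>ln b\<close> is
  consumed by the equation of the bubble itself.\<close>

lemma bubble_ratio_equation:
  fixes u :: "'a::euclidean_space \<Rightarrow> real" and a x :: 'a
  assumes sol: "log_lap_solution u" and l: "l > 0"
  defines "U \<equiv> bubble_ratio a l u"
  shows "integrable lborel (\<lambda>y. (U x - U y) * bubble a l y / norm (x - y) ^ DIM('a))"
    and "log_lap_c DIM('a) * (LINT y|lborel. (U x - U y) * bubble a l y / norm (x - y) ^ DIM('a))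
      = 4 / real DIM('a) * (bubble a l x * (U x * ln (U x)))"
proof -
  let ?b = "bubble a l"
  have u: "u \<in> L10 \<inter> Dini_space" and eq: "log_laplacian u x = 4 / real DIM('a) * (u x * ln (u x))"
    using sol unfolding log_lap_solution_def by auto
  have up: "u x > 0" by (rule log_lap_solution_pos[OF sol])
  have bp: "?b x > 0" by (rule bubble_pos[OF l])
  note gs = log_laplacian_ground_state[OF u bubble_good[OF l] bubble_pos[OF l], of x a]
  show "integrable lborel (\<lambda>y. (U x - U y) * ?b y / norm (x - y) ^ DIM('a))"
    using gs(1) by (simp add: U_def bubble_ratio_def)
  have "log_lap_c DIM('a) * (LINT y|lborel. (U x - U y) * ?b y / norm (x - y) ^ DIM('a))
    = log_laplacian u x - u x / ?b x * log_laplacian ?b x"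
    using gs(2) by (simp add: U_def bubble_ratio_def)
  also have "\<dots> = 4 / real DIM('a) * (u x * (ln (u x) - ln (?b x)))"
    unfolding eq log_laplacian_bubble[OF l] using bp by (simp add: field_simps)
  also have "\<dots> = 4 / real DIM('a) * (?b x * (U x * ln (U x)))"
    using up bp by (simp add: U_def bubble_ratio_def ln_div)
  finally show "log_lap_c DIM('a) * (LINT y|lborel. (U x - U y) * bubble a l y / norm (x - y) ^ DIM('a))
      = 4 / real DIM('a) * (bubble a l x * (U x * ln (U x)))" .
qed

lemma bubble_ratio_borel [measurable]:
  assumes "u \<in> borel_measurable borel" "l > 0"
  shows "bubble_ratio a l u \<in> borel_measurable borel"
proof -
  have [measurable]: "u \<in> borel_measurable borel" "bubble a l \<in> borel_measurable borel"
    using assms Dini_space_borel_measurable[OF bubble_Dini] by auto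
  show ?thesis unfolding bubble_ratio_def by measurable
qed

text \<open>No cut-off is present, so the inversion acts on the convergent integral directly; each
  side picks up the same factor \<open>M\<close>.\<close>

lemma kelvin_ratio_equation:
  fixes u :: "'a::euclidean_space \<Rightarrow> real" and a x :: 'a
  assumes sol: "log_lap_solution u" and l: "l > 0" and x: "x \<noteq> a"
  defines "V \<equiv> \<lambda>y. bubble_ratio a l u (sphere_inv a l y)"
  shows "integrable lborel (\<lambda>y. (V x - V y) * bubble a l y / norm (x - y) ^ DIM('a))"
    and "log_lap_c DIM('a) * (LINT y|lborel. (V x - V y) * bubble a l y / norm (x - y) ^ DIM('a))
      = 4 / real DIM('a) * (bubble a l x * (V x * ln (V x)))"
proof -
  let ?n = "DIM('a)" and ?b = "bubble a l" and ?U = "bubble_ratio a l u" and ?x = "sphere_inv a l x"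
  have [measurable]: "u \<in> borel_measurable borel"
    using sol Dini_space_borel_measurable unfolding log_lap_solution_def by auto
  have [measurable]: "?b \<in> borel_measurable borel" by (rule Dini_space_borel_measurable[OF bubble_Dini[OF l]])
  have [measurable]: "?U \<in> borel_measurable borel" using l by measurable
  define M where "M = (norm (x - a) / l) ^ ?n"
  have M: "M > 0" using x l by (simp add: M_def)
  let ?F = "\<lambda>y. (?U ?x - ?U y) * ?b y / norm (?x - y) ^ ?n"
  let ?G = "\<lambda>y. (V x - V y) * ?b y / norm (x - y) ^ ?n"
  let ?T = "\<lambda>y. (l / norm (y - a)) ^ (2 * ?n) * ?F (sphere_inv a l y)"
  have [measurable]: "V \<in> borel_measurable borel" unfolding V_def by measurable
  have mF: "?F \<in> borel_measurable borel" by measurable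
  have AE: "AE y in lborel. ?T y = M * ?G y"
  proof (rule AE_mp[OF AE_lborel_singleton[of a]], rule AE_I2, rule impI)
    fix y assume y: "y \<noteq> a"
    have "?T y = (V x - V y) * ?b y * ((l / norm (y - a)) ^ (2 * ?n) * ((norm (y - a) / l) ^ ?n / norm (?x - sphere_inv a l y) ^ ?n))"
      unfolding V_def bubble_sphere_inv_self[OF l y] by simp
    also have "\<dots> = M * ?G y" unfolding sphere_inv_kernel[OF l x y] M_def by simp
    finally show "?T y = M * ?G y" .
  qed
  have "integrable lborel ?T"
    using integrable_sphere_inv[OF l mF, of a] bubble_ratio_equation(1)[OF sol l] by blast
  then have "integrable lborel (\<lambda>y. M * ?G y)"
    by (rule integrable_cong_AE[THEN iffD1, rotated 3]) (use AE in \<open>simp_all\<close>)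
  then show "integrable lborel ?G" using M by (simp only: integrable_mult_left_iff) simp
  have "(LINT y|lborel. ?F y) = (LINT y|lborel. ?T y)" by (rule integral_sphere_inv[OF l mF])
  also have "\<dots> = (LINT y|lborel. M * ?G y)" using AE by (intro integral_cong_AE) measurable
  also have "\<dots> = M * (LINT y|lborel. ?G y)" by (rule integral_mult_right_zero)
  finally have "M * (log_lap_c ?n * (LINT y|lborel. ?G y)) = log_lap_c ?n * (LINT y|lborel. ?F y)" by simp
  also have "\<dots> = 4 / real ?n * (?b ?x * (?U ?x * ln (?U ?x)))" by (rule bubble_ratio_equation(2)[OF sol l])
  also have "\<dots> = M * (4 / real ?n * (?b x * (V x * ln (V x))))"
    unfolding bubble_sphere_inv_self[OF l x] V_def M_def by simp
  finally show "log_lap_c ?n * (LINT y|lborel. ?G y) = 4 / real ?n * (?b x * (V x * ln (V x)))"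
    using M by (simp only: mult_cancel_left) simp
qed

lemma kelvin_gap_equation:
  fixes u :: "'a::euclidean_space \<Rightarrow> real" and a x :: 'a
  assumes sol: "log_lap_solution u" and l: "l > 0" and x: "x \<noteq> a"
  defines "U \<equiv> bubble_ratio a l u" and "V \<equiv> \<lambda>y. bubble_ratio a l u (sphere_inv a l y)"
    and "W \<equiv> kelvin_gap a l u"
  shows "integrable lborel (\<lambda>y. (W x - W y) * bubble a l y / norm (x - y) ^ DIM('a))"
    and "log_lap_c DIM('a) * (LINT y|lborel. (W x - W y) * bubble a l y / norm (x - y) ^ DIM('a))
      = 4 / real DIM('a) * (bubble a l x * (V x * ln (V x) - U x * ln (U x)))"
proof -
  let ?F = "\<lambda>U y. (U x - U y) * bubble a l y / norm (x - y) ^ DIM('a)"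
  note u = bubble_ratio_equation[OF sol l, of a x, folded U_def]
  have v: "integrable lborel (?F V)" "log_lap_c DIM('a) * (LINT y|lborel. ?F V y)
      = 4 / real DIM('a) * (bubble a l x * (V x * ln (V x)))"
    unfolding V_def by (rule kelvin_ratio_equation[OF sol l x])+
  have eq: "?F W y = ?F V y - ?F U y" for y
  proof -
    have "W x - W y = (V x - V y) - (U x - U y)" by (simp add: W_def kelvin_gap_def U_def V_def)
    then show ?thesis by (simp only: left_diff_distrib diff_divide_distrib)
  qed
  show "integrable lborel (?F W)" unfolding eq by (rule Bochner_Integration.integrable_diff[OF v(1) u(1)])
  have "(LINT y|lborel. ?F W y) = (LINT y|lborel. ?F V y) - (LINT y|lborel. ?F U y)"
    unfolding eq by (rule Bochner_Integration.integral_diff[OF v(1) u(1)])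
  then show "log_lap_c DIM('a) * (LINT y|lborel. ?F W y)
      = 4 / real DIM('a) * (bubble a l x * (V x * ln (V x) - U x * ln (U x)))"
    using u(2) v(2) by (simp only: right_diff_distrib)
qed

text \<open>The kernel of an image charge: what the kernel at \<open>x\<close> becomes for points
  outside the ball after these have been reflected into it.\<close>

definition inv_kernel :: "'a::euclidean_space \<Rightarrow> real \<Rightarrow> 'a \<Rightarrow> 'a \<Rightarrow> real" where
  "inv_kernel a l x y = (l / norm (x - a)) ^ DIM('a) / norm (sphere_inv a l x - y) ^ DIM('a)"

lemma inv_kernel_nonneg: "l > 0 \<Longrightarrow> 0 \<le> inv_kernel a l x y"
  by (simp add: inv_kernel_def)

text \<open>With \<open>p = x - a\<close> and \<open>q = y - a\<close>, the squares of the two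
  distances, suitably scaled, differ by
  \<open>(l\<^sup>2 - p \<bullet> p) * (l\<^sup>2 - q \<bullet> q)\<close>, which is positive for
  two points inside the ball.\<close>

lemma inv_kernel_less:
  fixes a :: "'a::euclidean_space"
  assumes x: "x \<noteq> a" "norm (x - a) < l" and y: "norm (y - a) < l" and xy: "x \<noteq> y"
  shows "inv_kernel a l x y < 1 / norm (x - y) ^ DIM('a)"
proof -
  define p q where "p = x - a" and "q = y - a"
  have l: "l > 0" using y by (meson le_less_trans norm_ge_zero)
  have p: "norm p > 0" using x by (simp add: p_def)
  have "(norm p * norm (sphere_inv a l x - y))\<^sup>2 = (norm p)\<^sup>2 * (norm ((l\<^sup>2 / (norm p)\<^sup>2) *\<^sub>R p - q))\<^sup>2"
    by (simp add: power_mult_distrib sphere_inv_def p_def q_def algebra_simps)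
  also have "\<dots> = (p \<bullet> p) * ((l\<^sup>2 / (p \<bullet> p))\<^sup>2 * (p \<bullet> p) - 2 * (l\<^sup>2 / (p \<bullet> p)) * (p \<bullet> q) + q \<bullet> q)"
    unfolding power2_norm_eq_inner by (simp add: inner_diff inner_commute power2_eq_square algebra_simps)
  also have "\<dots> = l\<^sup>2 * l\<^sup>2 - 2 * l\<^sup>2 * (p \<bullet> q) + (p \<bullet> p) * (q \<bullet> q)"
    using p by (simp add: field_simps power2_eq_square)
  also have "\<dots> = l\<^sup>2 * (p \<bullet> p - 2 * (p \<bullet> q) + q \<bullet> q) + (l\<^sup>2 - p \<bullet> p) * (l\<^sup>2 - q \<bullet> q)"
    by (simp add: algebra_simps)
  also have "p \<bullet> p - 2 * (p \<bullet> q) + q \<bullet> q = (norm (p - q))\<^sup>2"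
    unfolding power2_norm_eq_inner by (simp add: inner_diff inner_commute)
  also have "p - q = x - y" by (simp add: p_def q_def)
  finally have e: "(norm p * norm (sphere_inv a l x - y))\<^sup>2 = (l * norm (x - y))\<^sup>2 + (l\<^sup>2 - p \<bullet> p) * (l\<^sup>2 - q \<bullet> q)"
    by (simp add: power_mult_distrib)
  have "p \<bullet> p < l\<^sup>2" "q \<bullet> q < l\<^sup>2"
    using x(2) y unfolding p_def q_def power2_norm_eq_inner[symmetric] by (auto intro!: power_strict_mono)
  then have "(l * norm (x - y))\<^sup>2 < (norm p * norm (sphere_inv a l x - y))\<^sup>2" unfolding e by simp
  then have lt: "l * norm (x - y) < norm p * norm (sphere_inv a l x - y)"
    by (rule power_less_imp_less_base) simp
  then have s: "norm (sphere_inv a l x - y) > 0" using l by (metis mult_less_cancel_left_pos mult_zero_right norm_ge_zero not_less p zero_le_mult_iff le_less less_le_trans mult_nonneg_nonneg)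
  have "(l / norm p) / norm (sphere_inv a l x - y) < 1 / norm (x - y)"
    using lt s p xy l by (simp add: field_simps)
  then have "((l / norm p) / norm (sphere_inv a l x - y)) ^ DIM('a) < (1 / norm (x - y)) ^ DIM('a)"
    using l by (intro power_strict_mono) auto
  then show ?thesis unfolding inv_kernel_def p_def by (simp add: power_divide power_mult_distrib)
qed

text \<open>The part of the integral outside the ball is folded into the ball by the inversion, under
  which the gap is odd.\<close>

lemma kelvin_gap_fold:
  fixes u :: "'a::euclidean_space \<Rightarrow> real" and a x :: 'a
  assumes sol: "log_lap_solution u" and x: "x \<noteq> a" "norm (x - a) < l"
  defines "W \<equiv> kelvin_gap a l u"
  defines "H \<equiv> \<lambda>y. if norm (y - a) < l
     then (W x - W y) * bubble a l y / norm (x - y) ^ DIM('a) + W y * inv_kernel a l x y * bubble a l y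
     else W x * bubble a l y / norm (x - y) ^ DIM('a)"
  shows "integrable lborel H"
    and "(LINT y|lborel. H y) = (LINT y|lborel. (W x - W y) * bubble a l y / norm (x - y) ^ DIM('a))"
proof -
  let ?n = "DIM('a)" and ?b = "bubble a l"
  have l: "l > 0" using x(2) by (meson le_less_trans norm_ge_zero)
  have [measurable]: "u \<in> borel_measurable borel"
    using sol Dini_space_borel_measurable unfolding log_lap_solution_def by auto
  have [measurable]: "?b \<in> borel_measurable borel" by (rule Dini_space_borel_measurable[OF bubble_Dini[OF l]])
  have [measurable]: "bubble_ratio a l u \<in> borel_measurable borel" using l by measurable
  have [measurable]: "W \<in> borel_measurable borel" unfolding W_def kelvin_gap_def by measurable
  let ?G = "\<lambda>y. (W x - W y) * ?b y / norm (x - y) ^ ?n"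
  define B where "B = {y. norm (y - a) < l}"
  have [measurable]: "B \<in> sets borel" unfolding B_def by measurable
  have iG: "integrable lborel ?G" unfolding W_def by (rule kelvin_gap_equation(1)[OF sol l x(1)])
  have i1: "integrable lborel (\<lambda>y. indicator B y * ?G y)"
    using integrable_mult_indicator[OF _ iG, of B] by simp
  have ib: "integrable lborel (\<lambda>y. indicator (- B) y * (?b y / norm (x - y) ^ ?n))"
  proof (rule integrable_L10_tail[where r = "l - norm (x - a)"])
    show "?b \<in> L10" by (rule bubble_L10[OF l])
    fix y assume "y \<in> - B"
    then have "l \<le> norm (y - a)" by (simp add: B_def)
    then show "l - norm (x - a) \<le> norm (y - x)" using norm_triangle_ineq[of "y - x" "x - a"] by simp
  qed (use x in simp_all)
  let ?D = "\<lambda>y. indicator (- B) y * (W y * ?b y / norm (x - y) ^ ?n)"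
  have eqD: "?D y = W x * (indicator (- B) y * (?b y / norm (x - y) ^ ?n)) - indicator (- B) y * ?G y" for y
    by (simp add: indicator_def algebra_simps diff_divide_distrib)
  have "integrable lborel (\<lambda>y. indicator (- B) y * ?G y)"
    using integrable_mult_indicator[OF _ iG, of "- B"] by simp
  then have iD: "integrable lborel ?D"
    unfolding eqD using ib by (intro Bochner_Integration.integrable_diff integrable_mult_right)
  let ?K = "\<lambda>y. indicator B y * (W y * inv_kernel a l x y * ?b y)"
  have [measurable]: "inv_kernel a l x \<in> borel_measurable borel" unfolding inv_kernel_def by measurable
  let ?T = "\<lambda>y. (l / norm (y - a)) ^ (2 * ?n) * ?D (sphere_inv a l y)"
  have xi: "sphere_inv a l x \<noteq> a" using x l by (simp add: sphere_inv_eq_center_iff)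
  have mD: "?D \<in> borel_measurable borel" by measurable
  \<comment> \<open>Ball and complement are exchanged only up to the sphere and the centre, which
    are null sets.\<close>
  have AE: "AE y in lborel. ?T y = - ?K y"
    using AE_lborel_singleton[of a] AE_not_in_sphere[of a l]
  proof eventually_elim
    case (elim y)
    have y: "norm (y - a) > 0" using elim by simp
    have "sphere_inv a l y \<in> - B \<longleftrightarrow> l \<le> l\<^sup>2 / norm (y - a)" by (auto simp: B_def norm_sphere_inv_center)
    also have "\<dots> \<longleftrightarrow> norm (y - a) \<le> l" using y l by (simp add: field_simps power2_eq_square)
    also have "\<dots> \<longleftrightarrow> y \<in> B" using elim by (auto simp: B_def)
    finally have i: "indicator (- B) (sphere_inv a l y) = (indicator B y :: real)" by (simp add: indicator_def)
    \<comment> \<open>Writing \<open>x\<close> as its double inversion lets the kernel law be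
      applied at the reflected point, which is how \<open>inv_kernel\<close> appears.\<close>
    have "?T y = indicator B y * (- W y * ?b y * ((l / norm (y - a)) ^ (2 * ?n) * ((norm (y - a) / l) ^ ?n / norm (sphere_inv a l (sphere_inv a l x) - sphere_inv a l y) ^ ?n)))"
      unfolding i bubble_sphere_inv_self[OF l elim(1)] using l by (simp add: W_def kelvin_gap_sphere_inv)
    also have "\<dots> = - ?K y"
      unfolding sphere_inv_kernel[OF l xi elim(1)] inv_kernel_def norm_sphere_inv_center
      using l x by (simp add: power2_eq_square)
    finally show ?case .
  qed
  have "integrable lborel ?T" using integrable_sphere_inv[OF l mD, of a] iD by blast
  then have "integrable lborel (\<lambda>y. - ?K y)"
    by (rule integrable_cong_AE[THEN iffD1, rotated 3]) (use AE in \<open>simp_all\<close>)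
  then have iK: "integrable lborel ?K" using integrable_minus by fastforce
  have "(LINT y|lborel. ?D y) = (LINT y|lborel. ?T y)" by (rule integral_sphere_inv[OF l mD])
  also have "\<dots> = (LINT y|lborel. - ?K y)" using AE by (intro integral_cong_AE) measurable
  finally have DK: "(LINT y|lborel. ?D y) = - (LINT y|lborel. ?K y)" by simp
  have ibW: "integrable lborel (\<lambda>y. W x * (indicator (- B) y * (?b y / norm (x - y) ^ ?n)))"
    using ib by (rule integrable_mult_right)
  have H: "H y = (indicator B y * ?G y + ?K y) + W x * (indicator (- B) y * (?b y / norm (x - y) ^ ?n))" for y
    unfolding H_def by (simp add: B_def indicator_def)
  show "integrable lborel H"
    unfolding H using i1 iK ibW by (intro Bochner_Integration.integrable_add)
  have G: "?G y = (indicator B y * ?G y - ?D y) + W x * (indicator (- B) y * (?b y / norm (x - y) ^ ?n))" for y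
    by (simp add: indicator_def algebra_simps diff_divide_distrib)
  have "(LINT y|lborel. H y) = (LINT y|lborel. indicator B y * ?G y) + (LINT y|lborel. ?K y)
     + (LINT y|lborel. W x * (indicator (- B) y * (?b y / norm (x - y) ^ ?n)))"
    unfolding H
    by (simp only: Bochner_Integration.integral_add[OF Bochner_Integration.integrable_add[OF i1 iK] ibW]
        Bochner_Integration.integral_add[OF i1 iK])
  moreover have "(LINT y|lborel. ?G y) = (LINT y|lborel. (indicator B y * ?G y - ?D y) + W x * (indicator (- B) y * (?b y / norm (x - y) ^ ?n)))"
    by (rule Bochner_Integration.integral_cong[OF refl G])
  moreover have "\<dots> = (LINT y|lborel. indicator B y * ?G y) - (LINT y|lborel. ?D y)
     + (LINT y|lborel. W x * (indicator (- B) y * (?b y / norm (x - y) ^ ?n)))"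
    by (simp only: Bochner_Integration.integral_add[OF Bochner_Integration.integrable_diff[OF i1 iD] ibW]
        Bochner_Integration.integral_diff[OF i1 iD])
  ultimately show "(LINT y|lborel. H y) = (LINT y|lborel. ?G y)" using DK by linarith
qed

section \<open>Maximum principles for the gap\<close>

lemma continuous_on_cball_bounded:
  fixes f :: "'a::euclidean_space \<Rightarrow> real"
  assumes "continuous_on (cball a r) f"
  obtains M where "\<And>y. norm (y - a) \<le> r \<Longrightarrow> \<bar>f y\<bar> \<le> M"
proof -
  have "bounded (f ` cball a r)"
    using assms by (intro compact_imp_bounded compact_continuous_image compact_cball)
  then obtain M where "\<forall>z\<in>f ` cball a r. norm z \<le> M" unfolding bounded_iff by auto
  then have "\<bar>f y\<bar> \<le> M" if "norm (y - a) \<le> r" for y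
    using that by (auto simp: dist_norm norm_minus_commute)
  then show ?thesis by (rule that)
qed

lemma bubble_ratio_continuous_on:
  assumes "u \<in> Dini_space" "l > 0"
  shows "continuous_on A (bubble_ratio a l u)"
proof -
  have "continuous_on A (bubble a l)" by (rule Dini_space_continuous_on[OF bubble_Dini[OF assms(2)]])
  moreover have "bubble a l y \<noteq> 0" for y using bubble_pos[OF assms(2), of a y] by simp
  ultimately show ?thesis
    unfolding bubble_ratio_def using Dini_space_continuous_on[OF assms(1)] by (intro continuous_intros) auto
qed

lemma kelvin_gap_continuous_on:
  assumes "u \<in> Dini_space" "l > 0"
  shows "continuous_on (- {a}) (kelvin_gap a l u)"
  unfolding kelvin_gap_def
  by (intro continuous_on_diff bubble_ratio_continuous_on[OF assms]
      continuous_on_compose2[OF bubble_ratio_continuous_on[OF assms, of UNIV] continuous_on_sphere_inv]) auto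

text \<open>At a zero of the gap both nonlinear terms agree, so the folded integral vanishes. Its
  integrand has one sign because the reflected kernel is strictly smaller; hence the gap vanishes
  almost everywhere in the ball, and by continuity on the punctured ball.\<close>

lemma kelvin_gap_strong_maximum:
  fixes u :: "'a::euclidean_space \<Rightarrow> real" and a x y :: 'a
  assumes sol: "log_lap_solution u"
    and nonneg: "\<And>y. y \<noteq> a \<Longrightarrow> norm (y - a) < l \<Longrightarrow> 0 \<le> kelvin_gap a l u y"
    and x: "x \<noteq> a" "norm (x - a) < l" and W0: "kelvin_gap a l u x = 0"
    and y: "y \<noteq> a" "norm (y - a) < l"
  shows "kelvin_gap a l u y = 0"
proof -
  let ?W = "kelvin_gap a l u" and ?b = "bubble a l"
  have l: "l > 0" using x(2) by (meson le_less_trans norm_ge_zero)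
  have bp: "?b y > 0" for y by (rule bubble_pos[OF l])
  have c: "log_lap_c DIM('a) > 0" by (rule log_lap_c_pos) simp
  define H where "H = (\<lambda>y. if norm (y - a) < l
     then (?W x - ?W y) * ?b y / norm (x - y) ^ DIM('a) + ?W y * inv_kernel a l x y * ?b y
     else ?W x * ?b y / norm (x - y) ^ DIM('a))"
  note H = kelvin_gap_fold[OF sol x, folded H_def]
  have "bubble_ratio a l u (sphere_inv a l x) = bubble_ratio a l u x" using W0 by (simp add: kelvin_gap_def)
  then have "(LINT y|lborel. H y) = 0"
    using kelvin_gap_equation(2)[OF sol l x(1)] c unfolding H(2) by simp
  then have i0: "(LINT y|lborel. - H y) = 0" by simp
  have Heq: "- H y = (if norm (y - a) < l then ?W y * ?b y * (1 / norm (x - y) ^ DIM('a) - inv_kernel a l x y) else 0)"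
    if "y \<noteq> x" for y
    using that by (simp add: H_def W0 algebra_simps)
  have "0 \<le> - H y" if "y \<noteq> a" for y
  proof (cases "y = x")
    case False
    then show ?thesis
      using Heq[OF False] nonneg[OF that] bp[of y] inv_kernel_less[OF x, of y] by (auto simp: less_imp_le)
  qed (simp add: H_def W0)
  then have "AE y in lborel. 0 \<le> - H y"
    using AE_lborel_singleton[of a] by (auto elim: eventually_mono)
  then have "AE y in lborel. - H y = 0"
    using i0 H(1) by (subst (asm) integral_nonneg_eq_0_iff_AE) auto
  then have "AE y in lborel. y \<notin> - {a} \<inter> ball a l \<inter> ?W -` (- {0})"
    using AE_lborel_singleton[of x]
  proof eventually_elim
    case (elim y)
    show ?case
      using Heq[OF elim(2)] elim bp[of y] inv_kernel_less[OF x, of y]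
      by (auto simp: dist_norm norm_minus_commute split: if_splits)
  qed
  moreover have "open (- {a} \<inter> ball a l \<inter> ?W -` (- {0}))"
    by (intro continuous_open_preimage continuous_on_subset[OF kelvin_gap_continuous_on[OF _ l]])
       (use sol in \<open>auto simp: log_lap_solution_def\<close>)
  ultimately have "- {a} \<inter> ball a l \<inter> ?W -` (- {0}) = {}" by (intro open_AE_imp_empty)
  then show ?thesis using y by (auto simp: dist_norm norm_minus_commute)
qed

text \<open>The factor \<open>sqrt (norm (y - a))\<close> forces a minimum away from \<open>a\<close>, where nothing is known
  about the limiting behaviour of the gap.\<close>

lemma kelvin_gap_weighted_minimum:
  fixes u :: "'a::euclidean_space \<Rightarrow> real" and a x :: 'a
  assumes sol: "log_lap_solution u"
    and x: "x \<noteq> a" "norm (x - a) < l" and neg: "kelvin_gap a l u x < 0"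
  obtains x0 where "x0 \<noteq> a" "norm (x0 - a) < l" "kelvin_gap a l u x0 < 0"
    "\<And>y. y \<noteq> a \<Longrightarrow> norm (y - a) < l \<Longrightarrow>
      sqrt (norm (x0 - a)) * kelvin_gap a l u x0 \<le> sqrt (norm (y - a)) * kelvin_gap a l u y"
proof -
  let ?W = "kelvin_gap a l u" and ?U = "bubble_ratio a l u"
  let ?f = "\<lambda>y. sqrt (norm (y - a)) * ?W y"
  have l: "l > 0" using x(2) by (meson le_less_trans norm_ge_zero)
  have u: "u \<in> Dini_space" using sol by (simp add: log_lap_solution_def)
  have Up: "?U y > 0" for y
    using log_lap_solution_pos[OF sol] bubble_pos[OF l, of a] by (simp add: bubble_ratio_def)
  obtain M where M: "\<And>y. norm (y - a) \<le> l \<Longrightarrow> \<bar>?U y\<bar> \<le> M"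
    by (rule continuous_on_cball_bounded[OF bubble_ratio_continuous_on[OF u l, of "cball a l" a]]) blast
  have M0: "M > 0" using M[of a] Up[of a] l by auto
  have fx: "?f x < 0" using x neg by (simp add: mult_pos_neg)
  \<comment> \<open>The gap is at least \<open>- M\<close> in the ball, so within this distance of
    \<open>a\<close> the weighted gap is at least \<open>?f x / 2\<close> and cannot compete with
    the negative value \<open>?f x\<close>.\<close>
  define r where "r = min (norm (x - a)) ((- ?f x / (2 * M))\<^sup>2)"
  have r: "0 < r" "r \<le> norm (x - a)" using x fx M0 by (auto simp: r_def)
  have small: "?f y > ?f x" if "y \<noteq> a" "norm (y - a) \<le> r" for y
  proof -
    have ly: "norm (y - a) \<le> l" using that r x by simp
    have "sqrt (norm (y - a)) \<le> sqrt ((- ?f x / (2 * M))\<^sup>2)"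
      using that(2) unfolding r_def by (intro real_sqrt_le_mono) linarith
    also have "\<dots> = - ?f x / (2 * M)" using fx M0 by (simp add: divide_nonneg_pos)
    finally have s: "sqrt (norm (y - a)) * M \<le> - ?f x / 2" using M0 by (simp add: field_simps)
    have "?W y \<ge> - M"
      using Up[of "sphere_inv a l y"] M[of y] ly by (simp add: kelvin_gap_def)
    then have "?f y \<ge> sqrt (norm (y - a)) * (- M)" by (intro mult_left_mono) auto
    then show ?thesis using s fx by simp
  qed
  define K where "K = cball a l - ball a r"
  have K: "compact K" unfolding K_def by (intro compact_diff compact_cball open_ball)
  have xK: "x \<in> K" using x r by (simp add: K_def dist_norm norm_minus_commute)
  have Ka: "K \<subseteq> - {a}" using r by (auto simp: K_def)
  have "continuous_on K ?f"
    by (intro continuous_intros continuous_on_subset[OF kelvin_gap_continuous_on[OF u l] Ka])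
  then obtain x0 where x0: "x0 \<in> K" "\<And>y. y \<in> K \<Longrightarrow> ?f x0 \<le> ?f y"
    using continuous_attains_inf[OF K] xK by blast
  have f0: "?f x0 < 0" using x0(2)[OF xK] fx by simp
  have x0a: "x0 \<noteq> a" using x0(1) Ka by auto
  have W0: "?W x0 < 0" using f0 x0a by (simp add: mult_less_0_iff)
  have "norm (x0 - a) \<noteq> l"
  proof
    assume "norm (x0 - a) = l"
    then have "?W x0 = 0" by (simp add: kelvin_gap_def sphere_inv_on_sphere)
    then show False using W0 by simp
  qed
  then have "norm (x0 - a) < l" using x0(1) by (simp add: K_def dist_norm norm_minus_commute)
  moreover have "?f x0 \<le> ?f y" if "y \<noteq> a" "norm (y - a) < l" for y
  proof (cases "norm (y - a) \<le> r")
    case True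
    then show ?thesis using small[OF that(1)] x0(2)[OF xK] by simp
  next
    case False
    then show ?thesis using that by (intro x0(2)) (simp add: K_def dist_norm norm_minus_commute)
  qed
  ultimately show ?thesis using that x0a W0 by blast
qed

text \<open>Cost of the weight at a minimum. For \<open>norm (y - a) < R / 2\<close> the kernel is
  at most \<open>(2 / R) ^ n\<close>, and the square root singularity is integrable even in
  dimension 1. Elsewhere the numerator is at most \<open>(2 / R) * norm (x - y)\<close> and removes
  the singularity at \<open>x\<close>. Each part contributes at most \<open>4 * sphere_area\<close>,
  whatever \<open>R\<close> is.\<close>

lemma singular_weight_bound:
  fixes a x :: "'a::euclidean_space"
  assumes x: "x \<noteq> a"
  defines "R \<equiv> norm (x - a)"
  obtains D :: "'a \<Rightarrow> real" where "integrable lborel D" "(LINT y|lborel. D y) \<le> 8 * sphere_area DIM('a)"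
    "\<And>y. 0 \<le> D y"
    "\<And>y. y \<noteq> a \<Longrightarrow> norm (y - a) < R \<Longrightarrow> (sqrt (R / norm (y - a)) - 1) / norm (x - y) ^ DIM('a) \<le> D y"
proof -
  let ?n = "DIM('a)"
  let ?s = "sphere_area ?n"
  have n: "?n > 0" by simp
  have s: "?s > 0" by (rule sphere_area_pos[OF n])
  have R: "R > 0" using x by (simp add: R_def)
  define D1 :: "'a \<Rightarrow> real" where "D1 = (\<lambda>y. indicator {..<R/2} (norm (y - a)) * ((2 / R) ^ ?n * sqrt (R / norm (y - a))))"
  define D2 :: "'a \<Rightarrow> real" where "D2 = (\<lambda>y. indicator {..<2*R} (norm (y - x)) * ((2 / R) * norm (y - x)) * (1 / norm (y - x) ^ ?n))"
  have D1: "D1 y \<ge> 0" and D2: "D2 y \<ge> 0" for y using R by (auto simp: D1_def D2_def)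
  have [measurable]: "D1 \<in> borel_measurable borel" "D2 \<in> borel_measurable borel"
    unfolding D1_def D2_def by measurable
  have "(\<integral>\<^sup>+y. ennreal (D1 y) \<partial>lborel)
    = (\<integral>\<^sup>+r. ennreal (?s * r ^ (?n - 1) * indicator {0..} r) * ennreal (indicator {..<R/2} r * ((2 / R) ^ ?n * sqrt (R / r))) \<partial>lborel)"
    unfolding D1_def by (rule nn_integral_radial) measurable
  also have "\<dots> \<le> (\<integral>\<^sup>+r. ennreal (?s * (2 / R) * sqrt R) * (ennreal (r powr (-1/2)) * indicator {0..R/2} r) \<partial>lborel)"
  proof (rule nn_integral_mono)
    fix r :: real
    show "ennreal (?s * r ^ (?n - 1) * indicator {0..} r) * ennreal (indicator {..<R/2} r * ((2 / R) ^ ?n * sqrt (R / r)))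
      \<le> ennreal (?s * (2 / R) * sqrt R) * (ennreal (r powr (-1/2)) * indicator {0..R/2} r)"
    proof (cases "0 < r \<and> r < R/2")
      case True
      have "(2 / R) ^ ?n = (2 / R) ^ (?n - 1) * (2 / R)" using n by (metis Suc_diff_1 power_Suc2)
      then have "r ^ (?n - 1) * (2 / R) ^ ?n = (r * (2 / R)) ^ (?n - 1) * (2 / R)"
        by (simp only: power_mult_distrib mult.assoc)
      also have "\<dots> \<le> 1 * (2 / R)"
        using True R by (intro mult_right_mono power_le_one) (auto simp: field_simps)
      finally have p: "r ^ (?n - 1) * (2 / R) ^ ?n \<le> 2 / R" by simp
      have "sqrt (R / r) = sqrt R * r powr (-1/2)"
        using True by (simp add: real_sqrt_divide powr_minus powr_half_sqrt inverse_eq_divide)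
      then have "?s * r ^ (?n - 1) * ((2 / R) ^ ?n * sqrt (R / r)) = ?s * sqrt R * r powr (-1/2) * (r ^ (?n - 1) * (2 / R) ^ ?n)"
        by simp
      also have "\<dots> \<le> ?s * sqrt R * r powr (-1/2) * (2 / R)"
        using p s R by (intro mult_left_mono) auto
      finally have "?s * r ^ (?n - 1) * ((2 / R) ^ ?n * sqrt (R / r)) \<le> (?s * (2 / R) * sqrt R) * r powr (-1/2)"
        by (simp add: mult_ac)
      from ennreal_leI[OF this] show ?thesis
        using True s R by (simp add: ennreal_mult'[symmetric] ennreal_mult[symmetric])
    next
      case False
      then show ?thesis by (cases "r = 0") (auto simp: indicator_def)
    qed
  qed
  also have "\<dots> = ennreal (?s * (2 / R) * sqrt R) * (\<integral>\<^sup>+r. ennreal (r powr (-1/2)) * indicator {0..R/2} r \<partial>lborel)"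
    by (rule nn_integral_cmult) measurable
  also have "(\<integral>\<^sup>+r. ennreal (r powr (-1/2)) * indicator {0..R/2} r \<partial>lborel) = ennreal ((R/2) powr (-1/2 + 1) / (-1/2 + 1))"
    using R by (intro nn_integral_has_integral_lebesgue' has_integral_powr_from_0) auto
  also have "(R/2) powr (-1/2 + 1) / (-1/2 + 1) = 2 * sqrt (R/2)" using R by (simp add: powr_half_sqrt)
  also have "ennreal (?s * (2 / R) * sqrt R) * ennreal (2 * sqrt (R/2)) = ennreal (?s * (2 / R) * sqrt R * (2 * sqrt (R/2)))"
    using s R by (simp flip: ennreal_mult)
  also have "\<dots> \<le> ennreal (4 * ?s)"
  proof (rule ennreal_leI)
    have "sqrt R * sqrt (R/2) \<le> sqrt R * sqrt R" using R by (intro mult_left_mono) auto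
    then have q: "sqrt R * sqrt (R/2) \<le> R" using R by simp
    have "?s * (2 / R) * sqrt R * (2 * sqrt (R/2)) = (4 * ?s / R) * (sqrt R * sqrt (R/2))" by simp
    also have "\<dots> \<le> (4 * ?s / R) * R" using q s R by (intro mult_left_mono) auto
    finally show "?s * (2 / R) * sqrt R * (2 * sqrt (R/2)) \<le> 4 * ?s" using R by simp
  qed
  finally have n1: "(\<integral>\<^sup>+y. ennreal (D1 y) \<partial>lborel) \<le> ennreal (4 * ?s)" .
  have "(\<integral>\<^sup>+y. ennreal (D2 y) \<partial>lborel)
     = (\<integral>\<^sup>+y. ennreal (indicator {..<2*R} (norm (y - x)) * ((2 / R) * norm (y - x))) * ennreal (1 / norm (y - x) ^ ?n) \<partial>lborel)"
    unfolding D2_def using R by (intro nn_integral_cong ennreal_mult) auto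
  also have "\<dots> = ennreal ?s * (\<integral>\<^sup>+r\<in>{0<..}. ennreal (indicator {..<2*R} r * ((2 / R) * r)) * ennreal (1 / r) \<partial>lborel)"
    by (rule nn_integral_radial_div) measurable
  also have "(\<integral>\<^sup>+r\<in>{0<..}. ennreal (indicator {..<2*R} r * ((2 / R) * r)) * ennreal (1 / r) \<partial>lborel)
     = (\<integral>\<^sup>+r. ennreal (2 / R) * indicator {0<..<2*R} r \<partial>lborel)"
    using R by (intro nn_integral_cong) (auto simp: indicator_def simp flip: ennreal_mult)
  also have "\<dots> = ennreal (2 / R * (2 * R))" using R by (subst nn_integral_cmult_indicator) (simp_all flip: ennreal_mult)
  also have "ennreal ?s * \<dots> = ennreal (?s * (2 / R * (2 * R)))" using s R by (intro ennreal_mult[symmetric]) auto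
  also have "?s * (2 / R * (2 * R)) = 4 * ?s" using R by simp
  finally have n2: "(\<integral>\<^sup>+y. ennreal (D2 y) \<partial>lborel) = ennreal (4 * ?s)" .
  have i1: "integrable lborel D1"
    using D1 le_less_trans[OF n1] by (intro integrableI_nonneg) auto
  have i2: "integrable lborel D2"
    using n2 D2 by (intro integrableI_nonneg) auto
  show ?thesis
  proof (rule that[of "\<lambda>y. D1 y + D2 y"])
    show "integrable lborel (\<lambda>y. D1 y + D2 y)" using i1 i2 by simp
    have "ennreal (LINT y|lborel. D1 y) \<le> ennreal (4 * ?s)" using n1 D1 by (simp add: nn_integral_eq_integral[OF i1])
    moreover have "ennreal (LINT y|lborel. D2 y) \<le> ennreal (4 * ?s)" using n2 D2 by (simp add: nn_integral_eq_integral[OF i2])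
    ultimately show "(LINT y|lborel. D1 y + D2 y) \<le> 8 * ?s" using i1 i2 s by simp
    show "0 \<le> D1 y + D2 y" for y using D1[of y] D2[of y] by simp
    fix y assume y: "y \<noteq> a" "norm (y - a) < R"
    define p w where "p = norm (y - a)" and "w = norm (x - y)"
    have p: "0 < p" "p < R" using y by (auto simp: p_def)
    have tri: "R - p \<le> w" using norm_triangle_ineq2[of "x - a" "y - a"] by (simp add: R_def p_def w_def)
    have w: "w > 0" using tri p by simp
    have wn: "norm (y - x) = w" by (simp add: w_def norm_minus_commute)
    show "(sqrt (R / norm (y - a)) - 1) / norm (x - y) ^ ?n \<le> D1 y + D2 y"
      unfolding p_def[symmetric] w_def[symmetric]
    proof (cases "p < R / 2")
      case True
      then have "R / 2 \<le> w" using tri by simp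
      then have "1 / w ^ ?n \<le> (2 / R) ^ ?n"
      proof -
        have "1 / w \<le> 2 / R" using \<open>R / 2 \<le> w\<close> R w by (simp add: field_simps)
        then have "(1 / w) ^ ?n \<le> (2 / R) ^ ?n" using w by (intro power_mono) auto
        then show ?thesis by (simp add: power_one_over)
      qed
      then have "sqrt (R / p) * (1 / w ^ ?n) \<le> sqrt (R / p) * (2 / R) ^ ?n" using p R by (intro mult_left_mono) auto
      moreover have "(sqrt (R / p) - 1) / w ^ ?n \<le> sqrt (R / p) * (1 / w ^ ?n)" using w by (simp add: divide_right_mono)
      ultimately have "(sqrt (R / p) - 1) / w ^ ?n \<le> D1 y" using True by (simp add: D1_def p_def[symmetric] mult.commute)
      then show "(sqrt (R / p) - 1) / w ^ ?n \<le> D1 y + D2 y" using D2[of y] by simp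
    next
      case False
      have "w \<le> R + p" using norm_triangle_ineq4[of "x - a" "y - a"] by (simp add: R_def p_def w_def)
      then have w2: "w < 2 * R" using p by simp
      have "sqrt (R / p) \<le> R / p"
      proof -
        have "1 \<le> R / p" using p by simp
        then have "R / p \<le> (R / p)\<^sup>2" by (rule self_le_power) simp
        then have "sqrt (R / p) \<le> sqrt ((R / p)\<^sup>2)" by (rule real_sqrt_le_mono)
        then show ?thesis using p R by simp
      qed
      then have "sqrt (R / p) - 1 \<le> (R - p) / p" using p by (simp add: diff_divide_distrib)
      also have "\<dots> \<le> w / p" using tri p by (intro divide_right_mono) auto
      also have "\<dots> \<le> w / (R / 2)" using False R p w by (intro divide_left_mono) auto
      finally have "(sqrt (R / p) - 1) / w ^ ?n \<le> (2 / R * w) / w ^ ?n" using w by (intro divide_right_mono) (auto simp: mult.commute)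
      also have "\<dots> = D2 y" using w2 by (simp add: D2_def wn)
      finally show "(sqrt (R / p) - 1) / w ^ ?n \<le> D1 y + D2 y" using D1[of y] by simp
    qed
  qed
qed

text \<open>Convexity of \<open>t * ln t\<close>, with the tangent taken at the larger point
  \<open>q\<close>: in the application \<open>q\<close> is the value of \<open>U\<close>, which is
  controlled, while \<open>p\<close> may be arbitrarily small.\<close>

lemma xlnx_tangent:
  fixes p q :: real
  assumes "0 < p" "p \<le> q"
  shows "(q - p) * (- ln q - 1) \<le> p * ln p - q * ln q"
proof -
  have "ln (q / p) \<le> q / p - 1" using assms by (intro ln_le_minus_one) simp
  then have "p * ln (q / p) \<le> p * (q / p - 1)" using assms by (intro mult_left_mono) auto
  then have "p * (ln q - ln p) \<le> q - p" using assms by (simp add: ln_div algebra_simps)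
  then show ?thesis by (simp add: algebra_simps)
qed

lemma bubble_bounds:
  fixes a x :: "'a::euclidean_space"
  assumes l: "l > 0" and d: "norm (x - a) \<le> d"
  shows "bubble a l x \<le> bubble_const DIM('a) * (1 / l) powr (real DIM('a) / 2)"
    and "bubble_const DIM('a) * (l / (l\<^sup>2 + d\<^sup>2)) powr (real DIM('a) / 2) \<le> bubble a l x"
proof -
  have q: "l\<^sup>2 + (norm (x - a))\<^sup>2 > 0" using l by (simp add: add_pos_nonneg)
  have d2: "(norm (x - a))\<^sup>2 \<le> d\<^sup>2" using d by (intro power_mono) auto
  show "bubble a l x \<le> bubble_const DIM('a) * (1 / l) powr (real DIM('a) / 2)"
    unfolding bubble_def
  proof (intro mult_left_mono powr_mono2)
    show "l / (l\<^sup>2 + (norm (x - a))\<^sup>2) \<le> 1 / l" using q l by (simp add: field_simps power2_eq_square)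
  qed (use bubble_const_pos[of "DIM('a)"] bubble_base_pos[OF l] in \<open>simp_all add: less_imp_le\<close>)
  show "bubble_const DIM('a) * (l / (l\<^sup>2 + d\<^sup>2)) powr (real DIM('a) / 2) \<le> bubble a l x"
    unfolding bubble_def
  proof (intro mult_left_mono powr_mono2)
    show "l / (l\<^sup>2 + d\<^sup>2) \<le> l / (l\<^sup>2 + (norm (x - a))\<^sup>2)"
      using q l d2 by (intro divide_left_mono) auto
  qed (use bubble_const_pos[of "DIM('a)"] bubble_base_pos[OF l] in \<open>simp_all add: less_imp_le\<close>)
qed

text \<open>The set \<open>G\<close> may be chosen freely among the sets avoiding the negativity set and a
  neighbourhood of the minimum; a large integral over \<open>G\<close> is incompatible with a negative
  minimum.\<close>

lemma kelvin_gap_minimum_estimate: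
  fixes u :: "'a::euclidean_space \<Rightarrow> real" and a x :: 'a
  assumes sol: "log_lap_solution u"
    and x: "x \<noteq> a" "norm (x - a) < l" and neg: "kelvin_gap a l u x < 0"
    and min: "\<And>y. y \<noteq> a \<Longrightarrow> norm (y - a) < l \<Longrightarrow>
      sqrt (norm (x - a)) * kelvin_gap a l u x \<le> sqrt (norm (y - a)) * kelvin_gap a l u y"
    and G: "G \<in> sets borel" and r: "r > 0" "\<And>y. y \<in> G \<Longrightarrow> r \<le> norm (y - x)"
    and GN: "\<And>y. y \<in> G \<Longrightarrow> y \<noteq> a \<Longrightarrow> norm (y - a) < l \<Longrightarrow> 0 \<le> kelvin_gap a l u y"
  shows "4 / real DIM('a) * (bubble a l x * (- ln (bubble_ratio a l u x) - 1))
    \<le> 16 * (bubble_const DIM('a) * (1 / l) powr (real DIM('a) / 2))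
      - log_lap_c DIM('a) * (LINT y|lborel. indicator G y * (bubble a l y / norm (x - y) ^ DIM('a)))"
proof -
  let ?n = "DIM('a)"
  let ?W = "kelvin_gap a l u" and ?b = "bubble a l" and ?U = "bubble_ratio a l u" and ?c = "log_lap_c ?n"
  define B where "B = bubble_const ?n * (1 / l) powr (real ?n / 2)"
  have l: "l > 0" using x(2) by (meson le_less_trans norm_ge_zero)
  have [measurable]: "G \<in> sets borel" by fact
  have [measurable]: "?b \<in> borel_measurable borel" by (rule Dini_space_borel_measurable[OF bubble_Dini[OF l]])
  have bp: "?b y > 0" for y by (rule bubble_pos[OF l])
  have bB: "?b y \<le> B" for y unfolding B_def by (rule bubble_bounds(1)[OF l order_refl])
  have B: "B > 0" using bp[of a] bB[of a] by simp
  have c: "?c > 0" by (rule log_lap_c_pos) simp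
  define m where "m = - ?W x"
  have m: "m > 0" using neg by (simp add: m_def)
  define R where "R = norm (x - a)"
  obtain D where D: "integrable lborel D" "(LINT y|lborel. D y) \<le> 8 * sphere_area ?n" "\<And>y. 0 \<le> D y"
    and Dw: "\<And>y. y \<noteq> a \<Longrightarrow> norm (y - a) < R \<Longrightarrow> (sqrt (R / norm (y - a)) - 1) / norm (x - y) ^ ?n \<le> D y"
    using singular_weight_bound[OF x(1)] unfolding R_def by blast
  define H where "H = (\<lambda>y. if norm (y - a) < l
     then (?W x - ?W y) * ?b y / norm (x - y) ^ ?n + ?W y * inv_kernel a l x y * ?b y
     else ?W x * ?b y / norm (x - y) ^ ?n)"
  note H = kelvin_gap_fold[OF sol x, folded H_def]
  let ?g = "\<lambda>y. indicator G y * (?b y / norm (x - y) ^ ?n)"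
  have ig: "integrable lborel ?g"
    by (rule integrable_L10_tail[OF bubble_L10[OF l] _ G r]) auto
  \<comment> \<open>Outside the ball, or where the gap is nonnegative, the full
    \<open>- m * ?K\<close> is available and pays for the term with \<open>G\<close>. Where the gap
    is negative, \<open>G\<close> is absent and minimality gives
    \<open>- ?W y \<le> m * sqrt (R / p)\<close>; only the excess of this over \<open>m\<close> is
    left, and \<open>D\<close> absorbs it.\<close>
  have bound: "H y \<le> m * B * D y - m * ?g y" if ya: "y \<noteq> a" and yx: "y \<noteq> x" for y
  proof -
    let ?K = "?b y / norm (x - y) ^ ?n"
    have K: "?K > 0" using bp[of y] yx by simp
    have gK: "?g y \<le> ?K" using K by (simp add: indicator_def)
    have BD: "0 \<le> m * B * D y" using m B D(3) by simp
    have far: "H y \<le> m * B * D y - m * ?g y" if "H y \<le> - m * ?K"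
    proof -
      have "m * ?g y \<le> m * ?K" using m gK by (intro mult_left_mono) auto
      then show ?thesis using that BD by simp
    qed
    show ?thesis
    proof (cases "norm (y - a) < l")
      case False
      then have "H y = - m * ?K" by (simp add: H_def m_def)
      then show ?thesis using far by simp
    next
      case True
      have k1: "inv_kernel a l x y < 1 / norm (x - y) ^ ?n" using yx by (intro inv_kernel_less[OF x True]) simp
      have k0: "0 \<le> inv_kernel a l x y" by (rule inv_kernel_nonneg[OF l])
      have Hy: "H y = - m * ?K - ?W y * ?b y * (1 / norm (x - y) ^ ?n - inv_kernel a l x y)"
        using True by (simp add: H_def m_def algebra_simps diff_divide_distrib)
      show ?thesis
      proof (cases "0 \<le> ?W y")
        case True
        then have "0 \<le> ?W y * ?b y * (1 / norm (x - y) ^ ?n - inv_kernel a l x y)"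
          using bp[of y] k1 by (intro mult_nonneg_nonneg) auto
        then show ?thesis using Hy far by simp
      next
        case Wneg: False
        define p where "p = norm (y - a)"
        have p: "p > 0" using ya by (simp add: p_def)
        have g0: "?g y = 0" using GN[of y] ya True Wneg by (auto simp: indicator_def)
        have "sqrt R * (- m) \<le> sqrt p * ?W y" using min[OF ya True] by (simp add: R_def p_def m_def)
        then have Wy: "- ?W y \<le> m * sqrt (R / p)" using p by (simp add: real_sqrt_divide field_simps)
        have "- ?W y * ?b y * (1 / norm (x - y) ^ ?n - inv_kernel a l x y) \<le> - ?W y * ?b y * (1 / norm (x - y) ^ ?n)"
          using Wneg bp[of y] k0 by (intro mult_left_mono mult_nonneg_nonneg) auto
        moreover have "- m * ?K + - ?W y * ?b y * (1 / norm (x - y) ^ ?n) = (- m - ?W y) * ?K"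
          using yx by (simp add: field_simps)
        ultimately have "H y \<le> (- m - ?W y) * ?K" unfolding Hy by linarith
        also have "\<dots> \<le> (m * (sqrt (R / p) - 1)) * ?K"
          using Wy K by (intro mult_right_mono) (auto simp: algebra_simps)
        also have "\<dots> \<le> m * B * D y"
        proof (cases "p < R")
          case True
          have s: "0 \<le> sqrt (R / p) - 1" using True p by simp
          have "(m * (sqrt (R / p) - 1)) * ?K = m * ?b y * ((sqrt (R / p) - 1) / norm (x - y) ^ ?n)" by simp
          also have "\<dots> \<le> m * B * D y"
            using Dw[OF ya] True bB[of y] m bp[of y] B s D(3)
            by (intro mult_mono) (auto simp: R_def p_def[symmetric])
          finally show ?thesis .
        next
          case False
          then have "sqrt (R / p) \<le> 1" using p by simp
          then have "(m * (sqrt (R / p) - 1)) * ?K \<le> 0" using m K by (intro mult_nonpos_nonneg mult_nonneg_nonpos) auto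
          then show ?thesis using BD by simp
        qed
        finally show ?thesis unfolding g0 by simp
      qed
    qed
  qed
  have "(LINT y|lborel. H y) \<le> (LINT y|lborel. m * B * D y - m * ?g y)"
  proof (rule integral_mono_AE[OF H(1)])
    show "integrable lborel (\<lambda>y. m * B * D y - m * ?g y)"
      using D(1) ig by (intro Bochner_Integration.integrable_diff integrable_mult_right)
    show "AE y in lborel. H y \<le> m * B * D y - m * ?g y"
      using AE_lborel_singleton[of a] AE_lborel_singleton[of x] by eventually_elim (rule bound)
  qed
  also have "\<dots> = (LINT y|lborel. m * B * D y) - (LINT y|lborel. m * ?g y)"
    using D(1) ig by (intro Bochner_Integration.integral_diff integrable_mult_right)
  also have "\<dots> = m * B * (LINT y|lborel. D y) - m * (LINT y|lborel. ?g y)"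
    by (simp only: integral_mult_right_zero)
  also have "\<dots> \<le> m * B * (8 * sphere_area ?n) - m * (LINT y|lborel. ?g y)"
    using D(2) m B by (intro diff_right_mono mult_left_mono) auto
  finally have "?c * (LINT y|lborel. H y) \<le> ?c * (m * B * (8 * sphere_area ?n) - m * (LINT y|lborel. ?g y))"
    using c by (intro mult_left_mono) auto
  also have "\<dots> = m * (8 * B * (?c * sphere_area ?n) - ?c * (LINT y|lborel. ?g y))" by (simp only: algebra_simps)
  also have "?c * sphere_area ?n = 2" by (rule log_lap_c_sphere_area) simp
  finally have le: "?c * (LINT y|lborel. H y) \<le> m * (16 * B - ?c * (LINT y|lborel. ?g y))" by simp
  define V where "V = ?U (sphere_inv a l x)"
  have Up: "?U y > 0" for y
    using log_lap_solution_pos[OF sol] bp by (simp add: bubble_ratio_def)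
  have mV: "m = ?U x - V" by (simp add: m_def kelvin_gap_def V_def)
  \<comment> \<open>The tangent inequality extracts a factor \<open>m\<close> from the nonlinearity
    as well, so the unknown depth of the minimum cancels.\<close>
  have "m * (4 / real ?n * (?b x * (- ln (?U x) - 1))) = 4 / real ?n * (?b x * ((?U x - V) * (- ln (?U x) - 1)))"
    unfolding mV by simp
  also have "\<dots> \<le> 4 / real ?n * (?b x * (V * ln V - ?U x * ln (?U x)))"
    using bp[of x] Up[of "sphere_inv a l x"] m mV
    by (intro mult_left_mono xlnx_tangent) (auto simp: V_def less_imp_le)
  also have "\<dots> = ?c * (LINT y|lborel. H y)"
    unfolding H(2) kelvin_gap_equation(2)[OF sol l x(1)] V_def by simp
  also note le
  finally have "4 / real ?n * (?b x * (- ln (?U x) - 1)) \<le> 16 * B - ?c * (LINT y|lborel. ?g y)"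
    using m by (simp only: mult_le_cancel_left_pos)
  then show ?thesis unfolding B_def .
qed

text \<open>On the ball of radius \<open>l\<close> the bubble is of order
  \<open>l powr (- n / 2)\<close>, while \<open>u\<close> stays bounded. So \<open>- ln U\<close> is
  large throughout the ball and outweighs the constant 16 without any help from the kernel: the
  estimate is used with an empty \<open>G\<close>.\<close>

lemma kelvin_gap_nonneg_small:
  fixes u :: "'a::euclidean_space \<Rightarrow> real" and a :: 'a
  assumes sol: "log_lap_solution u"
  obtains l0 where "l0 > 0"
    "\<And>l y. 0 < l \<Longrightarrow> l < l0 \<Longrightarrow> y \<noteq> a \<Longrightarrow> norm (y - a) < l \<Longrightarrow> 0 \<le> kelvin_gap a l u y"
proof -
  let ?n = "DIM('a)"
  let ?k = "real ?n / 2"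
  have u: "u \<in> Dini_space" using sol by (simp add: log_lap_solution_def)
  have n: "?n > 0" by simp
  obtain M where M: "\<And>y. norm (y - a) \<le> 1 \<Longrightarrow> \<bar>u y\<bar> \<le> M"
    by (rule continuous_on_cball_bounded[OF Dini_space_continuous_on[OF u, of "cball a 1"]]) blast
  have up: "u y > 0" for y by (rule log_lap_solution_pos[OF sol])
  have M0: "M > 0" using M[of a] up[of a] by auto
  have \<beta>: "bubble_const ?n > 0" by (rule bubble_const_pos)
  \<comment> \<open>\<open>2 powr ?k\<close> is the ratio of the upper to the lower bound of the
    bubble on the ball, \<open>4 * n\<close> turns the factor \<open>4 / n\<close> into 16, and the
    2 covers the \<open>- 1\<close> of the estimate with room for strictness.\<close>
  define T where "T = 2 + 4 * real ?n * 2 powr ?k"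
  define e where "e = bubble_const ?n * exp (- T) / M"
  have e: "e > 0" using \<beta> M0 by (simp add: e_def)
  define l0 where "l0 = min 1 (e powr (1 / ?k) / 2)"
  have l0: "l0 > 0" using e by (simp add: l0_def)
  have "0 \<le> kelvin_gap a l u y" if l: "0 < l" "l < l0" and y: "y \<noteq> a" "norm (y - a) < l" for l y
  proof (rule ccontr)
    assume "\<not> 0 \<le> kelvin_gap a l u y"
    then have "kelvin_gap a l u y < 0" by simp
    from kelvin_gap_weighted_minimum[OF sol y this]
    obtain x where x: "x \<noteq> a" "norm (x - a) < l" "kelvin_gap a l u x < 0"
      and min: "\<And>y. y \<noteq> a \<Longrightarrow> norm (y - a) < l \<Longrightarrow>
        sqrt (norm (x - a)) * kelvin_gap a l u x \<le> sqrt (norm (y - a)) * kelvin_gap a l u y"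
      by blast
    have l1: "l < 1" using l by (simp add: l0_def)
    have "4 / real ?n * (bubble a l x * (- ln (bubble_ratio a l u x) - 1))
      \<le> 16 * (bubble_const ?n * (1 / l) powr ?k)
        - log_lap_c ?n * (LINT y|lborel. indicator {} y * (bubble a l y / norm (x - y) ^ ?n))"
      by (rule kelvin_gap_minimum_estimate[OF sol x min, where r = 1]) auto
    then have est: "4 / real ?n * (bubble a l x * (- ln (bubble_ratio a l u x) - 1)) \<le> 16 * (bubble_const ?n * (1 / l) powr ?k)"
      by simp
    have bl: "bubble_const ?n * (1 / (2 * l)) powr ?k \<le> bubble a l x"
      using bubble_bounds(2)[OF l(1) less_imp_le[OF x(2)]] l by (simp add: power2_eq_square field_simps)
    have "(2 * l) powr ?k < e"
    proof -
      have "2 * l < e powr (1 / ?k)" using l by (simp add: l0_def)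
      then have "(2 * l) powr ?k < (e powr (1 / ?k)) powr ?k" using l n by (intro powr_less_mono2) auto
      then show ?thesis using e n by (simp add: powr_powr)
    qed
    then have "M * (2 * l) powr ?k < bubble_const ?n * exp (- T)" using M0 by (simp add: e_def field_simps)
    then have Ml: "M < exp (- T) * (bubble_const ?n * (1 / (2 * l)) powr ?k)"
      using l by (simp add: powr_divide field_simps)
    have "u x \<le> M" using M[of x] x(2) l1 by auto
    also have "M < exp (- T) * (bubble_const ?n * (1 / (2 * l)) powr ?k)" by (rule Ml)
    also have "\<dots> \<le> exp (- T) * bubble a l x" using bl by (intro mult_left_mono) auto
    finally have "bubble_ratio a l u x < exp (- T)"
      using bubble_pos[OF l(1), of a x] by (simp add: bubble_ratio_def field_simps)
    then have "ln (bubble_ratio a l u x) < - T"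
      using up[of x] bubble_pos[OF l(1), of a x] ln_less_cancel_iff[of "bubble_ratio a l u x" "exp (- T)"]
      by (simp add: bubble_ratio_def)
    then have T: "4 * real ?n * 2 powr ?k < - ln (bubble_ratio a l u x) - 1" by (simp add: T_def)
    have "16 * (bubble_const ?n * (1 / l) powr ?k) = 4 / real ?n * ((bubble_const ?n * (1 / (2 * l)) powr ?k) * (4 * real ?n * 2 powr ?k))"
      using l n by (simp add: powr_divide powr_mult field_simps)
    also have "\<dots> < 4 / real ?n * ((bubble_const ?n * (1 / (2 * l)) powr ?k) * (- ln (bubble_ratio a l u x) - 1))"
      using T \<beta> l n by (intro mult_strict_left_mono) auto
    also have "\<dots> \<le> 4 / real ?n * (bubble a l x * (- ln (bubble_ratio a l u x) - 1))"
    proof (intro mult_left_mono mult_right_mono bl)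
      have "0 \<le> 4 * real ?n * 2 powr ?k" by simp
      then show "0 \<le> - ln (bubble_ratio a l u x) - 1" using T by linarith
    qed simp
    finally show False using est by simp
  qed
  then show ?thesis using that l0 by blast
qed

section \<open>Continuation in the radius and the dichotomy\<close>

lemma kelvin_gap_sign:
  fixes a :: "'a::euclidean_space"
  assumes l: "l > 0" and x: "x \<noteq> a"
  shows "kelvin_gap a l u x < 0 \<longleftrightarrow> kelvin a l u x < u x"
    and "0 \<le> kelvin_gap a l u x \<longleftrightarrow> u x \<le> kelvin a l u x"
    and "kelvin_gap a l u x = 0 \<longleftrightarrow> kelvin a l u x = u x"
  using bubble_pos[OF l, of a x] unfolding kelvin_gap_eq[OF l x]
  by (auto simp: divide_less_0_iff zero_le_divide_iff)

lemma kelvin_tendsto: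
  fixes a :: "'a::euclidean_space"
  assumes u: "u \<in> Dini_space" and x: "x \<noteq> a" and l: "(l \<longlongrightarrow> L) F"
  shows "((\<lambda>k. kelvin a (l k) u x) \<longlongrightarrow> kelvin a L u x) F"
proof -
  have "isCont u (sphere_inv a L x)"
    using u Dini_continuous_at_imp_isCont by (auto simp: Dini_space_def)
  moreover have "((\<lambda>k. sphere_inv a (l k) x) \<longlongrightarrow> sphere_inv a L x) F"
    unfolding sphere_inv_def using x by (intro tendsto_intros l) auto
  ultimately have "((\<lambda>k. u (sphere_inv a (l k) x)) \<longlongrightarrow> u (sphere_inv a L x)) F"
    by (rule isCont_tendsto_compose)
  then show ?thesis unfolding kelvin_def using x by (intro tendsto_intros l) auto
qed

text \<open>Positivity at radius \<open>L\<close> is not uniform near the centre or the sphere, so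
  compactness gives nothing. Pointwise convergence still forces the measure of the negativity set to
  0 as the radius decreases to \<open>L\<close>. Around a minimum, an annulus with small inner
  radius, minus a set of tiny measure, then has arbitrarily large weight and contradicts the minimum
  estimate.\<close>

lemma kelvin_gap_nonneg_beyond:
  fixes u :: "'a::euclidean_space \<Rightarrow> real" and a :: 'a
  assumes sol: "log_lap_solution u" and L: "L > 0"
    and pos: "\<And>y. y \<noteq> a \<Longrightarrow> norm (y - a) < L \<Longrightarrow> 0 < kelvin_gap a L u y"
  shows "\<exists>\<delta>>0. \<forall>l. L < l \<and> l < L + \<delta> \<longrightarrow> (\<forall>y. y \<noteq> a \<longrightarrow> norm (y - a) < l \<longrightarrow> 0 \<le> kelvin_gap a l u y)"
proof (rule ccontr)
  assume contra: "\<not> ?thesis"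
  let ?n = "DIM('a)"
  let ?k = "real ?n / 2"
  let ?c = "log_lap_c ?n"
  have u: "u \<in> Dini_space" using sol by (simp add: log_lap_solution_def)
  have [measurable]: "u \<in> borel_measurable borel" by (rule Dini_space_borel_measurable[OF u])
  have up: "u y > 0" for y by (rule log_lap_solution_pos[OF sol])
  have n: "?n > 0" by simp
  have c: "?c > 0" by (rule log_lap_c_pos[OF n])
  have \<beta>: "bubble_const ?n > 0" by (rule bubble_const_pos)
  have "\<exists>l. L < l \<and> l < L + 1 / real (Suc k) \<and> (\<exists>y. y \<noteq> a \<and> norm (y - a) < l \<and> kelvin_gap a l u y < 0)" for k
  proof -
    have "1 / real (Suc k) > 0" by simp
    with contra obtain l y where "L < l" "l < L + 1 / real (Suc k)" "y \<noteq> a" "norm (y - a) < l" "\<not> 0 \<le> kelvin_gap a l u y"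
      by blast
    then show ?thesis by (intro exI[of _ l] conjI exI[of _ y]) auto
  qed
  then obtain l where l: "\<And>k. L < l k" "\<And>k. l k < L + 1 / real (Suc k)"
    and neg: "\<And>k. \<exists>y. y \<noteq> a \<and> norm (y - a) < l k \<and> kelvin_gap a (l k) u y < 0"
    by metis
  have l0: "l k > 0" for k using l(1)[of k] L by simp
  have l1: "l k < L + 1" for k
  proof -
    have "1 / real (Suc k) \<le> 1" by simp
    then show ?thesis using l(2)[of k] by linarith
  qed
  have l_lim: "l \<longlonglongrightarrow> L"
  proof (rule tendsto_sandwich[where f = "\<lambda>_. L" and h = "\<lambda>k. L + 1 / real (Suc k)"])
    show "(\<lambda>k. L + 1 / real (Suc k)) \<longlonglongrightarrow> L"
      using tendsto_add[OF tendsto_const LIMSEQ_Suc[OF lim_const_over_n[of 1]], of L] by simp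
    show "\<forall>\<^sub>F k in sequentially. L \<le> l k" "\<forall>\<^sub>F k in sequentially. l k \<le> L + 1 / real (Suc k)"
      using l by (auto intro!: always_eventually less_imp_le)
  qed simp
  define N where "N = (\<lambda>k. {y. y \<noteq> a \<and> norm (y - a) < l k \<and> kelvin a (l k) u y < u y})"
  have [measurable]: "kelvin a (l k) u \<in> borel_measurable borel" for k unfolding kelvin_def by measurable
  have N[measurable]: "N k \<in> sets borel" for k unfolding N_def by measurable
  have N_lim: "(\<lambda>k. measure lborel (N k)) \<longlonglongrightarrow> 0"
  proof -
    have "(\<lambda>k. LINT y|lborel. indicator (N k) y :: real) \<longlonglongrightarrow> (LINT y|(lborel :: 'a measure). 0 :: real)"
    proof (rule integral_dominated_convergence[where w = "indicator (cball a (L + 1))"])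
      show "integrable lborel (indicator (cball a (L + 1)) :: 'a \<Rightarrow> real)"
        using L by (intro integrable_real_indicator) (auto simp: emeasure_cball)
      show "AE y in lborel. (\<lambda>k. indicator (N k) y :: real) \<longlonglongrightarrow> 0"
        using AE_lborel_singleton[of a] AE_not_in_sphere[of a L]
      proof eventually_elim
        case (elim y)
        have "\<forall>\<^sub>F k in sequentially. y \<notin> N k"
        proof (cases "norm (y - a) < L")
          case True
          have "u y < kelvin a L u y"
            using pos[OF elim(1) True] kelvin_gap_sign[OF L elim(1), of u] by auto
          then have "\<forall>\<^sub>F k in sequentially. u y < kelvin a (l k) u y"
            by (intro order_tendstoD(1)[OF kelvin_tendsto[OF u elim(1) l_lim]])
          then show ?thesis by eventually_elim (auto simp: N_def)
        next
          case False
          then have "L < norm (y - a)" using elim by simp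
          then have "\<forall>\<^sub>F k in sequentially. l k < norm (y - a)" by (intro order_tendstoD(2)[OF l_lim])
          then show ?thesis by eventually_elim (auto simp: N_def)
        qed
        then have "\<forall>\<^sub>F k in sequentially. (indicator (N k) y :: real) = 0" by eventually_elim simp
        then show "(\<lambda>k. indicator (N k) y :: real) \<longlonglongrightarrow> 0" by (rule tendsto_eventually)
      qed
      show "AE y in lborel. norm (indicator (N k) y :: real) \<le> indicator (cball a (L + 1)) y" for k
        using l1[of k] by (intro AE_I2) (auto simp: N_def indicator_def dist_norm norm_minus_commute)
    qed auto
    then show ?thesis by simp
  qed
  \<comment> \<open>A lower bound of the bubbles on the ball of radius \<open>L + 2\<close>, which
    contains the annulus used below, and with \<open>B\<close> a global upper bound, both uniform in
    \<open>k\<close>.\<close>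
  define K where "K = bubble_const ?n * (L / ((L + 1)\<^sup>2 + (L + 2)\<^sup>2)) powr ?k"
  define B where "B = bubble_const ?n * (1 / L) powr ?k"
  have K: "K > 0" using \<beta> L by (simp add: K_def add_pos_pos)
  have B: "B > 0" using \<beta> L by (simp add: B_def)
  have bK: "K \<le> bubble a (l k) y" if "norm (y - a) \<le> L + 2" for k y
  proof -
    have "K \<le> bubble_const ?n * (l k / ((l k)\<^sup>2 + (L + 2)\<^sup>2)) powr ?k"
      unfolding K_def
    proof (intro mult_left_mono powr_mono2)
      show "L / ((L + 1)\<^sup>2 + (L + 2)\<^sup>2) \<le> l k / ((l k)\<^sup>2 + (L + 2)\<^sup>2)"
        using l(1)[of k] l1[of k] L l0[of k]
        by (intro frac_le add_right_mono power_mono) (auto intro: add_pos_pos)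
    qed (use \<beta> L in auto)
    also have "\<dots> \<le> bubble a (l k) y" by (rule bubble_bounds(2)[OF l0 that])
    finally show ?thesis .
  qed
  have BB: "bubble_const ?n * (1 / l k) powr ?k \<le> B" for k
    unfolding B_def
  proof (intro mult_left_mono powr_mono2)
    show "1 / l k \<le> 1 / L" using l(1)[of k] L by (intro divide_left_mono) auto
  qed (use \<beta> l0[of k] in auto)
  obtain M where M: "\<And>y. norm (y - a) \<le> L + 1 \<Longrightarrow> \<bar>u y\<bar> \<le> M"
    by (rule continuous_on_cball_bounded[OF Dini_space_continuous_on[OF u, of "cball a (L + 1)"]]) blast
  have M0: "M > 0" using M[of a] up[of a] L by auto
  define Q where "Q = \<bar>ln (M / K)\<bar> + 1"
  have Q: "Q > 0" by (simp add: Q_def)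
  \<comment> \<open>Solves for a contradiction with 1 to spare. The annulus from
    \<open>r = exp (- E)\<close> to 1 has weight \<open>sphere_area * E\<close>; removing a set of
    measure below \<open>r ^ n\<close> costs at most 1, since the kernel is at most
    \<open>1 / r ^ n\<close> on the annulus. \<open>Q\<close> covers the case of an unfavourable
    sign of the logarithm.\<close>
  define E where "E = (16 * B + 4 / real ?n * (B * Q) + ?c * K + 1) / (2 * K)"
  have E: "E > 0" using B K Q c n by (simp add: E_def add_pos_pos)
  define r where "r = exp (- E)"
  have r: "0 < r" "r < 1" using E by (auto simp: r_def)
  have "\<forall>\<^sub>F k in sequentially. measure lborel (N k) < r ^ ?n"
    using r by (intro order_tendstoD(2)[OF N_lim]) simp
  then obtain k where k: "measure lborel (N k) < r ^ ?n"
    unfolding eventually_sequentially by blast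
  from neg[of k] obtain x where x: "x \<noteq> a" "norm (x - a) < l k" "kelvin_gap a (l k) u x < 0"
    and min: "\<And>y. y \<noteq> a \<Longrightarrow> norm (y - a) < l k \<Longrightarrow>
      sqrt (norm (x - a)) * kelvin_gap a (l k) u x \<le> sqrt (norm (y - a)) * kelvin_gap a (l k) u y"
    using kelvin_gap_weighted_minimum[OF sol] by metis
  define A where "A = {y. r \<le> norm (y - x) \<and> norm (y - x) \<le> 1}"
  have A[measurable]: "A \<in> sets borel" unfolding A_def by measurable
  have xa: "norm (x - a) \<le> L + 1" using x(2) l1[of k] by simp
  have Aa: "norm (y - a) \<le> L + 2" if "y \<in> A" for y
    using that xa norm_triangle_ineq[of "y - x" "x - a"] by (simp add: A_def)
  let ?b = "bubble a (l k)"
  have [measurable]: "?b \<in> borel_measurable borel" by (rule Dini_space_borel_measurable[OF bubble_Dini[OF l0]])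
  have est: "4 / real ?n * (?b x * (- ln (bubble_ratio a (l k) u x) - 1))
    \<le> 16 * (bubble_const ?n * (1 / l k) powr ?k)
      - ?c * (LINT y|lborel. indicator (A - N k) y * (?b y / norm (x - y) ^ ?n))"
    by (rule kelvin_gap_minimum_estimate[OF sol x min _ r(1)])
       (auto simp: A_def N_def kelvin_gap_sign[OF l0])
  have fN: "emeasure lborel (N k) < \<infinity>"
  proof -
    have "emeasure lborel (N k) \<le> emeasure lborel (cball a (L + 1))"
      using l1[of k] by (intro emeasure_mono) (auto simp: N_def dist_norm norm_minus_commute)
    also have "\<dots> < \<infinity>" using L by (simp add: emeasure_cball)
    finally show ?thesis .
  qed
  have iN: "integrable lborel (indicator (N k) :: 'a \<Rightarrow> real)" using fN by (intro integrable_real_indicator) auto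
  have iA: "integrable lborel (\<lambda>y. indicator A y / norm (x - y) ^ ?n)"
    by (rule integrable_annulus[OF r(1), where R = 1]) (auto simp: A_def)
  have lower: "K * (sphere_area ?n * E - 1) \<le> (LINT y|lborel. indicator (A - N k) y * (?b y / norm (x - y) ^ ?n))"
  proof -
    have "sphere_area ?n * E = (LINT y|lborel. indicator A y / norm (x - y) ^ ?n)"
      unfolding A_def using r by (subst integral_annulus) (auto simp: r_def ln_div)
    moreover have "(LINT y|lborel. indicator (N k) y / r ^ ?n) \<le> 1"
      using k r by simp
    ultimately have "sphere_area ?n * E - 1 \<le> (LINT y|lborel. indicator A y / norm (x - y) ^ ?n) - (LINT y|lborel. indicator (N k) y / r ^ ?n)"
      by simp
    also have "\<dots> = (LINT y|lborel. indicator A y / norm (x - y) ^ ?n - indicator (N k) y / r ^ ?n)"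
      using iA iN by (intro Bochner_Integration.integral_diff[symmetric] integrable_divide) auto
    finally have "K * (sphere_area ?n * E - 1) \<le> K * \<dots>" using K by (intro mult_left_mono) auto
    also have "\<dots> = (LINT y|lborel. K * (indicator A y / norm (x - y) ^ ?n - indicator (N k) y / r ^ ?n))"
      by (rule integral_mult_right_zero[symmetric])
    also have "\<dots> \<le> (LINT y|lborel. indicator (A - N k) y * (?b y / norm (x - y) ^ ?n))"
    proof (rule integral_mono)
      show "integrable lborel (\<lambda>y. K * (indicator A y / norm (x - y) ^ ?n - indicator (N k) y / r ^ ?n))"
        using iA iN by (intro integrable_mult_right Bochner_Integration.integrable_diff integrable_divide) auto
      show "integrable lborel (\<lambda>y. indicator (A - N k) y * (?b y / norm (x - y) ^ ?n))"
        by (rule integrable_L10_tail[OF bubble_L10[OF l0] _ _ r(1)]) (auto simp: A_def)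
      fix y
      show "K * (indicator A y / norm (x - y) ^ ?n - indicator (N k) y / r ^ ?n) \<le> indicator (A - N k) y * (?b y / norm (x - y) ^ ?n)"
      proof (cases "y \<in> A")
        case True
        then have ry: "r \<le> norm (x - y)" by (simp add: A_def norm_minus_commute)
        show ?thesis
        proof (cases "y \<in> N k")
          case False
          have "K * (1 / norm (x - y) ^ ?n) \<le> ?b y * (1 / norm (x - y) ^ ?n)"
            by (intro mult_right_mono bK Aa True) auto
          then show ?thesis using True False by simp
        next
          case True
          have "1 / norm (x - y) ^ ?n \<le> 1 / r ^ ?n" using ry r
            by (intro divide_left_mono power_mono) (auto intro!: mult_pos_pos zero_less_power less_le_trans[OF r(1) ry])
          then show ?thesis using True K \<open>y \<in> A\<close> by (simp add: mult_le_0_iff)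
        qed
      next
        case False
        then show ?thesis using K r by (simp add: indicator_def)
      qed
    qed
    finally show ?thesis .
  qed
  have bx: "0 < ?b x" "?b x \<le> B" using bubble_pos[OF l0] bubble_bounds(1)[OF l0 order_refl] BB order_trans by blast+
  have "bubble_ratio a (l k) u x \<le> M / K"
    using M[OF xa] bK[of x k] xa K M0 up[of x] unfolding bubble_ratio_def by (intro frac_le) auto
  then have "ln (bubble_ratio a (l k) u x) \<le> ln (M / K)"
    using up[of x] bx(1) by (intro ln_mono) (auto simp: bubble_ratio_def)
  then have "- Q \<le> - ln (bubble_ratio a (l k) u x) - 1" by (simp add: Q_def)
  then have "?b x * (- Q) \<le> ?b x * (- ln (bubble_ratio a (l k) u x) - 1)" using bx by (intro mult_left_mono) auto
  moreover have "B * (- Q) \<le> ?b x * (- Q)" using bx Q by simp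
  ultimately have "4 / real ?n * (B * (- Q)) \<le> 4 / real ?n * (?b x * (- ln (bubble_ratio a (l k) u x) - 1))"
    by (intro mult_left_mono) auto
  also note est
  also have "16 * (bubble_const ?n * (1 / l k) powr ?k) - ?c * (LINT y|lborel. indicator (A - N k) y * (?b y / norm (x - y) ^ ?n))
    \<le> 16 * B - ?c * (K * (sphere_area ?n * E - 1))"
    using BB[of k] lower c by (intro diff_mono mult_left_mono) auto
  also have "?c * (K * (sphere_area ?n * E - 1)) = K * ((?c * sphere_area ?n) * E) - ?c * K"
    by (simp add: algebra_simps)
  also have "?c * sphere_area ?n = 2" by (rule log_lap_c_sphere_area[OF n])
  also have "K * (2 * E) = 16 * B + 4 / real ?n * (B * Q) + ?c * K + 1" using K by (simp add: E_def)
  finally show False by simp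
qed

text \<open>If some radius is bad, the infimum \<open>L\<close> of the bad radii is positive and, by
  continuity in the radius, not bad itself. A strictly positive gap at \<open>L\<close> would allow
  continuation past the infimum; so the gap has a zero inside the ball, vanishes there by the strong
  maximum principle, and vanishes outside because it is odd.\<close>

lemma kelvin_dichotomy:
  fixes u :: "'a::euclidean_space \<Rightarrow> real" and a :: 'a
  assumes sol: "log_lap_solution u"
  shows "(\<exists>l>0. \<forall>x. x \<noteq> a \<longrightarrow> kelvin a l u x = u x)
    \<or> (\<forall>l>0. \<forall>x. x \<noteq> a \<longrightarrow> norm (x - a) < l \<longrightarrow> u x \<le> kelvin a l u x)"
proof (rule disjCI)
  let ?W = "\<lambda>l. kelvin_gap a l u"
  define good where "good = (\<lambda>l. \<forall>y. y \<noteq> a \<longrightarrow> norm (y - a) < l \<longrightarrow> 0 \<le> ?W l y)"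
  assume "\<not> (\<forall>l>0. \<forall>x. x \<noteq> a \<longrightarrow> norm (x - a) < l \<longrightarrow> u x \<le> kelvin a l u x)"
  then obtain l1 x1 where "l1 > 0" "x1 \<noteq> a" "norm (x1 - a) < l1" "\<not> u x1 \<le> kelvin a l1 u x1" by blast
  then have l1: "l1 > 0" "\<not> good l1" unfolding good_def using kelvin_gap_sign(2) by blast+
  obtain l0 where l0: "l0 > 0"
    "\<And>l y. 0 < l \<Longrightarrow> l < l0 \<Longrightarrow> y \<noteq> a \<Longrightarrow> norm (y - a) < l \<Longrightarrow> 0 \<le> ?W l y"
    using kelvin_gap_nonneg_small[OF sol] by metis
  define S where "S = {l. l > 0 \<and> \<not> good l}"
  have S: "S \<noteq> {}" "bdd_below S" using l1 by (auto simp: S_def intro!: bdd_belowI[of _ 0])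
  define L where "L = Inf S"
  have "l0 \<le> L" unfolding L_def
  proof (rule cInf_greatest[OF S(1)])
    fix l assume "l \<in> S"
    then show "l0 \<le> l" using l0(2)[of l] unfolding S_def good_def by force
  qed
  then have L: "L > 0" using l0 by simp
  have below: "good l" if "0 < l" "l < L" for l
    using that cInf_lower[OF _ S(2), of l] unfolding L_def[symmetric] by (force simp: S_def)
  have gL: "0 \<le> ?W L y" if y: "y \<noteq> a" "norm (y - a) < L" for y
  proof -
    have "((\<lambda>l. kelvin a l u y) \<longlongrightarrow> kelvin a L u y) (at_left L)"
      using sol by (intro kelvin_tendsto[OF _ y(1)] tendsto_ident_at) (auto simp: log_lap_solution_def)
    moreover have "\<forall>\<^sub>F l in at_left L. u y \<le> kelvin a l u y"
      using eventually_at_left_real[OF y(2)]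
    proof eventually_elim
      case (elim l)
      have lp: "l > 0" using elim by (auto intro: le_less_trans[OF norm_ge_zero])
      have "0 \<le> ?W l y" using below[OF lp] elim y by (auto simp: good_def)
      then show ?case using kelvin_gap_sign(2)[OF lp y(1)] by blast
    qed
    ultimately have "u y \<le> kelvin a L u y" by (rule tendsto_lowerbound) simp
    then show ?thesis using kelvin_gap_sign(2)[OF L y(1)] by blast
  qed
  have "\<exists>x. x \<noteq> a \<and> norm (x - a) < L \<and> ?W L x = 0"
  proof (rule ccontr)
    assume "\<not> ?thesis"
    then have "0 < ?W L y" if "y \<noteq> a" "norm (y - a) < L" for y
      using gL[OF that] that by (metis order_le_imp_less_or_eq)
    from kelvin_gap_nonneg_beyond[OF sol L this]
    obtain \<delta> where \<delta>: "\<delta> > 0" "\<And>l. L < l \<Longrightarrow> l < L + \<delta> \<Longrightarrow> good l"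
      unfolding good_def by blast
    have "L + \<delta> \<le> Inf S"
    proof (rule cInf_greatest[OF S(1)])
      fix l assume l: "l \<in> S"
      then have "l > 0" "\<not> good l" by (auto simp: S_def)
      moreover have "good L" using gL by (simp add: good_def)
      ultimately show "L + \<delta> \<le> l" using below[of l] \<delta>(2)[of l] by (metis linorder_neqE_linordered_idom not_less)
    qed
    then show False using \<delta>(1) by (simp add: L_def)
  qed
  then obtain x where x: "x \<noteq> a" "norm (x - a) < L" "?W L x = 0" by blast
  have inside: "?W L y = 0" if "y \<noteq> a" "norm (y - a) < L" for y
    by (rule kelvin_gap_strong_maximum[OF sol gL x that])
  have "?W L y = 0" if y: "y \<noteq> a" for y
  proof -
    consider "norm (y - a) < L" | "norm (y - a) = L" | "L < norm (y - a)" by linarith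
    then show ?thesis
    proof cases
      case 1
      then show ?thesis using inside y by blast
    next
      case 2
      then show ?thesis by (simp add: kelvin_gap_def sphere_inv_on_sphere)
    next
      case 3
      have "norm (sphere_inv a L y - a) < L"
        using 3 L mult_strict_left_mono[OF 3 L] less_trans[OF L 3]
        by (simp add: norm_sphere_inv_center pos_divide_less_eq power2_eq_square)
      then have "?W L (sphere_inv a L y) = 0" using inside y L by (simp add: sphere_inv_eq_center_iff)
      then show ?thesis using L by (simp add: kelvin_gap_sphere_inv)
    qed
  qed
  then show "\<exists>l>0. \<forall>x. x \<noteq> a \<longrightarrow> kelvin a l u x = u x"
    using L kelvin_gap_sign(3)[OF L] by blast
qed

section \<open>Classification\<close>

lemma constant_not_L10:
  assumes "C > 0"
  shows "(\<lambda>_::'a::euclidean_space. C) \<notin> L10"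
proof
  assume "(\<lambda>_::'a. C) \<in> L10"
  then have i: "integrable lborel (\<lambda>y::'a. C / (1 + norm y ^ DIM('a)))" by (simp add: L10_borel_iff)
  let ?s = "sphere_area DIM('a)"
  have s: "?s > 0" by (rule sphere_area_pos) simp
  define I where "I = (LINT y|lborel. C / (1 + norm (y::'a) ^ DIM('a)))"
  have nn: "1 + norm y ^ DIM('a) > 0" for y :: 'a by (rule one_plus_norm_power_pos)
  have le: "C / 2 * (?s * ln T) \<le> I" if T: "T \<ge> 1" for T
  proof -
    let ?A = "{y::'a. 1 \<le> norm (y - 0) \<and> norm (y - 0) \<le> T}"
    have [measurable]: "?A \<in> sets borel" by measurable
    have iA: "integrable lborel (\<lambda>y::'a. indicator ?A y / norm (0 - y) ^ DIM('a))"
      by (rule integrable_annulus[where s = 1 and R = T]) auto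
    have "C / 2 * (?s * ln T) = C / 2 * (LINT y|lborel. indicator ?A y / norm (0 - y) ^ DIM('a))"
      using T by (subst integral_annulus) auto
    also have "\<dots> = (LINT y|lborel. C / 2 * (indicator ?A y / norm (0 - y) ^ DIM('a)))"
      by (rule integral_mult_right_zero[symmetric])
    also have "\<dots> \<le> I"
      unfolding I_def
    proof (rule integral_mono[OF integrable_mult_right[OF iA] i])
      fix y :: 'a
      show "C / 2 * (indicator ?A y / norm (0 - y) ^ DIM('a)) \<le> C / (1 + norm y ^ DIM('a))"
      proof (cases "y \<in> ?A")
        case True
        then have "1 \<le> norm y ^ DIM('a)" by simp
        then have "C / (2 * norm y ^ DIM('a)) \<le> C / (1 + norm y ^ DIM('a))"
          using assms nn[of y] by (intro divide_left_mono mult_pos_pos) auto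
        then show ?thesis using True by simp
      next
        case False
        then have "indicator ?A y = (0::real)" by simp
        then show ?thesis using assms nn[of y] by (simp only:) (simp add: less_imp_le)
      qed
    qed
    finally show ?thesis .
  qed
  have "I \<ge> 0" using le[of 1] by simp
  then have "C / 2 * (?s * ln (exp ((I + 1) / (C / 2 * ?s)))) \<le> I"
    using assms s by (intro le) simp
  moreover have "C / 2 * (?s * ln (exp ((I + 1) / (C / 2 * ?s)))) = I + 1"
    using assms s by simp
  ultimately show False by simp
qed

text \<open>The sphere centred at \<open>y - R *\<^sub>R e\<close> that exchanges \<open>y\<close>
  and \<open>z\<close> flattens to a hyperplane as \<open>R\<close> grows, and its conformal factor
  \<open>l / R\<close> tends to 1. This gives \<open>u y \<le> u z\<close>, and the roles of the two
  points can be interchanged.\<close>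

lemma Kelvin_monotone_imp_constant:
  fixes u :: "'a::euclidean_space \<Rightarrow> real"
  assumes mono: "\<And>a l x. l > 0 \<Longrightarrow> x \<noteq> a \<Longrightarrow> norm (x - a) < l \<Longrightarrow> u x \<le> kelvin a l u x"
  shows "u y = u z"
proof -
  have le: "u y \<le> u z" if yz: "y \<noteq> z" for y z
  proof -
    define d where "d = norm (z - y)"
    define e where "e = (1 / d) *\<^sub>R (z - y)"
    have d: "d > 0" using yz by (simp add: d_def)
    have e: "norm e = 1" "z = y + d *\<^sub>R e" using d by (simp_all add: e_def d_def)
    have "u y \<le> sqrt (1 + d * (1 / real (Suc k))) ^ DIM('a) * u z" for k
    proof -
      define R where "R = real (Suc k)"
      have R: "R > 0" by (simp add: R_def)
      define a where "a = y - R *\<^sub>R e"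
      define l where "l = sqrt (R * (R + d))"
      have l2: "l\<^sup>2 = R * (R + d)" using R d by (simp add: l_def)
      have l: "l > 0" using R d by (simp add: l_def)
      have ya: "y - a = R *\<^sub>R e" by (simp add: a_def)
      have nya: "norm (y - a) = R" using R e by (simp add: ya)
      have "R\<^sup>2 < l\<^sup>2" unfolding l2 using R d by (simp add: power2_eq_square)
      then have Rl: "R < l" using l by (rule power2_less_imp_less[OF _ less_imp_le])
      have "l\<^sup>2 / R\<^sup>2 * R = R + d" unfolding l2 using R by (simp add: power2_eq_square)
      then have "sphere_inv a l y = a + (R + d) *\<^sub>R e" unfolding sphere_inv_def unfolding nya unfolding ya by simp
      also have "\<dots> = z" unfolding e(2) a_def by (simp add: scaleR_left_distrib)
      finally have i: "sphere_inv a l y = z" .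
      have "l / R = sqrt (1 + d * (1 / R))"
      proof -
        have "l / R = sqrt (R * (R + d)) / sqrt (R\<^sup>2)" using R by (simp add: l_def)
        also have "\<dots> = sqrt (R * (R + d) / R\<^sup>2)" by (simp only: real_sqrt_divide)
        also have "R * (R + d) / R\<^sup>2 = 1 + d * (1 / R)" using R by (simp add: field_simps power2_eq_square)
        finally show ?thesis .
      qed
      moreover have "u y \<le> kelvin a l u y"
        using nya Rl R by (intro mono l) auto
      ultimately show ?thesis unfolding kelvin_def i nya R_def by simp
    qed
    moreover have "(\<lambda>k. sqrt (1 + d * (1 / real (Suc k))) ^ DIM('a) * u z) \<longlonglongrightarrow> sqrt (1 + d * 0) ^ DIM('a) * u z"
      by (intro tendsto_intros LIMSEQ_Suc[OF lim_const_over_n])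
    ultimately have "u y \<le> sqrt (1 + d * 0) ^ DIM('a) * u z" by (intro LIMSEQ_le_const) auto
    then show ?thesis by simp
  qed
  show ?thesis using le[of y z] le[of z y] by (cases "y = z") auto
qed

text \<open>If the comparison held for all radii around some centre, \<open>u\<close> would decay more slowly than
  every multiple of \<open>norm x powr - n\<close>; an exact symmetry around any other centre excludes this.\<close>

lemma Kelvin_symmetric_every_center:
  fixes u :: "'a::euclidean_space \<Rightarrow> real"
  assumes sol: "log_lap_solution u"
  shows "\<exists>l>0. \<forall>x. x \<noteq> a \<longrightarrow> kelvin a l u x = u x"
proof (rule ccontr)
  assume no: "\<not> ?thesis"
  let ?n = "DIM('a)"
  have u: "u \<in> L10" "u \<in> Dini_space" using sol by (auto simp: log_lap_solution_def)
  have up: "u y > 0" for y by (rule log_lap_solution_pos[OF sol])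
  have mono_a: "u x \<le> kelvin a l u x" if "l > 0" "x \<noteq> a" "norm (x - a) < l" for l x
    using kelvin_dichotomy[OF sol, of a] no that by blast
  show False
  proof (cases "\<exists>p. \<exists>l>0. \<forall>x. x \<noteq> p \<longrightarrow> kelvin p l u x = u x")
    case False
    then have mono: "u x \<le> kelvin b l u x" if "l > 0" "x \<noteq> b" "norm (x - b) < l" for b l x
      using kelvin_dichotomy[OF sol, of b] that by blast
    have "u y = u 0" for y by (rule Kelvin_monotone_imp_constant[OF mono])
    then have eq: "u = (\<lambda>_::'a. u 0)" by (rule ext)
    have "(\<lambda>_::'a. u 0) \<in> L10" using u(1) by (subst (asm) eq)
    then show False using constant_not_L10[OF up] by blast
  next
    case True
    then obtain p L where L: "L > 0" and sym: "\<And>x. x \<noteq> p \<Longrightarrow> kelvin p L u x = u x" by blast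
    obtain M where M: "\<And>y. norm (y - p) \<le> L \<Longrightarrow> \<bar>u y\<bar> \<le> M"
      by (rule continuous_on_cball_bounded[OF Dini_space_continuous_on[OF u(2), of "cball p L"]]) blast
    have "\<bar>u p\<bar> \<le> M" using L by (intro M) simp
    then have M0: "0 \<le> M" by linarith
    have une: "u y \<noteq> 0" for y using up[of y] by simp
    have cu: "continuous_on (cball a 1) (\<lambda>y. 1 / u y)"
      using une by (intro continuous_intros Dini_space_continuous_on[OF u(2)]) auto
    obtain m' where m': "\<And>y. norm (y - a) \<le> 1 \<Longrightarrow> \<bar>1 / u y\<bar> \<le> m'"
      by (rule continuous_on_cball_bounded[OF cu]) blast
    have "0 < 1 / u a" "1 / u a \<le> m'" using m'[of a] up[of a] by simp_all
    then have m'0: "m' > 0" by linarith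
    define m where "m = 1 / m'"
    have m: "m > 0" using m'0 by (simp add: m_def)
    have um: "m \<le> u y" if "norm (y - a) \<le> 1" for y
      using m'[OF that] up[of y] m'0 by (simp add: m_def field_simps)
    obtain e :: 'a where e: "norm e = 1" using norm_Basis nonempty_Basis by blast
    \<comment> \<open>Impossible for large \<open>l\<close>, since the right-hand side is fixed. A
      point at distance \<open>R\<close> from \<open>a\<close> has value at most a constant times
      \<open>1 / R ^ n\<close> by the symmetry around \<open>p\<close>. Its reflection lies near
      \<open>a\<close>, where \<open>u\<close> is at least \<open>m\<close>, and the comparison
      reads \<open>l ^ n * u ?y \<le> R ^ n * u x\<close>, in which \<open>R\<close>
      cancels.\<close>
    have bound: "l ^ ?n * m \<le> M * L ^ ?n * 2 ^ ?n" if l: "l > 0" for l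
    proof -
      \<comment> \<open>\<open>R \<ge> l\<^sup>2\<close> brings the reflected point within distance
        1 of \<open>a\<close>; the other summands put \<open>x\<close> outside the ball of radius
        \<open>l\<close> around \<open>a\<close> and at distance at least \<open>L\<close> and
        \<open>R / 2\<close> from \<open>p\<close>.\<close>
      define R where "R = l + l\<^sup>2 + L + 2 * norm (a - p) + L + 1"
      have R: "R > l" "R \<ge> l\<^sup>2" "R \<ge> 2 * norm (a - p)" "R > 0" "R - norm (a - p) \<ge> L"
      proof -
        have "0 \<le> norm (a - p)" "0 \<le> l\<^sup>2" by simp_all
        then show "R > l" "R \<ge> l\<^sup>2" "R \<ge> 2 * norm (a - p)" "R > 0" "R - norm (a - p) \<ge> L"
          using l L unfolding R_def by linarith+
      qed
      define x where "x = a + R *\<^sub>R e"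
      have xa: "norm (x - a) = R" using R e by (simp add: x_def)
      have xna: "x \<noteq> a" using xa R by auto
      have xp: "norm (x - p) \<ge> R - norm (a - p)"
        using norm_triangle_ineq4[of "x - p" "a - p"] xa by simp
      have xp2: "norm (x - p) \<ge> R / 2" using xp R(3) by simp
      have xpL: "norm (x - p) \<ge> L" using xp R(5) by simp
      have xnp: "x \<noteq> p" using xpL L by auto
      let ?y = "sphere_inv a l x"
      have ya: "norm (?y - a) = l\<^sup>2 / R" by (simp add: norm_sphere_inv_center xa)
      have "l\<^sup>2 / R \<le> 1" using R by simp
      then have m1: "m \<le> u ?y" by (intro um) (simp add: ya)
      have "l * l < R * l" using R(1) l by (intro mult_strict_right_mono) auto
      then have yl: "norm (?y - a) < l" unfolding ya using R by (simp add: pos_divide_less_eq power2_eq_square mult.commute)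
      have yna: "?y \<noteq> a" using xna l by (simp add: sphere_inv_eq_center_iff)
      have "u ?y \<le> (l / (l\<^sup>2 / R)) ^ ?n * u x"
        using mono_a[OF l yna yl] l unfolding kelvin_def ya by simp
      also have "l / (l\<^sup>2 / R) = R / l" using l by (simp add: power2_eq_square)
      finally have 1: "l ^ ?n * u ?y \<le> R ^ ?n * u x" using l by (simp add: power_divide field_simps)
      have 2: "l ^ ?n * m \<le> l ^ ?n * u ?y" using m1 l by (intro mult_left_mono) auto
      have 3: "u x \<le> (L / norm (x - p)) ^ ?n * M"
      proof -
        have "norm (sphere_inv p L x - p) \<le> L"
          using xpL L mult_left_mono[OF xpL less_imp_le[OF L]] less_le_trans[OF L xpL]
          by (simp add: norm_sphere_inv_center pos_divide_le_eq power2_eq_square)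
        then have "u (sphere_inv p L x) \<le> M" using M[of "sphere_inv p L x"] by simp
        then have "(L / norm (x - p)) ^ ?n * u (sphere_inv p L x) \<le> (L / norm (x - p)) ^ ?n * M"
          using L by (intro mult_left_mono) auto
        then show ?thesis using sym[OF xnp] by (simp add: kelvin_def)
      qed
      have 4: "(L / norm (x - p)) ^ ?n * M \<le> (L * 2 / R) ^ ?n * M"
      proof (intro mult_right_mono power_mono)
        have "norm (x - p) > 0" using xnp by simp
        then have "L / norm (x - p) \<le> L / (R / 2)" using xp2 L R(4) by (intro divide_left_mono mult_pos_pos) auto
        then show "L / norm (x - p) \<le> L * 2 / R" by simp
        show "0 \<le> M" by (rule M0)
      qed (use L in auto)
      have "R ^ ?n * u x \<le> R ^ ?n * ((L * 2 / R) ^ ?n * M)"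
        using R(4) by (intro mult_left_mono order_trans[OF 3 4]) auto
      then have "l ^ ?n * m \<le> R ^ ?n * ((L * 2 / R) ^ ?n * M)" using 1 2 by linarith
      also have "\<dots> = (R * (L * 2 / R)) ^ ?n * M" by (simp only: power_mult_distrib mult.assoc)
      also have "R * (L * 2 / R) = L * 2" using R(4) by simp
      finally show ?thesis by (simp add: power_mult_distrib mult_ac)
    qed
    define C where "C = M * L ^ ?n * 2 ^ ?n / m + 1"
    have C: "C \<ge> 1" using M0 L m by (simp add: C_def)
    have "C \<le> C ^ ?n" using C by (intro self_le_power) auto
    then have "C * m \<le> C ^ ?n * m" using m by simp
    also have "\<dots> \<le> M * L ^ ?n * 2 ^ ?n" using C by (intro bound) simp
    finally have "C * m \<le> M * L ^ ?n * 2 ^ ?n" .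
    then show False using m by (simp add: C_def algebra_simps)
  qed
qed

text \<open>Comparing the extrema of \<open>F s - s\<^sup>2 - c * s\<close> on an interval with the values of \<open>F\<close> at
  infinity, to which the inversion sends the extremal points, shows that every chord of
  \<open>F s - s\<^sup>2\<close> has the same slope; no differentiability is needed.\<close>

lemma inversion_invariant_quadratic:
  fixes F :: "real \<Rightarrow> real"
  assumes cont: "continuous_on UNIV F" and pos: "\<And>a. F a > 0"
    and inv: "\<And>a x. x \<noteq> a \<Longrightarrow> F (a + F a / (x - a)) * (x - a)\<^sup>2 = F a * F x"
  shows "\<exists>c. \<forall>s. F s = s\<^sup>2 + c * s + F 0"
proof -
  define P where "P = (\<lambda>s. F s - s\<^sup>2)"
  \<comment> \<open>The inversion around \<open>a\<close> sends \<open>x\<close> to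
    \<open>a + h\<close>. The left-hand side is the increment of \<open>P s - c * s\<close> from
    \<open>a\<close> to \<open>a + h\<close>, so increments from \<open>a\<close> are rescaled by
    the positive factor \<open>h / (x - a)\<close> and keep their sign, for every slope
    \<open>c\<close>.\<close>
  have step: "F (a + h) - F a - 2 * a * h - h\<^sup>2 - c * h = (P x - c * x - (P a - c * a)) * (h / (x - a))"
    if "x > a" "h = F a / (x - a)" for a x h c
  proof -
    have d: "x - a > 0" using that by simp
    have "F (a + h) * (x - a)\<^sup>2 = F a * F x" using inv[of x a] d unfolding that(2) by simp
    then have Fh: "F (a + h) = F a * F x / (x - a)\<^sup>2" using d by (simp add: eq_divide_eq)
    define d where "d = x - a"
    have d0: "d > 0" using that by (simp add: d_def)
    have e: "P x - c * x - (P a - c * a) = F x - d\<^sup>2 - 2 * a * d - F a - c * d"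
      by (simp add: P_def d_def power2_eq_square algebra_simps)
    show ?thesis unfolding e Fh unfolding that(2) d_def[symmetric] using d0
      by (simp add: field_simps power2_eq_square)
  qed
  have ev: "\<exists>K. \<forall>\<^sub>F x in at_top. \<bar>P x - c * x\<bar> \<le> K"
    if pq: "p < q" and c: "P p - c * p = P q - c * q" for p q c
  proof -
    let ?G = "\<lambda>s. P s - c * s"
    have contG: "continuous_on {p..q} ?G"
      unfolding P_def by (intro continuous_intros continuous_on_subset[OF cont]) auto
    have ne: "{p..q} \<noteq> {}" using pq by simp
    obtain a0 where a0: "a0 \<in> {p..q}" "\<And>s. s \<in> {p..q} \<Longrightarrow> ?G s \<le> ?G a0"
      using continuous_attains_sup[OF compact_Icc ne contG] by blast
    obtain b0 where b0: "b0 \<in> {p..q}" "\<And>s. s \<in> {p..q} \<Longrightarrow> ?G b0 \<le> ?G s"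
      using continuous_attains_inf[OF compact_Icc ne contG] by blast
    \<comment> \<open>An extremum at the right end is moved to the left end, where the value is the
      same: the reflection of a large \<open>x\<close> lies to the right of \<open>a\<close> and
      must still fall into the interval.\<close>
    define a where "a = (if a0 = q then p else a0)"
    define b where "b = (if b0 = q then p else b0)"
    have a: "p \<le> a" "a < q" "\<And>s. s \<in> {p..q} \<Longrightarrow> ?G s \<le> ?G a"
      using a0 c pq by (auto simp: a_def)
    have b: "p \<le> b" "b < q" "\<And>s. s \<in> {p..q} \<Longrightarrow> ?G b \<le> ?G s"
      using b0 c pq by (auto simp: b_def)
    have reflect: "\<exists>s\<in>{p..q}. \<exists>k>0. ?G s - ?G a = (?G x - ?G a) * k"
      if a: "p \<le> a" "a < q" and x: "x \<ge> a + F a / (q - a)" for a x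
    proof -
      have qa: "q - a > 0" using a by simp
      have "F a / (q - a) > 0" using pos[of a] qa by simp
      then have xa: "x > a" using x by linarith
      define h where "h = F a / (x - a)"
      have h0: "h > 0" using pos[of a] xa by (simp add: h_def)
      have "F a / (q - a) \<le> x - a" using x by simp
      then have "h \<le> q - a" using qa xa by (simp add: h_def field_simps)
      then have "a + h \<in> {p..q}" using a h0 by simp
      moreover have "?G (a + h) - ?G a = (?G x - ?G a) * (h / (x - a))"
        using step[OF xa h_def, of c] by (simp add: P_def power2_eq_square algebra_simps)
      moreover have "h / (x - a) > 0" using h0 xa by simp
      ultimately show ?thesis by blast
    qed
    have up: "?G x \<le> ?G a" if x: "x \<ge> a + F a / (q - a)" for x
    proof -
      obtain s k where "s \<in> {p..q}" "k > 0" "?G s - ?G a = (?G x - ?G a) * k"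
        using reflect[OF a(1,2) x] by blast
      then show ?thesis using a(3)[of s] mult_pos_pos[of "?G x - ?G a" k] by linarith
    qed
    have low: "?G b \<le> ?G x" if x: "x \<ge> b + F b / (q - b)" for x
    proof -
      obtain s k where "s \<in> {p..q}" "k > 0" "?G s - ?G b = (?G x - ?G b) * k"
        using reflect[OF b(1,2) x] by blast
      then show ?thesis using b(3)[of s] mult_neg_pos[of "?G x - ?G b" k] by linarith
    qed
    have "\<forall>\<^sub>F x in at_top. \<bar>P x - c * x\<bar> \<le> \<bar>?G a\<bar> + \<bar>?G b\<bar>"
      using eventually_ge_at_top[of "a + F a / (q - a)"] eventually_ge_at_top[of "b + F b / (q - b)"]
    proof eventually_elim
      case (elim x)
      show ?case using up[OF elim(1)] low[OF elim(2)] by linarith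
    qed
    then show ?thesis by blast
  qed
  have unique: "c = d" if "\<forall>\<^sub>F x in at_top. \<bar>P x - c * x\<bar> \<le> K" "\<forall>\<^sub>F x in at_top. \<bar>P x - d * x\<bar> \<le> K'" for c d K K'
  proof (rule ccontr)
    assume cd: "c \<noteq> d"
    have "\<forall>\<^sub>F x in at_top. \<bar>P x - c * x\<bar> \<le> K \<and> \<bar>P x - d * x\<bar> \<le> K' \<and> x > (K + K') / \<bar>c - d\<bar> \<and> x > 0"
      using that eventually_gt_at_top by (intro eventually_conj) auto
    then obtain x where x: "\<bar>P x - c * x\<bar> \<le> K" "\<bar>P x - d * x\<bar> \<le> K'" "x > (K + K') / \<bar>c - d\<bar>" "x > 0"
      using eventually_happens'[OF trivial_limit_at_top_linorder] by blast
    have "(c - d) * x = (P x - d * x) - (P x - c * x)" by (simp add: algebra_simps)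
    then have "\<bar>(c - d) * x\<bar> \<le> K + K'" using x(1,2) by linarith
    then have "x * \<bar>c - d\<bar> \<le> K + K'" using x(4) by (simp add: abs_mult mult.commute)
    then show False using x(3) cd by (simp add: pos_divide_less_eq)
  qed
  define c where "c = P 1 - P 0"
  obtain K where K: "\<forall>\<^sub>F x in at_top. \<bar>P x - c * x\<bar> \<le> K" using ev[of 0 1 c] by (auto simp: c_def)
  have slope: "P q - P p = c * (q - p)" if pq: "p < q" for p q
  proof -
    define d where "d = (P q - P p) / (q - p)"
    have d: "d * (q - p) = P q - P p" using pq by (simp add: d_def)
    then have "P p - d * p = P q - d * q" by (simp add: algebra_simps)
    then obtain K' where "\<forall>\<^sub>F x in at_top. \<bar>P x - d * x\<bar> \<le> K'" using ev[OF pq] by blast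
    then have "c = d" by (rule unique[OF K])
    then show ?thesis using d by simp
  qed
  have Ps: "P s = c * s + P 0" for s
    using slope[of 0 s] slope[of s 0] by (cases s "0::real" rule: linorder_cases) auto
  have "F s = s\<^sup>2 + c * s + F 0" for s using Ps[of s] by (simp add: P_def)
  then show ?thesis by (intro exI[of _ c] allI)
qed

text \<open>Additivity comes from the line through \<open>2 *\<^sub>R x\<close> and
  \<open>2 *\<^sub>R y\<close>, whose midpoint is \<open>x + y\<close>.\<close>

lemma affine_on_lines_imp_inner:
  fixes g :: "'a::euclidean_space \<Rightarrow> real"
  assumes line: "\<And>p v. \<exists>c. \<forall>s. g (p + s *\<^sub>R v) = g p + c * s"
  shows "\<exists>w. \<forall>x. g x = x \<bullet> w + g 0"
proof -
  define h where "h = (\<lambda>x. g x - g 0)"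
  have scale: "h (s *\<^sub>R x) = s * h x" for s x
  proof -
    obtain c where c: "\<And>s. g (0 + s *\<^sub>R x) = g 0 + c * s" using line by blast
    show ?thesis using c[of s] c[of 1] by (simp add: h_def)
  qed
  have add: "h (x + y) = h x + h y" for x y
  proof -
    obtain c where c: "\<And>s. g (2 *\<^sub>R x + s *\<^sub>R (2 *\<^sub>R y - 2 *\<^sub>R x)) = g (2 *\<^sub>R x) + c * s" using line by blast
    have "2 *\<^sub>R x + (1/2) *\<^sub>R (2 *\<^sub>R y - 2 *\<^sub>R x) = x + y"
      by (simp add: scaleR_diff_right flip: scaleR_add_left)
         (simp add: scaleR_2)
    then have "2 * h (x + y) = h (2 *\<^sub>R x) + h (2 *\<^sub>R y)" using c[of "1/2"] c[of 1] by (simp add: h_def)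
    then show ?thesis by (simp add: scale)
  qed
  have "linear h" by (intro linearI) (simp_all add: add scale)
  then have hx: "h x = x \<bullet> adjoint h 1" for x by (simp add: adjoint_works)
  have "g x = x \<bullet> adjoint h 1 + g 0" for x unfolding hx[symmetric] by (simp add: h_def)
  then show ?thesis by (intro exI[of _ "adjoint h 1"] allI)
qed

text \<open>Both sides are the limit of \<open>norm x ^ n * u x\<close> along one fixed ray: the
  symmetry around any centre sends distant points to the vicinity of that centre, where
  \<open>u\<close> is continuous.\<close>

lemma Kelvin_symmetric_level:
  fixes u :: "'a::euclidean_space \<Rightarrow> real"
  assumes u: "u \<in> Dini_space" and l: "\<And>a. l a > 0"
    and sym: "\<And>a x. x \<noteq> a \<Longrightarrow> kelvin a (l a) u x = u x"
  shows "l a ^ DIM('a) * u a = l b ^ DIM('a) * u b"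
proof -
  let ?n = "DIM('a)"
  obtain e :: 'a where e: "norm e = 1" using norm_Basis nonempty_Basis by blast
  have lim: "(\<lambda>k. real (Suc k) ^ ?n * u (real (Suc k) *\<^sub>R e)) \<longlonglongrightarrow> l a ^ ?n * u a" for a
  proof -
    define r where "r = (\<lambda>k. norm (e - (1 / real (Suc k)) *\<^sub>R a))"
    have "(\<lambda>k. e - (1 / real (Suc k)) *\<^sub>R a) \<longlonglongrightarrow> e - 0 *\<^sub>R a"
      by (intro tendsto_intros LIMSEQ_Suc[OF lim_const_over_n])
    then have r: "r \<longlonglongrightarrow> 1" unfolding r_def using e tendsto_norm by fastforce
    have nx: "norm (real (Suc k) *\<^sub>R e - a) = real (Suc k) * r k" for k
    proof -
      have "real (Suc k) *\<^sub>R e - a = real (Suc k) *\<^sub>R (e - (1 / real (Suc k)) *\<^sub>R a)"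
        by (simp add: scaleR_diff_right del: of_nat_Suc)
      then show ?thesis unfolding r_def by (simp del: of_nat_Suc)
    qed
    have pos: "\<forall>\<^sub>F k in sequentially. 0 < r k" using order_tendstoD(1)[OF r, of 0] by simp
    have "(\<lambda>k. (l a)\<^sup>2 * (1 / real (Suc k)) / r k) \<longlonglongrightarrow> (l a)\<^sup>2 * 0 / 1"
      by (intro tendsto_intros LIMSEQ_Suc[OF lim_const_over_n] r) simp
    moreover have "norm (sphere_inv a (l a) (real (Suc k) *\<^sub>R e) - a) = (l a)\<^sup>2 * (1 / real (Suc k)) / r k" for k
      unfolding norm_sphere_inv_center nx by simp
    ultimately have "(\<lambda>k. norm (sphere_inv a (l a) (real (Suc k) *\<^sub>R e) - a)) \<longlonglongrightarrow> 0" by simp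
    then have "(\<lambda>k. sphere_inv a (l a) (real (Suc k) *\<^sub>R e)) \<longlonglongrightarrow> a"
      by (simp add: LIM_zero_iff tendsto_norm_zero_iff)
    moreover have "isCont u a" using u Dini_continuous_at_imp_isCont by (auto simp: Dini_space_def)
    ultimately have "(\<lambda>k. u (sphere_inv a (l a) (real (Suc k) *\<^sub>R e))) \<longlonglongrightarrow> u a"
      by (rule isCont_tendsto_compose[rotated])
    then have "(\<lambda>k. (l a / r k) ^ ?n * u (sphere_inv a (l a) (real (Suc k) *\<^sub>R e))) \<longlonglongrightarrow> (l a / 1) ^ ?n * u a"
      by (intro tendsto_intros r) auto
    moreover have "\<forall>\<^sub>F k in sequentially. (l a / r k) ^ ?n * u (sphere_inv a (l a) (real (Suc k) *\<^sub>R e))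
       = real (Suc k) ^ ?n * u (real (Suc k) *\<^sub>R e)"
      using pos
    proof eventually_elim
      case (elim k)
      define K where "K = real (Suc k)"
      have K: "K > 0" by (simp add: K_def)
      have "K *\<^sub>R e \<noteq> a" using nx[of k] elim K unfolding K_def[symmetric] by auto
      from sym[OF this] have "u (K *\<^sub>R e) = (l a / (K * r k)) ^ ?n * u (sphere_inv a (l a) (K *\<^sub>R e))"
        using nx[of k] unfolding kelvin_def K_def[symmetric] by simp
      then show ?case using K unfolding K_def[symmetric] by (simp add: power_divide power_mult_distrib)
    qed
    ultimately have "(\<lambda>k. real (Suc k) ^ ?n * u (real (Suc k) *\<^sub>R e)) \<longlonglongrightarrow> (l a / 1) ^ ?n * u a"
      by (rule Lim_transform_eventually)
    then show ?thesis by simp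
  qed
  show ?thesis by (rule LIMSEQ_unique[OF lim lim])
qed

text \<open>The operator is homogeneous of degree one while \<open>t * ln t\<close> is not; at the
  centre of the bubble the difference is a nonzero multiple of \<open>ln \<kappa>\<close>.\<close>

lemma scaled_bubble_solution_unique:
  fixes z :: "'a::euclidean_space"
  assumes t: "t > 0" and \<kappa>: "\<kappa> > 0" and sol: "log_lap_solution (\<lambda>x. \<kappa> * bubble z t x)"
  shows "\<kappa> = 1"
proof -
  let ?b = "bubble z t"
  have m: "?b \<in> borel_measurable borel" by (rule Dini_space_borel_measurable[OF bubble_Dini[OF t]])
  have b: "?b z > 0" by (rule bubble_pos[OF t])
  have "(LINT y|lborel. (\<kappa> * ?b z * indicator (ball z 1) y - \<kappa> * ?b y) / norm (z - y) ^ DIM('a))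
    = (LINT y|lborel. \<kappa> * ((?b z * indicator (ball z 1) y - ?b y) / norm (z - y) ^ DIM('a)))"
    by (intro Bochner_Integration.integral_cong) (auto simp: right_diff_distrib)
  also have "\<dots> = \<kappa> * (LINT y|lborel. (?b z * indicator (ball z 1) y - ?b y) / norm (z - y) ^ DIM('a))"
    by (rule integral_mult_right_zero)
  finally have "log_laplacian (\<lambda>x. \<kappa> * ?b x) z = \<kappa> * log_laplacian ?b z"
    using m by (simp add: log_laplacian_lborel algebra_simps)
  moreover have "log_laplacian (\<lambda>x. \<kappa> * ?b x) z = 4 / real DIM('a) * (\<kappa> * ?b z * ln (\<kappa> * ?b z))"
    using sol by (simp add: log_lap_solution_def)
  ultimately have "\<kappa> * ?b z * ln (\<kappa> * ?b z) = \<kappa> * (?b z * ln (?b z))"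
    unfolding log_laplacian_bubble[OF t] by simp
  then have "ln (\<kappa> * ?b z) = ln (?b z)" using \<kappa> b by simp
  then have "\<kappa> * ?b z = ?b z" using \<kappa> b by (subst (asm) ln_inj_iff) auto
  then show ?thesis using b by simp
qed

lemma log_lap_solution_imp_bubble:
  fixes u :: "'a::euclidean_space \<Rightarrow> real"
  assumes sol: "log_lap_solution u"
  shows "\<exists>z t. t > 0 \<and> u = bubble z t"
proof -
  let ?n = "DIM('a)"
  have n: "?n > 0" by simp
  have u: "u \<in> Dini_space" using sol by (simp add: log_lap_solution_def)
  have up: "u x > 0" for x by (rule log_lap_solution_pos[OF sol])
  obtain l where l: "\<And>a. l a > 0" and sym: "\<And>a x. x \<noteq> a \<Longrightarrow> kelvin a (l a) u x = u x"
    using Kelvin_symmetric_every_center[OF sol] by metis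
  define A where "A = l 0 ^ ?n * u 0"
  have A: "A > 0" using l up by (simp add: A_def)
  have level: "l a ^ ?n * u a = A" for a
    unfolding A_def by (rule Kelvin_symmetric_level[OF u l sym])
  have ua: "u a = A / l a ^ ?n" for a using level[of a] l[of a] by (simp add: field_simps)
  define f where "f = (\<lambda>a. (l a)\<^sup>2)"
  have fp: "f a > 0" for a using l[of a] by (simp add: f_def)
  \<comment> \<open>Once \<open>u\<close> is expressed through the radii, the symmetry is a
    statement about radii alone; cancelling \<open>A\<close> and taking roots removes the
    dimension.\<close>
  have rel: "f (sphere_inv a (l a) x) * (norm (x - a))\<^sup>2 = f a * f x" if xa: "x \<noteq> a" for a x
  proof -
    let ?y = "sphere_inv a (l a) x"
    have "(l a / norm (x - a)) ^ ?n * (A / l ?y ^ ?n) = A / l x ^ ?n"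
      using sym[OF xa] unfolding kelvin_def ua .
    then have "(l a * l x) ^ ?n = (l ?y * norm (x - a)) ^ ?n"
      using A l[of x] l[of ?y] xa by (simp add: field_simps power_mult_distrib power_divide)
    then have "l a * l x = l ?y * norm (x - a)"
      using l[of a] l[of x] l[of ?y] n by (subst (asm) power_eq_iff_eq_base) (auto simp: less_imp_le)
    then show ?thesis unfolding f_def by (metis power_mult_distrib)
  qed
  have contf: "continuous_on UNIV f"
  proof -
    have "l a = root ?n (A / u a)" for a
    proof -
      have "A / u a = l a ^ ?n" using level[of a] up[of a] by (simp add: field_simps)
      then show ?thesis using l[of a] n by (simp add: real_root_power_cancel)
    qed
    moreover have "continuous_on UNIV (\<lambda>a. (root ?n (A / u a))\<^sup>2)"
      using up by (intro continuous_intros Dini_space_continuous_on[OF u]) (auto simp: less_imp_neq[symmetric])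
    ultimately show ?thesis unfolding f_def by simp
  qed
  have line: "\<exists>c. \<forall>s. f (p + s *\<^sub>R e) = s\<^sup>2 + c * s + f p" if e: "norm e = 1" for p e
  proof -
    let ?F = "\<lambda>s. f (p + s *\<^sub>R e)"
    have "\<exists>c. \<forall>s. ?F s = s\<^sup>2 + c * s + ?F 0"
    proof (rule inversion_invariant_quadratic)
      show "continuous_on UNIV ?F"
        by (intro continuous_on_compose2[OF contf] continuous_intros) auto
      fix a x :: real assume xa: "x \<noteq> a"
      have ne: "e \<noteq> 0" using e by auto
      have d: "p + x *\<^sub>R e - (p + a *\<^sub>R e) = (x - a) *\<^sub>R e" by (simp add: scaleR_diff_left)
      have "sphere_inv (p + a *\<^sub>R e) (l (p + a *\<^sub>R e)) (p + x *\<^sub>R e)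
         = p + a *\<^sub>R e + (?F a / (x - a)\<^sup>2 * (x - a)) *\<^sub>R e"
        unfolding sphere_inv_def d using e by (simp add: f_def)
      also have "?F a / (x - a)\<^sup>2 * (x - a) = ?F a / (x - a)" using xa by (simp add: power2_eq_square)
      finally have "sphere_inv (p + a *\<^sub>R e) (l (p + a *\<^sub>R e)) (p + x *\<^sub>R e) = p + (a + ?F a / (x - a)) *\<^sub>R e"
        by (simp add: scaleR_left_distrib)
      then show "?F (a + ?F a / (x - a)) * (x - a)\<^sup>2 = ?F a * ?F x"
        using rel[of "p + x *\<^sub>R e" "p + a *\<^sub>R e"] xa ne e unfolding d by simp
    qed (rule fp)
    then show ?thesis by simp
  qed
  define g where "g = (\<lambda>x. f x - x \<bullet> x)"
  have "\<exists>c. \<forall>s. g (p + s *\<^sub>R v) = g p + c * s" for p v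
  proof (cases "v = 0")
    case False
    define e where "e = (1 / norm v) *\<^sub>R v"
    have e: "norm e = 1" and v: "v = norm v *\<^sub>R e" using False by (auto simp: e_def)
    have ee: "e \<bullet> e = 1" using e by (simp add: norm_eq_1)
    obtain c where c: "\<And>s. f (p + s *\<^sub>R e) = s\<^sup>2 + c * s + f p" using line[OF e] by blast
    have "g (p + s *\<^sub>R e) = g p + (c - 2 * (p \<bullet> e)) * s" for s
      unfolding g_def c using ee
      by (simp add: inner_add inner_commute power2_eq_square algebra_simps)
    then have "g (p + s *\<^sub>R v) = g p + ((c - 2 * (p \<bullet> e)) * norm v) * s" for s
      by (subst v) (simp add: mult_ac)
    then show ?thesis by blast
  qed auto
  from affine_on_lines_imp_inner[OF this] obtain w where w: "\<And>x. g x = x \<bullet> w + g 0" by blast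
  \<comment> \<open>Completes the square in \<open>x \<bullet> x + x \<bullet> w + g 0\<close>;
    positivity of \<open>f\<close> at \<open>z\<close> then makes the remainder
    \<open>\<tau>\<close> the square of a positive number.\<close>
  define z where "z = - (1/2) *\<^sub>R w"
  define \<tau> where "\<tau> = g 0 - z \<bullet> z"
  have w2: "w = - 2 *\<^sub>R z" by (simp add: z_def)
  have f: "f x = \<tau> + (norm (x - z))\<^sup>2" for x
    using w[of x] unfolding w2 \<tau>_def g_def power2_norm_eq_inner
    by (simp add: inner_diff inner_commute algebra_simps)
  have \<tau>: "\<tau> > 0" using fp[of z] f[of z] by simp
  define t where "t = sqrt \<tau>"
  have t: "t > 0" "t\<^sup>2 = \<tau>" using \<tau> by (auto simp: t_def)
  define \<kappa> where "\<kappa> = A / (bubble_const ?n * t powr (real ?n / 2))"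
  have \<kappa>: "\<kappa> > 0" using A t bubble_const_pos[of ?n] by (simp add: \<kappa>_def)
  have "u x = \<kappa> * bubble z t x" for x
  proof -
    have q: "t\<^sup>2 + (norm (x - z))\<^sup>2 > 0" using t(1) by (simp add: add_pos_nonneg)
    have "(t\<^sup>2 + (norm (x - z))\<^sup>2) powr (real ?n / 2) = ((l x)\<^sup>2) powr (real ?n / 2)"
      using f[of x] t(2) by (simp add: f_def)
    also have "\<dots> = l x ^ ?n" using l[of x] by (simp add: powr_powr flip: powr_numeral powr_realpow)
    finally have "bubble z t x = bubble_const ?n * (t powr (real ?n / 2) / l x ^ ?n)"
      unfolding bubble_def using t(1) q by (simp add: powr_divide)
    then show ?thesis unfolding ua[of x] \<kappa>_def using t(1) bubble_const_pos[of ?n] by simp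
  qed
  then have eq: "u = (\<lambda>x. \<kappa> * bubble z t x)" by (intro ext)
  have "\<kappa> = 1"
    by (rule scaled_bubble_solution_unique[OF t(1) \<kappa>]) (use sol in \<open>simp only: eq\<close>)
  then have "u = bubble z t" using eq by simp
  then show ?thesis using t(1) by blast
qed

theorem theorem1p1:
  shows "{u :: real ^ 'n \<Rightarrow> real. log_lap_solution u} = {bubble z t | z t. t > 0}"
proof (intro set_eqI iffI)
  fix u :: "real ^ 'n \<Rightarrow> real"
  assume "u \<in> {u. log_lap_solution u}"
  then show "u \<in> {bubble z t | z t. t > 0}" using log_lap_solution_imp_bubble[of u] by auto
next
  fix u :: "real ^ 'n \<Rightarrow> real"
  assume "u \<in> {bubble z t | z t. t > 0}"
  then obtain z t where "t > 0" "u = bubble z t" by blast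
  then show "u \<in> {u. log_lap_solution u}" using bubble_solution[of t z] by simp
qed

end
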